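(* Let $m\ge1$ be an integer and $0<\alpha<mn$. Let $p_1(\cdot),\dots,p_m(\cdot)\in LH$ be measurable functions on $\mathbb R^n$ with $0<(p_k)^-\le(p_k)^+<\infty$ for $1\le k\le m$ and $$\frac{1}{(p_1)^+}+\cdots+\frac1{(p_m)^+}>\frac{\alpha}{n}.$$ Define $q(\cdot)$ by $$\frac1{q(\cdot)}=\frac1{p_1(\cdot)}+\cdots+\frac1{p_m(\cdot)}-\frac{\alpha}{n}.$$ Then the multilinear fractional integral operator $\mathcal T_\alpha$ can be extended to a bounded operator from $H^{p_1(\cdot)}\times\cdots\times H^{p_m(\cdot)}$ into $L^{q(\cdot)}$.
   Context: **Operator.** For $0<\alpha<mn$, $$\mathcal T_\alpha(f_1,\dots,f_m)(x)=\int_{(\mathbb R^n)^m}\frac{1}{|(y_1,\dots,y_m)|^{mn-\alpha}}\prod_{k=1}^m f_k(x-y_k)\,dy_1\cdots dy_m .$$ "Can be extended to a bounded operator from $H_{X_1}\times\cdots\times H_{X_m}$ into $Y$" means: there are $C>0$, $d\in\mathbb Z_+$ and an $m$-linear operator $T:H_{X_1}\times\cdots\times H_{X_m}\to Y$ with $\|T(f_1,\dots,f_m)\|_Y\le C\prod_k\|f_k\|_{H_{X_k}}$ that agrees with $\mathcal T_\alpha$ whenever all $f_k$ are finite linear combinations of $(X_k,\infty,d)$-atoms. An $(X,\infty,d)$-atom is a measurable function $a$ supported in a cube $Q$ with $\|a\|_{L^\infty}\le \|\chi_Q\|_X^{-1}$ and $\int a(x)x^{\beta}dx=0$ for all multi-indices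 $|\beta|\le d$. Here $X_k=L^{p_k(\cdot)}$, $Y=L^{q(\cdot)}$. **Exponents.** For measurable $p(\cdot):\mathbb R^n\to(0,\infty)$, $p^-=\inf_{x\in\mathbb R^n}p(x)$, $p^+=\sup_{x\in\mathbb R^n}p(x)$. $p(\cdot)\in LH$ means that for some $C>0$: $|p(x)-p(y)|\le \frac{C}{-\log|x-y|}$ when $|x-y|\le1/2$, and $|p(x)-p(y)|\le\frac{C}{\log(|x|+e)}$ when $|y|\ge|x|$. **Spaces.** $L^{p(\cdot)}$ is the set of measurable $f$ such that $\int_{\mathbb R^n}|\varepsilon f(x)|^{p(x)}dx<\infty$ for some $\varepsilon>0$, with $\|f\|_{L^{p(\cdot)}}=\inf\{\lambda>0:\int_{\mathbb R^n}(|f(x)|/\lambda)^{p(x)}dx\le1\}$. For a sufficiently large fixed integer $N$, let $\mathcal F_N=\{\varphi\in\mathcal S(\mathbb R^n):\sum_{|\beta|\le N}\sup_x(1+|x|)^N|\partial^\beta\varphi(x)|\le1\}$ and, for $f\in\mathcal S'(\mathbb R^n)$, $\mathcal M_Nf(x)=\sup\{|\psi_t*f(x)|:t>0,\psi\in\mathcal F_N\}$, $\psi_t(x)=t^{-n}\psi(x/t)$. For $X=L^{p(\cdot)}$, $H^{p(\cdot)}=H_X$ is the set of $f\in\mathcal S'$ with $\|f\|_{H_X}:=\|\mathcal M_Nf\|_X<\infty$. *)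

theory Defs
  imports "HOL-Probability.Essential_Supremum"
begin

definition variable_exponent :: "(real^'n \<Rightarrow> real) \<Rightarrow> bool" where
  "variable_exponent p \<longleftrightarrow> p \<in> borel_measurable lebesgue \<and> (\<forall>x. 0 < p x)"

definition exponent_inf :: "(real^'n \<Rightarrow> real) \<Rightarrow> ereal" where
  "exponent_inf p = (INF x. ereal (p x))"

definition exponent_sup :: "(real^'n \<Rightarrow> real) \<Rightarrow> ereal" where
  "exponent_sup p = (SUP x. ereal (p x))"

text \<open>For \<open>x = y\<close> the first bound reads \<open>0 \<le> C / 0 = 0\<close>, since \<open>ln 0 = 0\<close>.\<close>

definition LH :: "(real^'n \<Rightarrow> real) set" where
  "LH = {p. \<exists>C>0.
     (\<forall>x y. norm (x - y) \<le> 1/2 \<longrightarrow> \<bar>p x - p y\<bar> \<le> C / (- ln (norm (x - y)))) \<and>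
     (\<forall>x y. norm x \<le> norm y \<longrightarrow> \<bar>p x - p y\<bar> \<le> C / ln (norm x + exp 1))}"

text \<open>
  Maximal functions may take the value \<open>\<infinity>\<close>, so modular and norm are defined for
  \<open>[0,\<infinity>]\<close>-valued functions; a complex function \<open>f\<close> enters through \<open>cmod_fun f\<close>.
  The power \<open>r\<^sup>s\<close> is only used with \<open>s > 0\<close>.
\<close>

definition epowr :: "ennreal \<Rightarrow> real \<Rightarrow> ennreal" where
  "epowr r s = (if r = \<infinity> then \<infinity> else ennreal (enn2real r powr s))"

definition cmod_fun :: "('a \<Rightarrow> complex) \<Rightarrow> 'a \<Rightarrow> ennreal" where
  "cmod_fun f x = ennreal (cmod (f x))"

definition modular :: "(real^'n \<Rightarrow> real) \<Rightarrow> (real^'n \<Rightarrow> ennreal) \<Rightarrow> ennreal" where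
  "modular p g = (\<integral>\<^sup>+x. epowr (g x) (p x) \<partial>lebesgue)"

definition Lp_norm :: "(real^'n \<Rightarrow> real) \<Rightarrow> (real^'n \<Rightarrow> ennreal) \<Rightarrow> ennreal" where
  "Lp_norm p g = Inf {ennreal l |l. 0 < l \<and> modular p (\<lambda>x. g x / ennreal l) \<le> 1}"

definition Lp_space :: "(real^'n \<Rightarrow> real) \<Rightarrow> (real^'n \<Rightarrow> complex) set" where
  "Lp_space p = {f \<in> borel_measurable lebesgue.
     \<exists>\<epsilon>>0. modular p (\<lambda>x. ennreal \<epsilon> * cmod_fun f x) < \<infinity>}"

definition partial_deriv :: "'n \<Rightarrow> (real^'n \<Rightarrow> complex) \<Rightarrow> real^'n \<Rightarrow> complex" where
  "partial_deriv i f x = vector_derivative (\<lambda>t. f (x + t *\<^sub>R axis i 1)) (at 0)"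

definition smooth :: "(real^'n \<Rightarrow> complex) \<Rightarrow> bool" where
  "smooth f \<longleftrightarrow> (\<forall>is x. foldr partial_deriv is f differentiable (at x))"

text \<open>
  A multi-index is a function \<open>\<beta> :: 'n \<Rightarrow> nat\<close>. The coordinates are not ordered, so
  \<open>\<partial>\<^sup>\<beta>\<close> differentiates in an arbitrary order in which coordinate \<open>i\<close> occurs \<open>\<beta> i\<close> times;
  for smooth functions the order is irrelevant.
\<close>

definition mi_order :: "('n \<Rightarrow> nat) \<Rightarrow> nat" where
  "mi_order \<beta> = (\<Sum>i\<in>UNIV. \<beta> i)"

definition mi_list :: "('n \<Rightarrow> nat) \<Rightarrow> 'n list" where
  "mi_list \<beta> = (SOME is. \<forall>i. count_list is i = \<beta> i)"

lemma count_list_mi_list: "count_list (mi_list \<beta>) i = \<beta> i" for \<beta> :: "'n::finite \<Rightarrow> nat"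
proof -
  have "\<exists>is. \<forall>i. count_list is i = (if i \<in> A then \<beta> i else 0)" if "finite A" for A
    using that
  proof induction
    case empty
    show ?case by (rule exI[of _ "[]"]) simp
  next
    case (insert a A)
    then obtain js where js: "\<forall>i. count_list js i = (if i \<in> A then \<beta> i else 0)" by blast
    have "count_list (replicate k a) i = (if i = a then k else 0)" for k i
      by (induction k) auto
    then have "\<forall>i. count_list (replicate (\<beta> a) a @ js) i = (if i \<in> insert a A then \<beta> i else 0)"
      using js insert.hyps by auto
    then show ?case by blast
  qed
  from this[of UNIV] have "\<exists>is. \<forall>i. count_list is i = \<beta> i" by simp
  from someI_ex[OF this] show ?thesis by (simp add: mi_list_def)
qed

definition mi_deriv :: "('n \<Rightarrow> nat) \<Rightarrow> (real^'n \<Rightarrow> complex) \<Rightarrow> real^'n \<Rightarrow> complex" where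
  "mi_deriv \<beta> f = foldr partial_deriv (mi_list \<beta>) f"

definition mi_power :: "real^'n \<Rightarrow> ('n \<Rightarrow> nat) \<Rightarrow> real" where
  "mi_power x \<beta> = (\<Prod>i\<in>UNIV. (x $ i) ^ \<beta> i)"

definition schwartz :: "(real^'n \<Rightarrow> complex) set" where
  "schwartz = {\<phi>. smooth \<phi> \<and>
     (\<forall>M \<beta>. bdd_above (range (\<lambda>x. (1 + norm x) ^ M * cmod (mi_deriv \<beta> \<phi> x))))}"

definition schwartz_norm :: "nat \<Rightarrow> (real^'n \<Rightarrow> complex) \<Rightarrow> real" where
  "schwartz_norm N \<phi> =
     (\<Sum>\<beta> | mi_order \<beta> \<le> N. SUP x. (1 + norm x) ^ N * cmod (mi_deriv \<beta> \<phi> x))"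

text \<open>
  A tempered distribution is a linear functional on \<open>schwartz\<close>, continuous for the topology
  generated by the (increasing) norms \<open>schwartz_norm M\<close>. Functionals are extended by \<open>0\<close>
  outside \<open>schwartz\<close>, so that equality of functionals is equality of distributions and
  linear operations are pointwise.
\<close>

type_synonym 'n functional = "(real^'n \<Rightarrow> complex) \<Rightarrow> complex"

definition tempered :: "'n::finite functional set" where
  "tempered = {u.
     (\<forall>\<phi>. \<phi> \<notin> schwartz \<longrightarrow> u \<phi> = 0) \<and>
     (\<forall>\<phi>\<in>schwartz. \<forall>\<psi>\<in>schwartz. u (\<lambda>x. \<phi> x + \<psi> x) = u \<phi> + u \<psi>) \<and>
     (\<forall>\<phi>\<in>schwartz. \<forall>c. u (\<lambda>x. c * \<phi> x) = c * u \<phi>) \<and>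
     (\<forall>\<phi>\<in>schwartz. \<forall>\<epsilon>>0. \<exists>M. \<exists>\<delta>>0. \<forall>\<psi>\<in>schwartz.
        schwartz_norm M (\<lambda>x. \<psi> x - \<phi> x) < \<delta> \<longrightarrow> cmod (u \<psi> - u \<phi>) < \<epsilon>)}"

definition distribution_of :: "(real^'n \<Rightarrow> complex) \<Rightarrow> 'n::finite functional" where
  "distribution_of g \<phi> = (if \<phi> \<in> schwartz then \<integral>x. g x * \<phi> x \<partial>lebesgue else 0)"

definition test_class :: "nat \<Rightarrow> (real^'n \<Rightarrow> complex) set" where
  "test_class N = {\<phi> \<in> schwartz. schwartz_norm N \<phi> \<le> 1}"

definition dilate :: "real \<Rightarrow> (real^'n \<Rightarrow> complex) \<Rightarrow> real^'n \<Rightarrow> complex" where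
  "dilate t \<psi> x = complex_of_real (1 / t ^ CARD('n)) * \<psi> (x /\<^sub>R t)"

definition convolve :: "(real^'n \<Rightarrow> complex) \<Rightarrow> 'n::finite functional \<Rightarrow> real^'n \<Rightarrow> complex" where
  "convolve \<psi> u x = u (\<lambda>y. \<psi> (x - y))"

definition grand_maximal :: "nat \<Rightarrow> 'n::finite functional \<Rightarrow> real^'n \<Rightarrow> ennreal" where
  "grand_maximal N u x =
     (SUP (t, \<psi>) \<in> {0<..} \<times> test_class N. cmod_fun (convolve (dilate t \<psi>) u) x)"

definition Hardy_norm :: "nat \<Rightarrow> (real^'n \<Rightarrow> real) \<Rightarrow> 'n::finite functional \<Rightarrow> ennreal" where
  "Hardy_norm N p u = Lp_norm p (grand_maximal N u)"

definition Hardy_space :: "nat \<Rightarrow> (real^'n \<Rightarrow> real) \<Rightarrow> 'n::finite functional set" where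
  "Hardy_space N p = {u \<in> tempered. Hardy_norm N p u < \<infinity>}"

definition cube :: "(real^'n) set \<Rightarrow> bool" where
  "cube Q \<longleftrightarrow> (\<exists>c l. 0 < l \<and> Q = cbox c (c + (\<chi> i. l)))"

definition atom :: "(real^'n \<Rightarrow> real) \<Rightarrow> nat \<Rightarrow> (real^'n \<Rightarrow> complex) \<Rightarrow> bool" where
  "atom p d a \<longleftrightarrow> a \<in> borel_measurable lebesgue \<and>
     (\<exists>Q. cube Q \<and> (\<forall>x. x \<notin> Q \<longrightarrow> a x = 0) \<and>
        esssup lebesgue (cmod_fun a) \<le> inverse (Lp_norm p (indicator Q))) \<and>
     (\<forall>\<beta>. mi_order \<beta> \<le> d \<longrightarrow>
        (\<integral>x. a x * complex_of_real (mi_power x \<beta>) \<partial>lebesgue) = 0)"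

definition finite_atomic :: "(real^'n \<Rightarrow> real) \<Rightarrow> nat \<Rightarrow> (real^'n \<Rightarrow> complex) set" where
  "finite_atomic p d = {g. \<exists>(l::nat) c a. (\<forall>j<l. atom p d (a j)) \<and> g = (\<lambda>x. \<Sum>j<l. c j * a j x)}"

text \<open>
  Points of \<open>(\<real>\<^sup>n)\<^sup>m\<close> are \<open>y :: real^'n^'m\<close>; the norm of this type is the Euclidean norm
  of \<open>(y\<^sub>1, \<dots>, y\<^sub>m)\<close>.
\<close>

definition frac_int :: "real \<Rightarrow> ('m::finite \<Rightarrow> real^'n \<Rightarrow> complex) \<Rightarrow> real^'n \<Rightarrow> complex" where
  "frac_int \<alpha> f x =
     (\<integral>y. complex_of_real (1 / norm y powr (real (CARD('m) * CARD('n)) - \<alpha>)) *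
          (\<Prod>k\<in>UNIV. f k (x - y $ k)) \<partial>(lebesgue :: (real^'n^'m) measure))"

text \<open>
  Elements of \<open>Lp_space q\<close> are functions, not classes, so all identities between values
  of \<open>T\<close> hold almost everywhere.
\<close>

definition multilinear_ae ::
  "('m::finite \<Rightarrow> 'n::finite functional set) \<Rightarrow> (('m \<Rightarrow> 'n functional) \<Rightarrow> real^'n \<Rightarrow> complex) \<Rightarrow> bool" where
  "multilinear_ae V T \<longleftrightarrow>
     (\<forall>F k. (\<forall>j. F j \<in> V j) \<longrightarrow>
        (\<forall>G\<in>V k. AE x in lebesgue. T (F(k := \<lambda>\<phi>. F k \<phi> + G \<phi>)) x = T F x + T (F(k := G)) x) \<and>
        (\<forall>c. AE x in lebesgue. T (F(k := \<lambda>\<phi>. c * F k \<phi>)) x = c * T F x))"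

definition frac_int_extends_boundedly ::
  "nat \<Rightarrow> real \<Rightarrow> ('m::finite \<Rightarrow> real^'n \<Rightarrow> real) \<Rightarrow> (real^'n \<Rightarrow> real) \<Rightarrow> bool" where
  "frac_int_extends_boundedly N \<alpha> p q \<longleftrightarrow>
     (\<exists>C>0. \<exists>d. \<exists>T :: ('m \<Rightarrow> 'n functional) \<Rightarrow> real^'n \<Rightarrow> complex.
        multilinear_ae (\<lambda>k. Hardy_space N (p k)) T \<and>
        (\<forall>F. (\<forall>k. F k \<in> Hardy_space N (p k)) \<longrightarrow>
           T F \<in> Lp_space q \<and>
           Lp_norm q (cmod_fun (T F)) \<le> ennreal C * (\<Prod>k\<in>UNIV. Hardy_norm N (p k) (F k))) \<and>
        (\<forall>f. (\<forall>k. f k \<in> finite_atomic (p k) d) \<longrightarrow>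
           (\<forall>k. distribution_of (f k) \<in> Hardy_space N (p k)) \<and>
           (AE x in lebesgue. T (\<lambda>k. distribution_of (f k)) x = frac_int \<alpha> f x)))"

end

theory Submission
  imports Defs
begin

text \<open>
  The extension is given by an explicit formula instead of by atomic decompositions. With
  \<open>s = m n - \<alpha>\<close>, the kernel \<open>|y| powr (- s)\<close> is a constant multiple of the integral over \<open>t > 0\<close> of
  \<open>t powr (- s - 1) * exp (- |y|^2 / t^2)\<close>, and the Gaussian is the product of the Gaussians in
  \<open>y\<^sub>1, \<dots>, y\<^sub>m\<close>. Hence the operator is a multiple of the integral of \<open>t powr (\<alpha> - 1)\<close> times the product
  of the convolutions of \<open>f\<^sub>k\<close> with the dilated Gaussian at scale \<open>t\<close>, which makes sense for tempered
  distributions. These convolutions at \<open>(x, t)\<close> are bounded by the grand maximal function at every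
  point of the ball of radius \<open>t\<close> about \<open>x\<close>, so they are bounded by its value at \<open>x\<close> and, by the
  norm, by a multiple of \<open>t powr (- n / p\<^sub>k x)\<close> for \<open>t \<le> 1\<close> and of \<open>t powr (- n / p\<^sub>k \<infinity>)\<close> for \<open>t \<ge> 1\<close>.
  Splitting the integral as in Hedberg's proof of the Hardy-Littlewood-Sobolev inequality gives the
  estimate. Atoms enter only qualitatively: by Taylor expansion at the origin, cancellation makes the
  grand maximal function of a finite sum of atoms decay fast enough to lie in the Hardy spaces.
\<close>

section \<open>Smooth functions\<close>

text \<open>A formula for the extension settles well-definedness and linearity on whole Hardy
  spaces: density of finite atomic sums, completeness of \<open>Lp_space q\<close> and comparison of
  atomic with Hardy norms never enter, although the exponents may lie below 1. The cost is Hedberg's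
  argument with variable exponents. The hypothesis on the suprema keeps
  \<open>n * (\<Sum>k. 1 / p k x) - \<alpha>\<close> uniformly away from 0, also for the limits of
  the exponents at infinity, so the scale integrals have uniform constants. The obstacle is the
  region where the product G of the maximal functions is below 1. There the optimal scale exceeds 1,
  the limit exponents replace those at x, and raising to the power q x gives G a power slightly
  different from the one that the modulars control. Log-Hoelder decay makes the discrepancy of order
  1 / ln |x|; removing it costs a bounded factor and an integrable power of 1 + |x|. The number d of
  vanishing moments depends only on the lower bound of the exponents and on n, so the threshold for
  N serves all \<alpha> and q.\<close>

lemma smooth_differentiable:
  "smooth f \<Longrightarrow> foldr partial_deriv is f differentiable (at x)"
  by (simp add: smooth_def)

lemma smooth_imp_differentiable: "smooth f \<Longrightarrow> f differentiable (at x)"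
  using smooth_differentiable[of f "[]"] by simp

lemma smooth_foldr_partial_deriv: "smooth f \<Longrightarrow> smooth (foldr partial_deriv is f)"
  unfolding smooth_def by (metis foldr_append comp_apply)

lemma smooth_partial_deriv: "smooth f \<Longrightarrow> smooth (partial_deriv i f)"
  using smooth_foldr_partial_deriv[of f "[i]"] by simp

lemma vector_derivative_along:
  fixes f :: "real^'n \<Rightarrow> complex"
  assumes "(f has_derivative D) (at (w + s *\<^sub>R v))"
  shows "((\<lambda>t. f (w + t *\<^sub>R v)) has_vector_derivative D v) (at s)"
proof -
  have "((\<lambda>t. w + t *\<^sub>R v) has_vector_derivative v) (at s)"
    by (auto intro!: derivative_eq_intros simp: has_vector_derivative_def)
  from diff_chain_at[OF this[unfolded has_vector_derivative_def] assms]
  show ?thesis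
    using linear_scale[OF has_derivative_linear[OF assms]]
    by (simp add: o_def has_vector_derivative_def)
qed

lemma partial_deriv_eq:
  fixes f :: "real^'n \<Rightarrow> complex"
  assumes "(f has_derivative D) (at x)"
  shows "partial_deriv i f x = D (axis i 1)"
  unfolding partial_deriv_def
  using vector_derivative_along[of f D x 0 "axis i 1"] assms
  by (simp add: vector_derivative_at)

lemma has_derivative_partials:
  fixes f :: "real^'n \<Rightarrow> complex"
  assumes "f differentiable (at x)"
  shows "(f has_derivative (\<lambda>v. \<Sum>i\<in>UNIV. v $ i *\<^sub>R partial_deriv i f x)) (at x)"
proof -
  obtain D where D: "(f has_derivative D) (at x)"
    using assms by (auto simp: differentiable_def)
  then interpret linear D using has_derivative_linear by blast
  have "D v = (\<Sum>i\<in>UNIV. v $ i *\<^sub>R partial_deriv i f x)" for v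
  proof -
    have "D v = D (\<Sum>i\<in>UNIV. v $ i *\<^sub>R axis i 1)"
      by (simp add: basis_expansion[of v, unfolded scalar_mult_eq_scaleR])
    also have "\<dots> = (\<Sum>i\<in>UNIV. v $ i *\<^sub>R D (axis i 1))"
      by (simp add: sum scale)
    finally show ?thesis by (simp add: partial_deriv_eq[OF D])
  qed
  then have "D = (\<lambda>v. \<Sum>i\<in>UNIV. v $ i *\<^sub>R partial_deriv i f x)" by blast
  with D show ?thesis by simp
qed

lemma smooth_along:
  fixes f :: "real^'n \<Rightarrow> complex"
  assumes "smooth f"
  shows "((\<lambda>t. foldr partial_deriv is f (w + t *\<^sub>R v)) has_vector_derivative
    (\<Sum>i\<in>UNIV. v $ i *\<^sub>R foldr partial_deriv (i # is) f (w + s *\<^sub>R v))) (at s within S)"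
  using vector_derivative_along[OF has_derivative_partials[OF smooth_differentiable[OF assms, of "is" "w + s *\<^sub>R v"]]]
  by (simp add: has_vector_derivative_at_within)

text \<open>Affine substitution commutes with differentiation up to a power of \<open>s\<close>, and
  smoothness is read off from the resulting formula; hence the common proof. The factor
  \<open>c\<close> is carried along so that dilations and, with \<open>c = -1\<close>, differences
  are covered.\<close>

lemma
  fixes f :: "real^'n \<Rightarrow> complex"
  assumes "smooth f"
  shows foldr_partial_deriv_affine: "foldr partial_deriv is (\<lambda>y. c * f (s *\<^sub>R y + b)) =
    (\<lambda>y. c * complex_of_real (s ^ length is) * foldr partial_deriv is f (s *\<^sub>R y + b))"
    and smooth_affine: "smooth (\<lambda>y. c * f (s *\<^sub>R y + b))"
proof -
  have D: "((\<lambda>y. c' * foldr partial_deriv is f (s *\<^sub>R y + b)) has_derivative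
      (\<lambda>v. c' * (\<Sum>i\<in>UNIV. (s *\<^sub>R v) $ i *\<^sub>R foldr partial_deriv (i # is) f (s *\<^sub>R x + b)))) (at x)" for x c' "is"
  proof -
    have 1: "((\<lambda>y. s *\<^sub>R y + b) has_derivative (\<lambda>v. s *\<^sub>R v)) (at x)"
      by (auto intro!: derivative_eq_intros)
    have 2: "(foldr partial_deriv is f has_derivative (\<lambda>v. \<Sum>i\<in>UNIV. v $ i *\<^sub>R foldr partial_deriv (i # is) f (s *\<^sub>R x + b))) (at (s *\<^sub>R x + b))"
      using has_derivative_partials[OF smooth_differentiable[OF assms, of "is" "s *\<^sub>R x + b"]] by simp
    show ?thesis
      by (intro has_derivative_mult_right has_derivative_compose[OF 1 2])
  qed
  show A: "foldr partial_deriv is (\<lambda>y. c * f (s *\<^sub>R y + b)) =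
    (\<lambda>y. c * complex_of_real (s ^ length is) * foldr partial_deriv is f (s *\<^sub>R y + b))" for "is"
  proof (induction "is")
    case (Cons i "is")
    have "partial_deriv i (\<lambda>y. c * complex_of_real (s ^ length is) * foldr partial_deriv is f (s *\<^sub>R y + b)) x
      = c * complex_of_real (s ^ length (i # is)) * foldr partial_deriv (i # is) f (s *\<^sub>R x + b)" for x
      by (subst partial_deriv_eq[OF D])
         (simp add: axis_def if_distrib if_distribR sum.delta cong: if_cong, simp add: scaleR_conv_of_real)
    then show ?case by (simp only: Cons.IH foldr.simps o_apply)
  qed simp
  show "smooth (\<lambda>y. c * f (s *\<^sub>R y + b))"
    unfolding smooth_def A using D by (auto simp: differentiable_def)
qed

lemma
  assumes "smooth f" "smooth g"
  shows foldr_partial_deriv_add: "foldr partial_deriv is (\<lambda>y. f y + g y) =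
    (\<lambda>y. foldr partial_deriv is f y + foldr partial_deriv is g y)"
    and smooth_add: "smooth (\<lambda>y. f y + g y)"
proof -
  show A: "foldr partial_deriv is (\<lambda>y. f y + g y) =
    (\<lambda>y. foldr partial_deriv is f y + foldr partial_deriv is g y)" for "is"
  proof (induction "is")
    case (Cons i "is")
    have "partial_deriv i (\<lambda>y. foldr partial_deriv is f y + foldr partial_deriv is g y) x
      = foldr partial_deriv (i # is) f x + foldr partial_deriv (i # is) g x" for x
    proof -
      obtain D D' where D: "(foldr partial_deriv is f has_derivative D) (at x)"
         "(foldr partial_deriv is g has_derivative D') (at x)"
        using assms smooth_differentiable[of f "is" x] smooth_differentiable[of g "is" x]
        by (auto simp: differentiable_def)
      show ?thesis
        using partial_deriv_eq[OF D(1), of i] partial_deriv_eq[OF D(2), of i]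
          partial_deriv_eq[OF has_derivative_add[OF D], of i] by simp
    qed
    then show ?case by (simp only: Cons.IH foldr.simps o_apply)
  qed simp
  show "smooth (\<lambda>y. f y + g y)"
    unfolding smooth_def A using assms by (auto simp: smooth_def)
qed

text \<open>The double difference of \<open>h\<close> over a small square equals, by two applications of the mean
  value theorem, the value of either mixed derivative at some point of the square.\<close>

lemma mixed_difference:
  fixes h h1 h12 :: "real \<Rightarrow> real \<Rightarrow> real"
  assumes "0 < r"
    and 1: "\<And>s t. ((\<lambda>s. h s t) has_field_derivative h1 s t) (at s)"
    and 2: "\<And>s t. ((\<lambda>t. h1 s t) has_field_derivative h12 s t) (at t)"
  shows "\<exists>s t. 0 < s \<and> s < r \<and> 0 < t \<and> t < r \<and> h r r - h r 0 - h 0 r + h 0 0 = r * r * h12 s t"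
proof -
  have "((\<lambda>s. h s r - h s 0) has_field_derivative h1 s r - h1 s 0) (at s)" for s
    by (intro DERIV_diff 1)
  from MVT2[OF \<open>0 < r\<close> this] obtain s where s: "0 < s" "s < r"
    "(h r r - h r 0) - (h 0 r - h 0 0) = r * (h1 s r - h1 s 0)" by auto
  from MVT2[OF \<open>0 < r\<close> 2] obtain t where t: "0 < t" "t < r" "h1 s r - h1 s 0 = r * h12 s t"
    by (metis diff_zero)
  from s t show ?thesis by (intro exI[of _ s] exI[of _ t]) (simp add: algebra_simps)
qed

text \<open>Schwarz's theorem at the origin. The double difference is symmetric in the two
  variables, so its two mean value representations agree; on squares of side \<open>r k\<close>
  shrinking to 0, continuity of the mixed derivatives turns this into equality at the point.\<close>

lemma mixed_derivatives_equal:
  fixes h h1 h2 h12 h21 :: "real \<Rightarrow> real \<Rightarrow> real"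
  assumes 1: "\<And>s t. ((\<lambda>s. h s t) has_field_derivative h1 s t) (at s)"
    and 12: "\<And>s t. ((\<lambda>t. h1 s t) has_field_derivative h12 s t) (at t)"
    and 2: "\<And>s t. ((\<lambda>t. h s t) has_field_derivative h2 s t) (at t)"
    and 21: "\<And>s t. ((\<lambda>s. h2 s t) has_field_derivative h21 s t) (at s)"
    and c12: "continuous (at (0, 0)) (\<lambda>(s, t). h12 s t)"
    and c21: "continuous (at (0, 0)) (\<lambda>(s, t). h21 s t)"
  shows "h12 0 0 = h21 0 0"
proof -
  define r where "r k = 1 / real (Suc k)" for k
  have r: "r k > 0" for k by (simp add: r_def)
  have r0: "r \<longlonglongrightarrow> 0" unfolding r_def by (rule LIMSEQ_Suc[OF lim_1_over_n])
  have "\<exists>s t. 0 < s \<and> s < r k \<and> 0 < t \<and> t < r k \<and> h (r k) (r k) - h (r k) 0 - h 0 (r k) + h 0 0 = r k * r k * h12 s t" for k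
    by (rule mixed_difference[OF r 1 12])
  then obtain s t where st: "\<And>k. 0 < s k \<and> s k < r k \<and> 0 < t k \<and> t k < r k \<and> h (r k) (r k) - h (r k) 0 - h 0 (r k) + h 0 0 = r k * r k * h12 (s k) (t k)"
    by metis
  have "\<exists>t s. 0 < t \<and> t < r k \<and> 0 < s \<and> s < r k \<and> h (r k) (r k) - h 0 (r k) - h (r k) 0 + h 0 0 = r k * r k * h21 s t" for k
    by (rule mixed_difference[where h = "\<lambda>t s. h s t" and ?h1.0 = "\<lambda>t s. h2 s t" and ?h12.0 = "\<lambda>t s. h21 s t", OF r 2 21])
  then obtain s' t' where st': "\<And>k. 0 < t' k \<and> t' k < r k \<and> 0 < s' k \<and> s' k < r k \<and> h (r k) (r k) - h 0 (r k) - h (r k) 0 + h 0 0 = r k * r k * h21 (s' k) (t' k)"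
    by metis
  have eq: "h12 (s k) (t k) = h21 (s' k) (t' k)" for k
  proof -
    have "r k * r k * h12 (s k) (t k) = r k * r k * h21 (s' k) (t' k)"
      using st[of k] st'[of k] by linarith
    then show ?thesis using r[of k] by simp
  qed
  have lim: "u \<longlonglongrightarrow> 0" if "\<And>k. 0 < u k \<and> u k < r k" for u :: "nat \<Rightarrow> real"
    by (rule tendsto_sandwich[OF _ _ tendsto_const r0]) (use that in \<open>auto intro!: always_eventually less_imp_le\<close>)
  have "(\<lambda>k. (s k, t k)) \<longlonglongrightarrow> (0, 0)" "(\<lambda>k. (s' k, t' k)) \<longlonglongrightarrow> (0, 0)"
    using st st' by (auto intro!: tendsto_Pair lim)
  then have "(\<lambda>k. h12 (s k) (t k)) \<longlonglongrightarrow> h12 0 0" "(\<lambda>k. h21 (s' k) (t' k)) \<longlonglongrightarrow> h21 0 0"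
    using continuous_within_tendsto_compose'[OF c12, of "\<lambda>k. (s k, t k)" sequentially]
      continuous_within_tendsto_compose'[OF c21, of "\<lambda>k. (s' k, t' k)" sequentially] by auto
  then show ?thesis using eq LIMSEQ_unique by auto
qed

text \<open>Needed because \<open>mi_list\<close> picks an arbitrary order of differentiation. The
  mean value theorem fails for complex-valued functions, so real and imaginary part are treated
  separately.\<close>

lemma partial_deriv_commute:
  fixes f :: "real^'n \<Rightarrow> complex"
  assumes f: "smooth f"
  shows "partial_deriv i (partial_deriv j f) = partial_deriv j (partial_deriv i f)"
proof
  fix x
  have *: "g (partial_deriv j (partial_deriv i f) x) = g (partial_deriv i (partial_deriv j f) x)"
    if g: "bounded_linear g" for g :: "complex \<Rightarrow> real"
  proof -
    define w where "w s t = x + s *\<^sub>R axis i 1 + t *\<^sub>R axis j 1" for s t :: real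
    have ws: "((\<lambda>s. F (w s t)) has_vector_derivative partial_deriv i F (w s t)) (at s)"
      if "smooth F" for F s t
      using vector_derivative_along[where w = "x + t *\<^sub>R axis j 1" and s = s and v = "axis i 1", OF has_derivative_partials[OF smooth_imp_differentiable[OF that]]]
      by (simp add: w_def axis_def if_distrib if_distribR sum.delta algebra_simps cong: if_cong)
    have wt: "((\<lambda>t. F (w s t)) has_vector_derivative partial_deriv j F (w s t)) (at t)"
      if "smooth F" for F s t
      using vector_derivative_along[where w = "x + s *\<^sub>R axis i 1" and s = t and v = "axis j 1", OF has_derivative_partials[OF smooth_imp_differentiable[OF that]]]
      by (simp add: w_def axis_def if_distrib if_distribR sum.delta algebra_simps cong: if_cong)
    note gd = bounded_linear.has_vector_derivative[OF g, folded has_real_derivative_iff_has_vector_derivative]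
    have cont: "continuous (at (0, 0)) (\<lambda>(s, t). g (F (w s t)))" if "smooth F" for F
    proof -
      have 1: "isCont (\<lambda>p. w (fst p) (snd p)) (0, 0)"
        unfolding w_def by (intro continuous_intros)
      have 2: "isCont (\<lambda>z. g (F z)) z" for z
        by (rule bounded_linear.continuous[OF g])
           (rule differentiable_imp_continuous_within[OF smooth_imp_differentiable[OF that]])
      show ?thesis using isCont_o2[OF 1 2] by (simp add: case_prod_beta')
    qed
    have "g (partial_deriv j (partial_deriv i f) (w 0 0)) = g (partial_deriv i (partial_deriv j f) (w 0 0))"
      by (rule mixed_derivatives_equal[OF gd[OF ws[OF f]] gd[OF wt] gd[OF wt[OF f]] gd[OF ws]])
         (rule cont smooth_partial_deriv f)+
    then show ?thesis by (simp add: w_def)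
  qed
  from *[OF bounded_linear_Re] *[OF bounded_linear_Im]
  show "partial_deriv i (partial_deriv j f) x = partial_deriv j (partial_deriv i f) x"
    by (simp add: complex_eq_iff)
qed

lemma foldr_partial_deriv_mset:
  assumes f: "smooth f" and "mset is = mset js"
  shows "foldr partial_deriv is f = foldr partial_deriv js f"
proof -
  \<comment> \<open>Partial derivatives commute on smooth functions only, whereas reordering a fold
    asks for operators that commute everywhere. Setting \<open>D i\<close> to the identity off the
    smooth functions gives such operators.\<close>
  define D where "D i g = (if smooth g then partial_deriv i g else g)" for i :: 'a and g
  have D: "foldr partial_deriv ks f = foldr D ks f" for ks
    by (induction ks) (use f in \<open>auto simp: D_def dest: smooth_foldr_partial_deriv\<close>,
       metis smooth_foldr_partial_deriv)
  have "D i \<circ> D j = D j \<circ> D i" for i j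
    by (auto simp: D_def fun_eq_iff smooth_partial_deriv partial_deriv_commute)
  then have "fold D (rev is) = fold D (rev js)"
    using assms(2) by (intro fold_multiset_equiv) auto
  then have "foldr D is = foldr D js" by (simp add: foldr_conv_fold)
  then show ?thesis by (simp add: D)
qed

text \<open>From here on derivatives are indexed by plain lists of coordinates, on which induction
  is available; multi-index derivatives reappear only where \<open>schwartz\<close> and
  \<open>schwartz_norm\<close> are unfolded.\<close>

lemma foldr_partial_deriv_eq_mi_deriv:
  fixes f :: "real^'n \<Rightarrow> complex"
  assumes "smooth f"
  shows "foldr partial_deriv is f = mi_deriv (count_list is) f"
  unfolding mi_deriv_def
  by (rule foldr_partial_deriv_mset[OF assms])
     (simp add: multiset_eq_iff count_mset count_list_mi_list)

section \<open>Schwartz functions\<close>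

lemma finite_mi_order_le: "finite {\<beta> :: 'n::finite \<Rightarrow> nat. mi_order \<beta> \<le> N}"
proof (rule finite_subset)
  show "{\<beta> :: 'n \<Rightarrow> nat. mi_order \<beta> \<le> N} \<subseteq> PiE UNIV (\<lambda>_. {..N})"
    unfolding mi_order_def by (auto simp: PiE_UNIV_domain) (meson finite member_le_sum UNIV_I le_trans zero_le)
qed (simp add: finite_PiE)

lemma length_mi_list: "length (mi_list \<beta>) = mi_order \<beta>" for \<beta> :: "'n::finite \<Rightarrow> nat"
  using sum_count_set[of "mi_list \<beta>" UNIV] by (simp add: mi_order_def count_list_mi_list)

lemma mi_order_count_list: "mi_order (count_list is) = length is" for "is" :: "'n::finite list"
  using sum_count_set[of "is" UNIV] by (simp add: mi_order_def)

lemma schwartz_smooth: "\<phi> \<in> schwartz \<Longrightarrow> smooth \<phi>"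
  by (simp add: schwartz_def)

lemma schwartz_decay:
  fixes \<phi> :: "real^'n \<Rightarrow> complex"
  assumes "\<phi> \<in> schwartz"
  obtains B where "0 \<le> B" "\<And>x. (1 + norm x) ^ M * cmod (foldr partial_deriv is \<phi> x) \<le> B"
proof -
  have "bdd_above (range (\<lambda>x. (1 + norm x) ^ M * cmod (foldr partial_deriv is \<phi> x)))"
    using assms by (simp add: schwartz_def foldr_partial_deriv_eq_mi_deriv)
  then obtain B where B: "(1 + norm x) ^ M * cmod (foldr partial_deriv is \<phi> x) \<le> B" for x
    by (auto simp: bdd_above_def)
  moreover have "0 \<le> B" using B[of 0] order_trans[OF _ B[of 0]] by simp
  ultimately show thesis by (rule that[rotated])
qed

lemma schwartzI:
  fixes \<phi> :: "real^'n \<Rightarrow> complex"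
  assumes "smooth \<phi>"
    and "\<And>M is. \<exists>B. \<forall>x. (1 + norm x) ^ M * cmod (foldr partial_deriv is \<phi> x) \<le> B"
  shows "\<phi> \<in> schwartz"
  using assms unfolding schwartz_def mi_deriv_def bdd_above_def by fast

lemma le_schwartz_norm:
  fixes \<phi> :: "real^'n \<Rightarrow> complex"
  assumes \<phi>: "\<phi> \<in> schwartz" and "length is \<le> N"
  shows "(1 + norm x) ^ N * cmod (foldr partial_deriv is \<phi> x) \<le> schwartz_norm N \<phi>"
proof -
  let ?s = "\<lambda>\<beta>. SUP x. (1 + norm x) ^ N * cmod (mi_deriv \<beta> \<phi> x)"
  have bdd: "bdd_above (range (\<lambda>x. (1 + norm x) ^ N * cmod (mi_deriv \<beta> \<phi> x)))" for \<beta>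
    using \<phi> by (simp add: schwartz_def)
  have nonneg: "0 \<le> ?s \<beta>" for \<beta>
    by (rule cSUP_upper2[OF bdd, of 0]) auto
  have "(1 + norm x) ^ N * cmod (foldr partial_deriv is \<phi> x) \<le> ?s (count_list is)"
    using \<phi> by (auto simp: foldr_partial_deriv_eq_mi_deriv schwartz_smooth intro!: cSUP_upper bdd)
  also have "\<dots> \<le> schwartz_norm N \<phi>"
    unfolding schwartz_norm_def
    by (rule member_le_sum) (use assms nonneg finite_mi_order_le in \<open>auto simp: mi_order_count_list\<close>)
  finally show ?thesis .
qed

lemma norm_le_schwartz_norm:
  "\<phi> \<in> schwartz \<Longrightarrow> (1 + norm x) ^ N * cmod (\<phi> x) \<le> schwartz_norm N \<phi>"
  using le_schwartz_norm[of \<phi> "[]" N x] by simp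

lemma schwartz_norm_nonneg: "\<phi> \<in> schwartz \<Longrightarrow> 0 \<le> schwartz_norm N \<phi>"
  using order_trans[OF _ norm_le_schwartz_norm[of \<phi> 0 N]] by simp

lemma schwartz_norm_le:
  fixes \<phi> :: "real^'n \<Rightarrow> complex" and B :: real
  assumes "\<And>is x. length is \<le> N \<Longrightarrow> (1 + norm x) ^ N * cmod (foldr partial_deriv is \<phi> x) \<le> B"
  shows "schwartz_norm N \<phi> \<le> real (card {\<beta> :: 'n \<Rightarrow> nat. mi_order \<beta> \<le> N}) * B"
  unfolding schwartz_norm_def
  by (rule sum_bounded_above, rule cSUP_least)
     (use assms in \<open>auto simp: mi_deriv_def length_mi_list\<close>)

text \<open>A Peetre-type inequality. The constant depends only on a lower bound for the slope and
  an upper bound for the shift, so it is uniform over a neighbourhood of affine maps.\<close>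

lemma affine_weight:
  fixes y b :: "'a::real_normed_vector"
  assumes "0 < \<sigma>" "\<sigma> \<le> \<bar>s\<bar>" "norm b \<le> \<beta>"
  shows "1 + norm y \<le> (1 + (1 + \<beta>) / \<sigma>) * (1 + norm (s *\<^sub>R y + b))"
proof -
  have \<beta>: "0 \<le> \<beta>" using assms(3) norm_ge_zero order_trans by blast
  have "\<sigma> * norm y \<le> norm (s *\<^sub>R y)"
    using assms by (simp add: mult_right_mono)
  also have "\<dots> \<le> norm (s *\<^sub>R y + b) + \<beta>"
    using assms(3) norm_triangle_ineq4[of "s *\<^sub>R y + b" b] by simp
  finally have "norm y \<le> (norm (s *\<^sub>R y + b) + \<beta>) / \<sigma>"
    using assms(1) by (simp add: field_simps)
  also have "\<dots> \<le> (1 + \<beta>) / \<sigma> * (1 + norm (s *\<^sub>R y + b))"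
    using assms(1) \<beta> by (auto simp: field_simps)
  finally have "norm y \<le> (1 + \<beta>) / \<sigma> * (1 + norm (s *\<^sub>R y + b))" .
  moreover have "(1 + (1 + \<beta>) / \<sigma>) * (1 + norm (s *\<^sub>R y + b)) =
      1 + norm (s *\<^sub>R y + b) + (1 + \<beta>) / \<sigma> * (1 + norm (s *\<^sub>R y + b))"
    by (simp only: distrib_right mult_1_left)
  ultimately show ?thesis using norm_ge_zero[of "s *\<^sub>R y + b"] by linarith
qed

lemma schwartz_affine:
  fixes \<phi> :: "real^'n \<Rightarrow> complex"
  assumes \<phi>: "\<phi> \<in> schwartz" and "s \<noteq> 0"
  shows "(\<lambda>y. c * \<phi> (s *\<^sub>R y + b)) \<in> schwartz"
proof (rule schwartzI)
  show "smooth (\<lambda>y. c * \<phi> (s *\<^sub>R y + b))"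
    by (rule smooth_affine[OF schwartz_smooth[OF \<phi>]])
  fix M and "is" :: "'n list"
  obtain B where B: "0 \<le> B" "\<And>x. (1 + norm x) ^ M * cmod (foldr partial_deriv is \<phi> x) \<le> B"
    using schwartz_decay[OF \<phi>] by blast
  let ?K = "1 + (1 + norm b) / \<bar>s\<bar>" and ?c = "cmod (c * of_real (s ^ length is))"
  have K: "0 \<le> ?K" by (simp add: add_nonneg_nonneg)
  have "(1 + norm x) ^ M * cmod (foldr partial_deriv is (\<lambda>y. c * \<phi> (s *\<^sub>R y + b)) x) \<le> ?K ^ M * (?c * B)" for x
  proof -
    let ?d = "cmod (foldr partial_deriv is \<phi> (s *\<^sub>R x + b))"
    have "(1 + norm x) ^ M * (?c * ?d) \<le> (?K * (1 + norm (s *\<^sub>R x + b))) ^ M * (?c * ?d)"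
      by (intro mult_right_mono power_mono affine_weight) (use assms in auto)
    also have "\<dots> = ?K ^ M * (?c * ((1 + norm (s *\<^sub>R x + b)) ^ M * ?d))"
      by (simp only: power_mult_distrib mult_ac)
    also have "\<dots> \<le> ?K ^ M * (?c * B)"
      by (intro mult_left_mono B) (use K in auto)
    finally show ?thesis
      by (simp add: foldr_partial_deriv_affine[OF schwartz_smooth[OF \<phi>]] norm_mult mult.assoc)
  qed
  then show "\<exists>B. \<forall>x. (1 + norm x) ^ M * cmod (foldr partial_deriv is (\<lambda>y. c * \<phi> (s *\<^sub>R y + b)) x) \<le> B"
    by blast
qed

lemma schwartz_scale: "\<phi> \<in> schwartz \<Longrightarrow> (\<lambda>y. c * \<phi> y) \<in> schwartz"
  using schwartz_affine[of \<phi> 1 c 0] by simp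

lemma schwartz_add:
  fixes \<phi> \<psi> :: "real^'n \<Rightarrow> complex"
  assumes \<phi>: "\<phi> \<in> schwartz" and \<psi>: "\<psi> \<in> schwartz"
  shows "(\<lambda>y. \<phi> y + \<psi> y) \<in> schwartz"
proof (rule schwartzI)
  show "smooth (\<lambda>y. \<phi> y + \<psi> y)"
    by (intro smooth_add schwartz_smooth assms)
  fix M and "is" :: "'n list"
  obtain B where B: "0 \<le> B" "\<And>x. (1 + norm x) ^ M * cmod (foldr partial_deriv is \<phi> x) \<le> B"
    using schwartz_decay[OF \<phi>] by blast
  obtain B' where B': "0 \<le> B'" "\<And>x. (1 + norm x) ^ M * cmod (foldr partial_deriv is \<psi> x) \<le> B'"
    using schwartz_decay[OF \<psi>] by blast
  have "(1 + norm x) ^ M * cmod (foldr partial_deriv is (\<lambda>y. \<phi> y + \<psi> y) x) \<le> B + B'" for x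
  proof -
    have "(1 + norm x) ^ M * cmod (foldr partial_deriv is \<phi> x + foldr partial_deriv is \<psi> x)
      \<le> (1 + norm x) ^ M * (cmod (foldr partial_deriv is \<phi> x) + cmod (foldr partial_deriv is \<psi> x))"
      by (intro mult_left_mono norm_triangle_ineq) auto
    then show ?thesis using B(2)[of x] B'(2)[of x]
      by (simp add: foldr_partial_deriv_add[OF \<phi>[THEN schwartz_smooth] \<psi>[THEN schwartz_smooth]] distrib_left)
  qed
  then show "\<exists>B. \<forall>x. (1 + norm x) ^ M * cmod (foldr partial_deriv is (\<lambda>y. \<phi> y + \<psi> y) x) \<le> B"
    by blast
qed

lemma schwartz_diff:
  "\<phi> \<in> schwartz \<Longrightarrow> \<psi> \<in> schwartz \<Longrightarrow> (\<lambda>y. \<phi> y - \<psi> y) \<in> schwartz"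
  using schwartz_add[OF _ schwartz_scale[of \<psi> "-1"], of \<phi>] by simp

section \<open>Continuity of tempered distributions along affine families of test functions\<close>

lemma schwartz_affine_lipschitz:
  fixes \<phi> :: "real^'n \<Rightarrow> complex"
  assumes \<phi>: "\<phi> \<in> schwartz" and s0: "s0 \<noteq> 0"
  obtains C where "0 \<le> C" 
    "\<And>s b y. \<bar>s - s0\<bar> \<le> \<bar>s0\<bar> / 2 \<Longrightarrow> norm (b - b0) \<le> 1 \<Longrightarrow>
      (1 + norm y) ^ M * cmod (foldr partial_deriv is \<phi> (s *\<^sub>R y + b)) \<le> C"
    "\<And>s b y. \<bar>s - s0\<bar> \<le> \<bar>s0\<bar> / 2 \<Longrightarrow> norm (b - b0) \<le> 1 \<Longrightarrow>
      (1 + norm y) ^ M * cmod (foldr partial_deriv is \<phi> (s *\<^sub>R y + b) - foldr partial_deriv is \<phi> (s0 *\<^sub>R y + b0))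
        \<le> C * (\<bar>s - s0\<bar> + norm (b - b0))"
proof -
  define f where "f = foldr partial_deriv is \<phi>"
  \<comment> \<open>The constant of \<open>affine_weight\<close> for slopes of modulus at least
    \<open>\<bar>s0\<bar> / 2\<close> and shifts within distance 1 of \<open>b0\<close>; such slopes
    stay away from 0.\<close>
  define K where "K = 1 + (1 + (norm b0 + 1)) / (\<bar>s0\<bar> / 2)"
  have K: "0 \<le> K" "1 \<le> K" unfolding K_def using s0 by auto
  have weight: "1 + norm y \<le> K * (1 + norm (s *\<^sub>R y + b))"
    if "\<bar>s - s0\<bar> \<le> \<bar>s0\<bar> / 2" "norm (b - b0) \<le> 1" for s b y
    unfolding K_def
  proof (rule affine_weight)
    show "\<bar>s0\<bar> / 2 \<le> \<bar>s\<bar>" using that(1) by linarith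
    show "norm b \<le> norm b0 + 1" using that(2) norm_triangle_ineq2[of b b0] by linarith
  qed (use s0 in simp)
  obtain B where B: "0 \<le> B" "\<And>x. (1 + norm x) ^ M * cmod (f x) \<le> B"
    using schwartz_decay[OF \<phi>] unfolding f_def by blast
  \<comment> \<open>The argument moves by an amount that grows like \<open>1 + norm y\<close>, so
    the gradient is given one more power of the weight than the function.\<close>
  have "\<exists>B. \<forall>x. (1 + norm x) ^ (M + 1) * cmod (partial_deriv i f x) \<le> B" for i
    using schwartz_decay[OF \<phi>, of "M + 1" "i # is"] unfolding f_def by (metis comp_apply foldr.simps(2))
  then obtain B' where B': "(1 + norm x) ^ (M + 1) * cmod (partial_deriv i f x) \<le> B' i" for i x
    by metis
  define D where "D = (\<Sum>i\<in>UNIV. B' i)"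
  have B'0: "0 \<le> B' i" for i using order_trans[OF _ B'[of 0 i]] by simp
  then have D: "0 \<le> D" unfolding D_def by (intro sum_nonneg) auto
  have first: "(1 + norm y) ^ M * cmod (f (s *\<^sub>R y + b)) \<le> K ^ M * B"
    if sb: "\<bar>s - s0\<bar> \<le> \<bar>s0\<bar> / 2" "norm (b - b0) \<le> 1" for s b y
  proof -
    have "(1 + norm y) ^ M * cmod (f (s *\<^sub>R y + b)) \<le> (K * (1 + norm (s *\<^sub>R y + b))) ^ M * cmod (f (s *\<^sub>R y + b))"
      by (intro mult_right_mono power_mono weight[OF sb]) auto
    also have "\<dots> = K ^ M * ((1 + norm (s *\<^sub>R y + b)) ^ M * cmod (f (s *\<^sub>R y + b)))"
      by (simp only: power_mult_distrib mult_ac)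
    also have "\<dots> \<le> K ^ M * B"
      using B K by (intro mult_left_mono B) auto
    finally show ?thesis .
  qed
  have second: "(1 + norm y) ^ M * cmod (f (s *\<^sub>R y + b) - f (s0 *\<^sub>R y + b0)) \<le> K ^ (M + 1) * D * (\<bar>s - s0\<bar> + norm (b - b0))"
    if sb: "\<bar>s - s0\<bar> \<le> \<bar>s0\<bar> / 2" "norm (b - b0) \<le> 1" for s b y
  proof -
    define a where "a = (s - s0) *\<^sub>R y + (b - b0)"
    define x0 where "x0 = s0 *\<^sub>R y + b0"
    define G where "G = (\<lambda>t. x0 + t *\<^sub>R a) ` {0..1::real}"
    define L where "L = D * (K / (1 + norm y)) ^ (M + 1)"
    have y: "0 < 1 + norm y" by (simp add: add_pos_nonneg)
    have der: "(f has_derivative (\<lambda>v. \<Sum>i\<in>UNIV. v $ i *\<^sub>R partial_deriv i f x)) (at x within G)" for x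
      unfolding f_def
      by (rule has_derivative_at_withinI[OF has_derivative_partials[OF smooth_differentiable[OF schwartz_smooth[OF \<phi>]]]])
    have "onorm (\<lambda>v. \<Sum>i\<in>UNIV. v $ i *\<^sub>R partial_deriv i f x) \<le> L" if "x \<in> G" for x
    proof (rule onorm_le)
      from that obtain t where t: "0 \<le> t" "t \<le> 1" "x = x0 + t *\<^sub>R a" by (auto simp: G_def)
      \<comment> \<open>A point of the segment is the image of the same \<open>y\<close> under an
        intermediate affine map whose parameters obey the same bounds, so \<open>weight\<close>
        applies to it.\<close>
      have x: "x = (s0 + t * (s - s0)) *\<^sub>R y + (b0 + t *\<^sub>R (b - b0))"
        by (simp add: t x0_def a_def algebra_simps)
      have "1 + norm y \<le> K * (1 + norm x)" unfolding x
      proof (rule weight)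
        have "t * \<bar>s - s0\<bar> \<le> 1 * \<bar>s - s0\<bar>" by (rule mult_right_mono) (use t in auto)
        then show "\<bar>s0 + t * (s - s0) - s0\<bar> \<le> \<bar>s0\<bar> / 2" using sb t by (simp add: abs_mult)
        have "t * norm (b - b0) \<le> 1 * norm (b - b0)" by (rule mult_right_mono) (use t in auto)
        then show "norm (b0 + t *\<^sub>R (b - b0) - b0) \<le> 1" using sb t by simp
      qed
      then have w: "1 \<le> K / (1 + norm y) * (1 + norm x)" using y by (simp add: field_simps)
      have pd: "cmod (partial_deriv i f x) \<le> B' i * (K / (1 + norm y)) ^ (M + 1)" for i
      proof -
        have "1 * cmod (partial_deriv i f x) \<le> (K / (1 + norm y) * (1 + norm x)) ^ (M + 1) * cmod (partial_deriv i f x)"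
          by (rule mult_right_mono[OF one_le_power[OF w]]) simp
        also have "\<dots> = (K / (1 + norm y)) ^ (M + 1) * ((1 + norm x) ^ (M + 1) * cmod (partial_deriv i f x))"
          by (simp only: power_mult_distrib mult_ac)
        also have "\<dots> \<le> (K / (1 + norm y)) ^ (M + 1) * B' i"
          using K y by (intro mult_left_mono B') auto
        finally show ?thesis by (simp add: mult.commute)
      qed
      fix v :: "real^'n"
      have "norm (\<Sum>i\<in>UNIV. v $ i *\<^sub>R partial_deriv i f x) \<le> (\<Sum>i\<in>UNIV. norm v * (B' i * (K / (1 + norm y)) ^ (M + 1)))"
      proof (intro sum_norm_le)
        fix i show "norm (v $ i *\<^sub>R partial_deriv i f x) \<le> norm v * (B' i * (K / (1 + norm y)) ^ (M + 1))"
          unfolding norm_scaleR by (intro mult_mono pd component_le_norm_cart) auto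
      qed
      also have "\<dots> = L * norm v"
        by (simp add: L_def D_def sum_distrib_left sum_distrib_right sum_divide_distrib mult_ac)
      finally show "norm (\<Sum>i\<in>UNIV. v $ i *\<^sub>R partial_deriv i f x) \<le> L * norm v" .
    qed
    note on = this
    have "norm (f (x0 + a) - f x0) \<le> norm a * L"
      by (rule differentiable_bound_segment[OF _ der on]) (auto simp: G_def)
    moreover have "x0 + a = s *\<^sub>R y + b" by (simp add: x0_def a_def algebra_simps)
    ultimately have 1: "cmod (f (s *\<^sub>R y + b) - f (s0 *\<^sub>R y + b0)) \<le> norm a * L" by (simp add: x0_def)
    have "norm a \<le> \<bar>s - s0\<bar> * norm y + norm (b - b0)"
      unfolding a_def using norm_triangle_ineq[of "(s - s0) *\<^sub>R y"] by simp
    also have "\<dots> \<le> (\<bar>s - s0\<bar> + norm (b - b0)) * (1 + norm y)"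
      by (simp add: algebra_simps)
    finally have 2: "norm a \<le> (\<bar>s - s0\<bar> + norm (b - b0)) * (1 + norm y)" .
    have L0: "0 \<le> L" using K D y by (simp add: L_def)
    have "(1 + norm y) ^ M * cmod (f (s *\<^sub>R y + b) - f (s0 *\<^sub>R y + b0)) \<le> (1 + norm y) ^ M * ((\<bar>s - s0\<bar> + norm (b - b0)) * (1 + norm y) * L)"
      by (intro mult_left_mono order_trans[OF 1] mult_right_mono 2 L0) auto
    also have "\<dots> = K ^ (M + 1) * D * (\<bar>s - s0\<bar> + norm (b - b0))"
    proof -
      have "w ^ M * (R * w * (D * (K / w) ^ (M + 1))) = K ^ (M + 1) * D * R" if "0 < w" for w R :: real
        using that by (simp add: power_divide field_simps)
      then show ?thesis unfolding L_def using y by blast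
    qed
    finally show ?thesis .
  qed
  define C where "C = max (K ^ M * B) (K ^ (M + 1) * D)"
  show thesis
  proof (rule that[of C])
    show "0 \<le> C" using K B D by (simp add: C_def le_max_iff_disj)
  next
    fix s b y assume sb: "\<bar>s - s0\<bar> \<le> \<bar>s0\<bar> / 2" "norm (b - b0) \<le> 1"
    show "(1 + norm y) ^ M * cmod (foldr partial_deriv is \<phi> (s *\<^sub>R y + b)) \<le> C"
      using first[OF sb, of y] by (simp add: C_def f_def)
    have "K ^ (M + 1) * D * (\<bar>s - s0\<bar> + norm (b - b0)) \<le> C * (\<bar>s - s0\<bar> + norm (b - b0))"
      by (rule mult_right_mono) (auto simp: C_def)
    with second[OF sb, of y]
    show "(1 + norm y) ^ M * cmod (foldr partial_deriv is \<phi> (s *\<^sub>R y + b) - foldr partial_deriv is \<phi> (s0 *\<^sub>R y + b0)) \<le> C * (\<bar>s - s0\<bar> + norm (b - b0))"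
      by (simp add: f_def)
  qed
qed

text \<open>A derivative of order \<open>k\<close> of \<open>\<phi> (s *\<^sub>R y + b)\<close>
  carries the factor \<open>s ^ k\<close>. Its variation gives the sum of power differences, the
  variation of the argument gives the other two terms. What matters is that the bound tends to 0 as
  \<open>(s, b)\<close> tends to \<open>(s0, b0)\<close>.\<close>

lemma schwartz_norm_affine_diff:
  fixes \<phi> :: "real^'n \<Rightarrow> complex"
  assumes \<phi>: "\<phi> \<in> schwartz" and s0: "s0 \<noteq> 0"
  obtains C where "\<And>s b. \<bar>s - s0\<bar> \<le> \<bar>s0\<bar> / 2 \<Longrightarrow> norm (b - b0) \<le> 1 \<Longrightarrow>
      schwartz_norm M (\<lambda>y. \<phi> (s *\<^sub>R y + b) - \<phi> (s0 *\<^sub>R y + b0))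
        \<le> C * ((\<Sum>k\<le>M. \<bar>s ^ k - s0 ^ k\<bar>) + \<bar>s - s0\<bar> + norm (b - b0))"
proof -
  have "\<exists>C\<ge>0. (\<forall>s b y. \<bar>s - s0\<bar> \<le> \<bar>s0\<bar> / 2 \<longrightarrow> norm (b - b0) \<le> 1 \<longrightarrow>
      (1 + norm y) ^ M * cmod (foldr partial_deriv is \<phi> (s *\<^sub>R y + b)) \<le> C) \<and>
    (\<forall>s b y. \<bar>s - s0\<bar> \<le> \<bar>s0\<bar> / 2 \<longrightarrow> norm (b - b0) \<le> 1 \<longrightarrow>
      (1 + norm y) ^ M * cmod (foldr partial_deriv is \<phi> (s *\<^sub>R y + b) - foldr partial_deriv is \<phi> (s0 *\<^sub>R y + b0))
        \<le> C * (\<bar>s - s0\<bar> + norm (b - b0)))" for "is"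
    using schwartz_affine_lipschitz[OF \<phi> s0, of b0 M "is"] by metis
  then obtain C where C: "\<And>is. 0 \<le> C is"
    "\<And>is s b y. \<bar>s - s0\<bar> \<le> \<bar>s0\<bar> / 2 \<Longrightarrow> norm (b - b0) \<le> 1 \<Longrightarrow>
      (1 + norm y) ^ M * cmod (foldr partial_deriv is \<phi> (s *\<^sub>R y + b)) \<le> C is"
    "\<And>is s b y. \<bar>s - s0\<bar> \<le> \<bar>s0\<bar> / 2 \<Longrightarrow> norm (b - b0) \<le> 1 \<Longrightarrow>
      (1 + norm y) ^ M * cmod (foldr partial_deriv is \<phi> (s *\<^sub>R y + b) - foldr partial_deriv is \<phi> (s0 *\<^sub>R y + b0))
        \<le> C is * (\<bar>s - s0\<bar> + norm (b - b0))"
    by metis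
  define L where "L = {is :: 'n list. length is \<le> M}"
  have finL: "finite L" unfolding L_def using finite_lists_length_le[of "UNIV :: 'n set" M] by simp
  define S where "S = (1 + \<bar>s0\<bar>) ^ M * (\<Sum>is\<in>L. C is)"
  have CS: "(1 + \<bar>s0\<bar>) ^ M * C is \<le> S" if "length is \<le> M" for "is"
    unfolding S_def by (intro mult_left_mono member_le_sum) (use C that finL in \<open>auto simp: L_def\<close>)
  show thesis
  proof (rule that)
    fix s b assume sb: "\<bar>s - s0\<bar> \<le> \<bar>s0\<bar> / 2" "norm (b - b0) \<le> 1"
    let ?R = "(\<Sum>k\<le>M. \<bar>s ^ k - s0 ^ k\<bar>) + \<bar>s - s0\<bar> + norm (b - b0)"
    show "schwartz_norm M (\<lambda>y. \<phi> (s *\<^sub>R y + b) - \<phi> (s0 *\<^sub>R y + b0)) \<le> (real (card {\<beta> :: 'n \<Rightarrow> nat. mi_order \<beta> \<le> M}) * S) * ?R"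
      unfolding mult.assoc
    proof (rule schwartz_norm_le)
      fix "is" :: "'n list" and y :: "real^'n" assume len: "length is \<le> M"
      let ?k = "length is" and ?f = "foldr partial_deriv is \<phi>"
      note aff = foldr_partial_deriv_affine[OF schwartz_smooth[OF \<phi>]]
      have "foldr partial_deriv is (\<lambda>y. \<phi> (s *\<^sub>R y + b) - \<phi> (s0 *\<^sub>R y + b0)) y
        = of_real (s ^ ?k) * ?f (s *\<^sub>R y + b) - of_real (s0 ^ ?k) * ?f (s0 *\<^sub>R y + b0)"
        using foldr_partial_deriv_add[OF smooth_affine[OF schwartz_smooth[OF \<phi>], of 1 s b]
            smooth_affine[OF schwartz_smooth[OF \<phi>], of "-1" s0 b0], of "is"]
          aff[of "is" 1 s b] aff[of "is" "-1" s0 b0] by simp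
      also have "\<dots> = of_real (s ^ ?k - s0 ^ ?k) * ?f (s *\<^sub>R y + b) + of_real (s0 ^ ?k) * (?f (s *\<^sub>R y + b) - ?f (s0 *\<^sub>R y + b0))"
        by (simp add: algebra_simps)
      finally have eq: "foldr partial_deriv is (\<lambda>y. \<phi> (s *\<^sub>R y + b) - \<phi> (s0 *\<^sub>R y + b0)) y = \<dots>" .
      have "(1 + norm y) ^ M * cmod (foldr partial_deriv is (\<lambda>y. \<phi> (s *\<^sub>R y + b) - \<phi> (s0 *\<^sub>R y + b0)) y)
        \<le> (1 + norm y) ^ M * (\<bar>s ^ ?k - s0 ^ ?k\<bar> * cmod (?f (s *\<^sub>R y + b)) + \<bar>s0 ^ ?k\<bar> * cmod (?f (s *\<^sub>R y + b) - ?f (s0 *\<^sub>R y + b0)))"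
        unfolding eq
        by (intro mult_left_mono order_trans[OF norm_triangle_ineq]) (simp_all add: norm_mult del: of_real_diff of_real_power)
      also have "\<dots> = \<bar>s ^ ?k - s0 ^ ?k\<bar> * ((1 + norm y) ^ M * cmod (?f (s *\<^sub>R y + b))) + \<bar>s0 ^ ?k\<bar> * ((1 + norm y) ^ M * cmod (?f (s *\<^sub>R y + b) - ?f (s0 *\<^sub>R y + b0)))"
        by (simp add: algebra_simps)
      also have "\<dots> \<le> \<bar>s ^ ?k - s0 ^ ?k\<bar> * C is + (1 + \<bar>s0\<bar>) ^ M * (C is * (\<bar>s - s0\<bar> + norm (b - b0)))"
      proof (rule add_mono[OF mult_left_mono[OF C(2)[OF sb]] mult_mono[OF _ C(3)[OF sb]]])
        have "\<bar>s0\<bar> ^ ?k \<le> (1 + \<bar>s0\<bar>) ^ ?k" by (intro power_mono) auto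
        also have "\<dots> \<le> (1 + \<bar>s0\<bar>) ^ M" using len by (intro power_increasing) auto
        finally show "\<bar>s0 ^ ?k\<bar> \<le> (1 + \<bar>s0\<bar>) ^ M" by (simp add: power_abs)
      qed auto
      also have "\<dots> \<le> \<bar>s ^ ?k - s0 ^ ?k\<bar> * S + S * (\<bar>s - s0\<bar> + norm (b - b0))"
      proof (intro add_mono mult_left_mono)
        have "1 * C is \<le> (1 + \<bar>s0\<bar>) ^ M * C is" by (intro mult_right_mono C one_le_power) auto
        then show "C is \<le> S" using CS[OF len] by simp
        show "(1 + \<bar>s0\<bar>) ^ M * (C is * (\<bar>s - s0\<bar> + norm (b - b0))) \<le> S * (\<bar>s - s0\<bar> + norm (b - b0))"
          unfolding mult.assoc[symmetric] by (intro mult_right_mono CS len) auto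
      qed auto
      also have "\<dots> \<le> S * ?R"
      proof -
        have "\<bar>s ^ ?k - s0 ^ ?k\<bar> \<le> (\<Sum>k\<le>M. \<bar>s ^ k - s0 ^ k\<bar>)"
          by (rule member_le_sum) (use len in auto)
        moreover have "0 \<le> S" unfolding S_def by (intro mult_nonneg_nonneg sum_nonneg C) auto
        ultimately have "S * \<bar>s ^ ?k - s0 ^ ?k\<bar> \<le> S * (\<Sum>k\<le>M. \<bar>s ^ k - s0 ^ k\<bar>)"
          by (rule mult_left_mono)
        then show ?thesis by (simp add: algebra_simps)
      qed
      finally show "(1 + norm y) ^ M * cmod (foldr partial_deriv is (\<lambda>y. \<phi> (s *\<^sub>R y + b) - \<phi> (s0 *\<^sub>R y + b0)) y) \<le> S * ?R" .
    qed
  qed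
qed

text \<open>With \<open>s = - 1 / t\<close> and \<open>b = (1 / t) *\<^sub>R x\<close> this becomes
  joint continuity of a convolution in point and scale, from which the measurability of the heat
  extensions follows.\<close>

lemma tempered_affine_continuous:
  fixes \<phi> :: "real^'n::finite \<Rightarrow> complex"
  assumes u: "u \<in> tempered" and \<phi>: "\<phi> \<in> schwartz" and s0: "s0 \<noteq> 0"
  shows "isCont (\<lambda>(s, b). u (\<lambda>y. \<phi> (s *\<^sub>R y + b))) (s0, b0)"
  unfolding continuous_within tendsto_iff
proof (intro allI impI)
  fix \<epsilon> :: real assume "0 < \<epsilon>"
  have aff: "(\<lambda>y. \<phi> (s *\<^sub>R y + b)) \<in> schwartz" if "s \<noteq> 0" for s b
    using schwartz_affine[OF \<phi> that, of 1 b] by simp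
  have "\<forall>\<phi>\<in>schwartz. \<forall>\<epsilon>>0. \<exists>M. \<exists>\<delta>>0. \<forall>\<psi>\<in>schwartz.
        schwartz_norm M (\<lambda>x. \<psi> x - \<phi> x) < \<delta> \<longrightarrow> cmod (u \<psi> - u \<phi>) < \<epsilon>"
    using u by (simp add: tempered_def)
  from this[rule_format, OF aff[OF s0, of b0] \<open>0 < \<epsilon>\<close>]
  obtain M \<delta> where M: "0 < \<delta>" "\<And>\<psi>. \<psi> \<in> schwartz \<Longrightarrow>
    schwartz_norm M (\<lambda>x. \<psi> x - \<phi> (s0 *\<^sub>R x + b0)) < \<delta> \<Longrightarrow> cmod (u \<psi> - u (\<lambda>y. \<phi> (s0 *\<^sub>R y + b0))) < \<epsilon>"
    by blast
  obtain C where C: "\<And>s b. \<bar>s - s0\<bar> \<le> \<bar>s0\<bar> / 2 \<Longrightarrow> norm (b - b0) \<le> 1 \<Longrightarrow>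
      schwartz_norm M (\<lambda>y. \<phi> (s *\<^sub>R y + b) - \<phi> (s0 *\<^sub>R y + b0))
        \<le> C * ((\<Sum>k\<le>M. \<bar>s ^ k - s0 ^ k\<bar>) + \<bar>s - s0\<bar> + norm (b - b0))"
    by (rule schwartz_norm_affine_diff[OF \<phi> s0, of b0 M]) (rule that, blast)
  let ?r = "\<lambda>p. C * ((\<Sum>k\<le>M. \<bar>fst p ^ k - s0 ^ k\<bar>) + \<bar>fst p - s0\<bar> + norm (snd p - b0))"
  have "(?r \<longlongrightarrow> C * ((\<Sum>k\<le>M. \<bar>fst (s0, b0) ^ k - s0 ^ k\<bar>) + \<bar>fst (s0, b0) - s0\<bar> + norm (snd (s0, b0) - b0))) (at (s0, b0))"
    by (intro tendsto_intros)
  then have "(?r \<longlongrightarrow> 0) (at (s0, b0))" by simp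
  then have 1: "\<forall>\<^sub>F p in at (s0, b0). ?r p < \<delta>" using M(1) by (rule order_tendstoD)
  have "((\<lambda>p. \<bar>fst p - s0\<bar>) \<longlongrightarrow> \<bar>fst (s0, b0) - s0\<bar>) (at (s0, b0))"
    "((\<lambda>p. norm (snd p - b0)) \<longlongrightarrow> norm (snd (s0, b0) - b0)) (at (s0, b0))"
    by (intro tendsto_intros)+
  from order_tendstoD(2)[OF this(1), of "\<bar>s0\<bar> / 2"] order_tendstoD(2)[OF this(2), of 1]
  have 2: "\<forall>\<^sub>F p in at (s0, b0). \<bar>fst p - s0\<bar> < \<bar>s0\<bar> / 2" 
    and 3: "\<forall>\<^sub>F p in at (s0, b0). norm (snd p - b0) < 1"
    using s0 by auto
  show "\<forall>\<^sub>F p in at (s0, b0). dist (case p of (s, b) \<Rightarrow> u (\<lambda>y. \<phi> (s *\<^sub>R y + b)))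
    (case (s0, b0) of (s, b) \<Rightarrow> u (\<lambda>y. \<phi> (s *\<^sub>R y + b))) < \<epsilon>"
    using 1 2 3
  proof eventually_elim
    case (elim p)
    obtain s b where p: "p = (s, b)" by force
    have "s \<noteq> 0" using elim(2) p s0 by auto
    have "schwartz_norm M (\<lambda>y. \<phi> (s *\<^sub>R y + b) - \<phi> (s0 *\<^sub>R y + b0)) < \<delta>"
      using C[of s b] elim p by simp
    from M(2)[OF aff[OF \<open>s \<noteq> 0\<close>] this] show ?case by (simp add: p dist_norm)
  qed
qed

section \<open>Gaussians and maximal functions\<close>

lemma polynomial_has_derivative:
  fixes P :: "real^'n \<Rightarrow> real"
  assumes "real_polynomial_function P"
  shows "\<exists>D. (\<forall>x. (P has_derivative D x) (at x)) \<and> (\<forall>v. real_polynomial_function (\<lambda>x. D x v))"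
  using assms
proof induction
  case (linear f)
  then show ?case
    by (intro exI[of _ "\<lambda>_. f"]) (auto intro: bounded_linear_imp_has_derivative real_polynomial_function.intros(2))
next
  case (const c)
  then show ?case
    by (intro exI[of _ "\<lambda>_ _. 0"]) (auto intro: real_polynomial_function.intros(2))
next
  case (add f g)
  then obtain D E where "\<And>x. (f has_derivative D x) (at x)" "\<And>v. real_polynomial_function (\<lambda>x. D x v)"
    "\<And>x. (g has_derivative E x) (at x)" "\<And>v. real_polynomial_function (\<lambda>x. E x v)" by blast
  then show ?case
    by (intro exI[of _ "\<lambda>x v. D x v + E x v"]) (auto intro: has_derivative_add real_polynomial_function.intros(3))
next
  case (mult f g)
  then obtain D E where "\<And>x. (f has_derivative D x) (at x)" "\<And>v. real_polynomial_function (\<lambda>x. D x v)"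
    "\<And>x. (g has_derivative E x) (at x)" "\<And>v. real_polynomial_function (\<lambda>x. E x v)" by blast
  then show ?case using mult.hyps
  proof (intro exI[of _ "\<lambda>x v. f x * E x v + D x v * g x"] conjI allI)
    show "((\<lambda>a. f a * g a) has_derivative (\<lambda>a. f x * E x a + D x a * g x)) (at x)" for x
      by (intro has_derivative_mult) fact+
    show "real_polynomial_function (\<lambda>x. f x * E x v + D x v * g x)" for v
      by (intro real_polynomial_function.intros(3,4)) fact+
  qed
qed

lemma polynomial_growth:
  fixes P :: "real^'n \<Rightarrow> real"
  assumes "real_polynomial_function P"
  shows "\<exists>C k. 0 \<le> C \<and> (\<forall>x. \<bar>P x\<bar> \<le> C * (1 + norm x) ^ k)"
  using assms
proof induction
  case (linear f)
  then obtain K where K: "0 < K" "\<And>x. \<bar>f x\<bar> \<le> norm x * K"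
    using bounded_linear.pos_bounded by (metis real_norm_def)
  have "\<bar>f x\<bar> \<le> K * (1 + norm x) ^ 1" for x
    using K(2)[of x] K(1) by (simp add: algebra_simps)
  then show ?case using K by (intro exI[of _ K] exI[of _ 1]) auto
next
  case (const c)
  then show ?case by (intro exI[of _ "\<bar>c\<bar>"] exI[of _ 0]) auto
next
  case (add f g)
  then obtain C k C' k' where *: "0 \<le> C" "\<And>x. \<bar>f x\<bar> \<le> C * (1 + norm x) ^ k"
    "0 \<le> C'" "\<And>x. \<bar>g x\<bar> \<le> C' * (1 + norm x) ^ k'" by blast
  have "\<bar>f x + g x\<bar> \<le> (C + C') * (1 + norm x) ^ (k + k')" for x
  proof -
    have "C * (1 + norm x) ^ k \<le> C * (1 + norm x) ^ (k + k')" "C' * (1 + norm x) ^ k' \<le> C' * (1 + norm x) ^ (k + k')"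
      using * by (intro mult_left_mono power_increasing; simp)+
    then show ?thesis using *(2)[of x] *(4)[of x] by (simp add: distrib_right)
  qed
  then show ?case using * by (intro exI[of _ "C + C'"] exI[of _ "k + k'"]) auto
next
  case (mult f g)
  then obtain C k C' k' where *: "0 \<le> C" "\<And>x. \<bar>f x\<bar> \<le> C * (1 + norm x) ^ k"
    "0 \<le> C'" "\<And>x. \<bar>g x\<bar> \<le> C' * (1 + norm x) ^ k'" by blast
  have "\<bar>f x * g x\<bar> \<le> (C * C') * (1 + norm x) ^ (k + k')" for x
  proof -
    have "\<bar>f x\<bar> * \<bar>g x\<bar> \<le> (C * (1 + norm x) ^ k) * (C' * (1 + norm x) ^ k')"
      using * by (intro mult_mono *) auto
    then show ?thesis by (simp add: abs_mult power_add mult_ac)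
  qed
  then show ?case using * by (intro exI[of _ "C * C'"] exI[of _ "k + k'"]) auto
qed

definition gaussian :: "real^'n \<Rightarrow> complex" where
  "gaussian x = complex_of_real (exp (- (norm x)\<^sup>2))"

lemma polynomial_gaussian_has_derivative:
  fixes P :: "real^'n \<Rightarrow> real"
  assumes "(P has_derivative D) (at x)"
  shows "((\<lambda>x. complex_of_real (P x) * gaussian x) has_derivative
    (\<lambda>v. complex_of_real (D v - 2 * (P x * (v \<bullet> x))) * gaussian x)) (at x)"
proof -
  have eq: "(\<lambda>x. complex_of_real (P x) * gaussian x) = (\<lambda>x. complex_of_real (P x * exp (- (x \<bullet> x))))"
    by (simp add: gaussian_def power2_norm_eq_inner)
  have "((\<lambda>x. P x * exp (- (x \<bullet> x))) has_derivative
      (\<lambda>v. (D v - 2 * (P x * (v \<bullet> x))) * exp (- (x \<bullet> x)))) (at x)"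
    by (auto intro!: derivative_eq_intros assms simp: algebra_simps inner_commute)
  from has_derivative_of_real[OF this] show ?thesis
    by (simp add: eq gaussian_def power2_norm_eq_inner)
qed

lemma foldr_partial_deriv_gaussian:
  "\<exists>P. real_polynomial_function P \<and>
     foldr partial_deriv is (gaussian :: real^'n \<Rightarrow> complex) = (\<lambda>x. complex_of_real (P x) * gaussian x)"
proof (induction "is")
  case Nil
  show ?case by (intro exI[of _ "\<lambda>_. 1"]) (auto intro: real_polynomial_function.intros(2))
next
  case (Cons i "is")
  then obtain P where P: "real_polynomial_function P"
    "foldr partial_deriv is (gaussian :: real^'n \<Rightarrow> complex) = (\<lambda>x. complex_of_real (P x) * gaussian x)" by blast
  from polynomial_has_derivative[OF P(1)] obtain D where
    D: "\<And>x. (P has_derivative D x) (at x)" "\<And>v. real_polynomial_function (\<lambda>x. D x v)" by blast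
  have "foldr partial_deriv (i # is) (gaussian :: real^'n \<Rightarrow> complex)
     = (\<lambda>x. complex_of_real (D x (axis i 1) - 2 * (P x * (axis i 1 \<bullet> x))) * gaussian x)"
    using partial_deriv_eq[OF polynomial_gaussian_has_derivative[OF D(1)]] by (auto simp: P(2))
  moreover have "real_polynomial_function (\<lambda>x. D x (axis i 1) - 2 * (P x * (axis i 1 \<bullet> x)))"
    by (intro real_polynomial_function_diff real_polynomial_function.intros D P bounded_linear_inner_right)
  ultimately show ?case by blast
qed

lemma gaussian_schwartz: "(gaussian :: real^'n \<Rightarrow> complex) \<in> schwartz"
proof (rule schwartzI)
  show "smooth (gaussian :: real^'n \<Rightarrow> complex)"
    unfolding smooth_def
  proof (intro allI)
    fix "is" and x :: "real^'n"
    obtain P where P: "real_polynomial_function P"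
      "foldr partial_deriv is (gaussian :: real^'n \<Rightarrow> complex) = (\<lambda>x. complex_of_real (P x) * gaussian x)"
      using foldr_partial_deriv_gaussian by blast
    from polynomial_has_derivative[OF P(1)] obtain D where "\<And>x. (P has_derivative D x) (at x)" by blast
    from polynomial_gaussian_has_derivative[OF this] show "foldr partial_deriv is gaussian differentiable (at x)"
      unfolding P(2) differentiable_def by blast
  qed
  fix M and "is" :: "'n list"
  obtain P where P: "real_polynomial_function P"
    "foldr partial_deriv is (gaussian :: real^'n \<Rightarrow> complex) = (\<lambda>x. complex_of_real (P x) * gaussian x)"
    using foldr_partial_deriv_gaussian by blast
  obtain C k where C: "0 \<le> C" "\<And>x. \<bar>P x\<bar> \<le> C * (1 + norm x) ^ k"
    using polynomial_growth[OF P(1)] by blast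
  let ?m = "real (M + k)"
  have "(1 + norm x) ^ M * cmod (foldr partial_deriv is gaussian x) \<le> C * exp (?m\<^sup>2)" for x :: "real^'n"
  proof -
    have "(1 + norm x) ^ (M + k) \<le> exp (norm x) ^ (M + k)"
      by (intro power_mono exp_ge_add_one_self) auto
    also have "\<dots> = exp (?m * norm x)" by (simp only: exp_of_nat_mult)
    \<comment> \<open>Since \<open>2 * m * r \<le> m\<^sup>2 + r\<^sup>2\<close>, growth of order
      \<open>exp (m * r)\<close> costs only a constant against the Gaussian.\<close>
    also have "\<dots> \<le> exp (?m\<^sup>2 + (norm x)\<^sup>2)"
    proof -
      have "0 \<le> (?m - norm x)\<^sup>2" "0 \<le> ?m * norm x" by simp_all
      then show ?thesis unfolding exp_le_cancel_iff power2_diff by linarith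
    qed
    finally have 1: "(1 + norm x) ^ (M + k) * exp (- (norm x)\<^sup>2) \<le> exp (?m\<^sup>2)"
      by (simp add: exp_add exp_minus field_simps)
    have "(1 + norm x) ^ M * cmod (foldr partial_deriv is gaussian x) = (1 + norm x) ^ M * (\<bar>P x\<bar> * exp (- (norm x)\<^sup>2))"
      by (simp add: P(2) gaussian_def norm_mult)
    also have "\<dots> \<le> (1 + norm x) ^ M * ((C * (1 + norm x) ^ k) * exp (- (norm x)\<^sup>2))"
      by (intro mult_left_mono mult_right_mono C) auto
    also have "\<dots> = C * ((1 + norm x) ^ (M + k) * exp (- (norm x)\<^sup>2))"
      by (simp add: power_add mult_ac)
    also have "\<dots> \<le> C * exp (?m\<^sup>2)" by (intro mult_left_mono 1 C)
    finally show ?thesis .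
  qed
  then show "\<exists>B. \<forall>x. (1 + norm x) ^ M * cmod (foldr partial_deriv is (gaussian :: real^'n \<Rightarrow> complex) x) \<le> B"
    by blast
qed

section \<open>Convolutions of distributions with dilated test functions\<close>

lemma tempered_scale:
  "u \<in> tempered \<Longrightarrow> \<phi> \<in> schwartz \<Longrightarrow> u (\<lambda>x. c * \<phi> x) = c * u \<phi>"
  by (simp add: tempered_def)

lemma dilate_reflect:
  fixes \<phi> :: "real^'n \<Rightarrow> complex"
  shows "dilate t \<phi> (x - y) = complex_of_real (1 / t ^ CARD('n)) * \<phi> ((- 1 / t) *\<^sub>R y + (1 / t) *\<^sub>R x)"
  by (simp add: dilate_def divide_inverse scaleR_diff_right)

lemma dilate_reflect_schwartz:
  fixes \<phi> :: "real^'n \<Rightarrow> complex"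
  assumes "\<phi> \<in> schwartz" "0 < t"
  shows "(\<lambda>y. dilate t \<phi> (x - y)) \<in> schwartz"
  unfolding dilate_reflect by (rule schwartz_affine) (use assms in auto)

lemma convolve_dilate_eq:
  fixes \<phi> :: "real^'n::finite \<Rightarrow> complex"
  assumes "u \<in> tempered" "\<phi> \<in> schwartz" "0 < t"
  shows "convolve (dilate t \<phi>) u x =
    complex_of_real (1 / t ^ CARD('n)) * u (\<lambda>y. \<phi> ((- 1 / t) *\<^sub>R y + (1 / t) *\<^sub>R x))"
proof -
  have "(\<lambda>y. \<phi> ((- 1 / t) *\<^sub>R y + (1 / t) *\<^sub>R x)) \<in> schwartz"
    using schwartz_affine[of \<phi> "-1/t" 1 "(1 / t) *\<^sub>R x"] assms by simp
  from tempered_scale[OF assms(1) this] show ?thesis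
    unfolding convolve_def dilate_reflect .
qed

lemma convolve_dilate_continuous:
  fixes \<phi> :: "real^'n::finite \<Rightarrow> complex"
  assumes u: "u \<in> tempered" and \<phi>: "\<phi> \<in> schwartz"
  shows "continuous_on (UNIV \<times> {0<..}) (\<lambda>p. convolve (dilate (snd p) \<phi>) u (fst p))"
proof -
  have 1: "continuous_on ({s. s \<noteq> 0} \<times> UNIV) (\<lambda>(s, b). u (\<lambda>y. \<phi> (s *\<^sub>R y + b)))"
    by (intro continuous_at_imp_continuous_on) (auto intro: tempered_affine_continuous[OF u \<phi>])
  have 2: "continuous_on (UNIV \<times> {0<..}) (\<lambda>p. ((- 1) / snd p, (1 / snd p) *\<^sub>R fst p :: real^'n))"
    by (intro continuous_intros) auto
  have 3: "(\<lambda>p. ((- 1) / snd p, (1 / snd p) *\<^sub>R fst p :: real^'n)) ` (UNIV \<times> {0<..}) \<subseteq> {s. s \<noteq> 0} \<times> UNIV"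
    by auto
  from continuous_on_compose2[OF 1 2 3]
  have "continuous_on (UNIV \<times> {0<..}) (\<lambda>p::(real^'n) \<times> real. u (\<lambda>y. \<phi> ((- 1 / snd p) *\<^sub>R y + (1 / snd p) *\<^sub>R fst p)))"
    by (simp only: case_prod_beta' fst_conv snd_conv)
  then have "continuous_on (UNIV \<times> {0<..}) (\<lambda>p::(real^'n) \<times> real. complex_of_real (1 / snd p ^ CARD('n)) * u (\<lambda>y. \<phi> ((- 1 / snd p) *\<^sub>R y + (1 / snd p) *\<^sub>R fst p)))"
    by (intro continuous_intros) auto
  then show ?thesis
    by (rule continuous_on_cong[THEN iffD1, rotated 2])
       (use convolve_dilate_eq[OF u \<phi>] in auto)
qed

text \<open>A shift of the point by at most \<open>t\<close> is absorbed by a bounded translation of the test function,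
  so the grand maximal function also controls the nontangential maximal function of a single kernel.\<close>

lemma convolve_le_grand_maximal:
  fixes \<phi> :: "real^'n::finite \<Rightarrow> complex"
  assumes \<phi>: "\<phi> \<in> schwartz"
  obtains C where "0 < C"
    "\<And>u x y t. u \<in> tempered \<Longrightarrow> 0 < t \<Longrightarrow> dist x y \<le> t \<Longrightarrow>
       ennreal (cmod (convolve (dilate t \<phi>) u x)) \<le> ennreal C * grand_maximal N u y"
proof -
  \<comment> \<open>For \<open>norm z \<le> 1\<close> the weight satisfies
    \<open>1 + norm w \<le> 2 * (1 + norm (w + z))\<close>, hence the factor \<open>2 ^ N\<close>.
    The constant \<open>C\<close> counts the multi-indices in \<open>schwartz_norm\<close>, and the
    added 1 keeps it positive.\<close>
  define S where "S = 2 ^ N * schwartz_norm N \<phi>"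
  define C where "C = real (card {\<beta> :: 'n \<Rightarrow> nat. mi_order \<beta> \<le> N}) * S + 1"
  have S: "0 \<le> S" using schwartz_norm_nonneg[OF \<phi>] by (simp add: S_def)
  then have C: "0 < C" unfolding C_def by (simp add: add_nonneg_pos)
  show thesis
  proof (rule that[OF C])
    fix u :: "'n functional" and x y :: "real^'n" and t :: real
    assume u: "u \<in> tempered" and t: "0 < t" and xy: "dist x y \<le> t"
    define z where "z = (x - y) /\<^sub>R t"
    have z: "norm z \<le> 1" using xy t by (simp add: z_def dist_norm divide_inverse_commute[symmetric])
    let ?\<psi> = "\<lambda>w. complex_of_real (1 / C) * \<phi> (1 *\<^sub>R w + z)"
    have \<psi>: "?\<psi> \<in> schwartz" by (rule schwartz_affine[OF \<phi>]) simp
    have "schwartz_norm N ?\<psi> \<le> real (card {\<beta> :: 'n \<Rightarrow> nat. mi_order \<beta> \<le> N}) * (S / C)"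
    proof (rule schwartz_norm_le)
      fix "is" :: "'n list" and w :: "real^'n" assume len: "length is \<le> N"
      let ?d = "cmod (foldr partial_deriv is \<phi> (w + z))"
      have "1 + norm w \<le> 2 * (1 + norm (w + z))"
        using z norm_triangle_ineq4[of "w + z" z] by (simp, smt (verit) norm_ge_zero)
      then have "(1 + norm w) ^ N * ?d \<le> (2 * (1 + norm (w + z))) ^ N * ?d"
        by (intro mult_right_mono power_mono) auto
      also have "\<dots> = 2 ^ N * ((1 + norm (w + z)) ^ N * ?d)"
        by (simp only: power_mult_distrib mult.assoc)
      also have "\<dots> \<le> S" unfolding S_def
        by (intro mult_left_mono le_schwartz_norm \<phi> len) auto
      finally have "(1 + norm w) ^ N * ?d \<le> S" .
      then have "1 / C * ((1 + norm w) ^ N * ?d) \<le> 1 / C * S"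
        using C by (intro mult_left_mono) auto
      then show "(1 + norm w) ^ N * cmod (foldr partial_deriv is ?\<psi> w) \<le> S / C"
        unfolding foldr_partial_deriv_affine[OF schwartz_smooth[OF \<phi>]] using C by (simp add: norm_mult norm_divide mult_ac)
    qed
    also have "\<dots> \<le> 1" using C by (simp add: C_def)
    finally have test: "?\<psi> \<in> test_class N" using \<psi> by (simp add: test_class_def)
    have "(\<lambda>v. dilate t \<phi> (x - v)) = (\<lambda>v. complex_of_real C * dilate t ?\<psi> (y - v))"
    proof
      fix v
      have "(x - v) /\<^sub>R t = (y - v) /\<^sub>R t + z"
        by (simp add: z_def algebra_simps)
      then show "dilate t \<phi> (x - v) = complex_of_real C * dilate t ?\<psi> (y - v)"
        using C by (simp add: dilate_def)
    qed
    then have "convolve (dilate t \<phi>) u x = complex_of_real C * convolve (dilate t ?\<psi>) u y"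
      unfolding convolve_def using tempered_scale[OF u dilate_reflect_schwartz[OF \<psi> t], of "complex_of_real C" y] by simp
    then have "ennreal (cmod (convolve (dilate t \<phi>) u x)) = ennreal C * cmod_fun (convolve (dilate t ?\<psi>) u) y"
      using C by (simp add: cmod_fun_def norm_mult ennreal_mult)
    also have "\<dots> \<le> ennreal C * grand_maximal N u y"
      unfolding grand_maximal_def
      by (intro mult_left_mono SUP_upper2[of "(t, ?\<psi>)"]) (use t test in auto)
    finally show "ennreal (cmod (convolve (dilate t \<phi>) u x)) \<le> ennreal C * grand_maximal N u y" .
  qed
qed

section \<open>Log-Hoelder continuous exponents\<close>

lemma epowr_ennreal: "0 \<le> a \<Longrightarrow> epowr (ennreal a) s = ennreal (a powr s)"
  by (simp add: epowr_def)

lemma epowr_mono: "0 \<le> s \<Longrightarrow> a \<le> b \<Longrightarrow> epowr a s \<le> epowr b s"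
  by (auto simp: epowr_def top_unique less_top[symmetric] intro!: ennreal_leI powr_mono2 enn2real_mono)

lemma epowr_mult_right:
  assumes "0 < c" "0 < s"
  shows "epowr (a * ennreal c) s = epowr a s * ennreal (c powr s)"
proof (cases a)
  case (real r)
  have "epowr (ennreal (r * c)) s = ennreal (r powr s) * ennreal (c powr s)"
    using real assms by (subst epowr_ennreal) (auto simp: powr_mult ennreal_mult)
  then show ?thesis using real assms by (simp add: epowr_ennreal ennreal_mult)
next
  case top
  then show ?thesis using assms by (simp add: epowr_def ennreal_top_mult)
qed

lemma epowr_divide:
  assumes "0 < c" "0 < s"
  shows "epowr (a / ennreal c) s = epowr a s * ennreal (c powr (- s))"
  using epowr_mult_right[of "1 / c" s a] assms
  by (simp add: divide_ennreal_def inverse_ennreal inverse_eq_divide powr_minus powr_divide)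

lemma epowr_measurable [measurable]:
  assumes "g \<in> borel_measurable M" "p \<in> borel_measurable M"
  shows "(\<lambda>x. epowr (g x) (p x)) \<in> borel_measurable M"
  unfolding epowr_def using assms by measurable

lemma modular_mono:
  assumes "\<And>x. 0 < p x" "\<And>x. g x \<le> h x"
  shows "modular p g \<le> modular p h"
  unfolding modular_def by (intro nn_integral_mono epowr_mono less_imp_le assms)

text \<open>Turns a bound of a modular by some constant into a bound by 1, which is what the norm is
  made of: a divisor \<open>c \<ge> 1\<close> gains at least the factor
  \<open>c powr (- b)\<close>.\<close>

lemma modular_divide_le:
  assumes [measurable]: "p \<in> borel_measurable lebesgue" "g \<in> borel_measurable lebesgue"
    and p: "\<And>x. b \<le> p x" "0 < b" and c: "1 \<le> c"
  shows "modular p (\<lambda>x. g x / ennreal c) \<le> ennreal (c powr (- b)) * modular p g"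
proof -
  have "epowr (g x / ennreal c) (p x) \<le> ennreal (c powr (- b)) * epowr (g x) (p x)" for x
  proof -
    have "c powr (- p x) \<le> c powr (- b)" using p(1)[of x] c by (intro powr_mono) auto
    moreover have "epowr (g x / ennreal c) (p x) = epowr (g x) (p x) * ennreal (c powr (- p x))"
      using p(1)[of x] p(2) c by (intro epowr_divide) auto
    ultimately show ?thesis by (simp add: mult.commute[of _ "epowr _ _"] mult_left_mono ennreal_leI)
  qed
  then have "modular p (\<lambda>x. g x / ennreal c) \<le> (\<integral>\<^sup>+x. ennreal (c powr (- b)) * epowr (g x) (p x) \<partial>lebesgue)"
    unfolding modular_def by (rule nn_integral_mono)
  then show ?thesis by (simp add: modular_def nn_integral_cmult)
qed

text \<open>The second log-Hoelder bound compares points far out, so the values along a ray form a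
  Cauchy sequence; letting the outer point run to infinity along that ray gives the estimate against
  the limit \<open>pinf\<close>.\<close>

lemma LH_limit:
  fixes p :: "real^'n \<Rightarrow> real"
  assumes "p \<in> LH" and bounds: "\<And>x. a \<le> p x" "\<And>x. p x \<le> b"
  obtains C pinf where "0 < C" "a \<le> pinf" "pinf \<le> b"
    "\<And>x. \<bar>p x - pinf\<bar> \<le> C / ln (norm x + exp 1)"
    "\<And>x y. norm (x - y) \<le> 1/2 \<Longrightarrow> \<bar>p x - p y\<bar> \<le> C / (- ln (norm (x - y)))"
proof -
  obtain C where C: "0 < C" "\<And>x y. norm (x - y) \<le> 1/2 \<Longrightarrow> \<bar>p x - p y\<bar> \<le> C / (- ln (norm (x - y)))"
    "\<And>x y. norm x \<le> norm y \<Longrightarrow> \<bar>p x - p y\<bar> \<le> C / ln (norm x + exp 1)"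
    using assms(1) by (auto simp: LH_def)
  define e where "e k = real k *\<^sub>R (axis undefined 1 :: real^'n)" for k
  have e: "norm (e k) = real k" for k by (simp add: e_def)
  have "Cauchy (\<lambda>k. p (e k))"
  proof (rule metric_CauchyI)
    fix \<epsilon> :: real assume \<epsilon>: "0 < \<epsilon>"
    obtain N where N: "exp (2 * C / \<epsilon>) < real N" using reals_Archimedean2 by blast
    have small: "\<bar>p (e N) - p (e k)\<bar> < \<epsilon> / 2" if "N \<le> k" for k
    proof -
      have *: "2 * C / \<epsilon> < ln (real N + exp 1)"
      proof -
        have "exp (2 * C / \<epsilon>) < real N + exp 1" using N exp_gt_zero[of 1] by linarith
        then have "ln (exp (2 * C / \<epsilon>)) < ln (real N + exp 1)"
          by (subst ln_less_cancel_iff) (auto intro: add_nonneg_pos)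
        then show ?thesis by simp
      qed
      then have "C / ln (real N + exp 1) < \<epsilon> / 2"
      proof -
        have "0 < 2 * C / \<epsilon>" using C(1) \<epsilon> by simp
        then have "0 < ln (real N + exp 1)" using * by linarith
        then show ?thesis using * \<epsilon> by (simp add: field_simps)
      qed
      moreover have "\<bar>p (e N) - p (e k)\<bar> \<le> C / ln (real N + exp 1)"
        using C(3)[of "e N" "e k"] that by (simp add: e)
      ultimately show ?thesis by linarith
    qed
    show "\<exists>M. \<forall>m\<ge>M. \<forall>k\<ge>M. dist (p (e m)) (p (e k)) < \<epsilon>"
    proof (intro exI[of _ N] allI impI)
      fix m k assume "N \<le> m" "N \<le> k"
      then show "dist (p (e m)) (p (e k)) < \<epsilon>"
        using small[of m] small[of k] unfolding dist_real_def by linarith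
    qed
  qed
  then obtain pinf where lim: "(\<lambda>k. p (e k)) \<longlonglongrightarrow> pinf"
    using convergent_eq_Cauchy by (auto simp: Cauchy_convergent_iff convergent_def)
  show thesis
  proof (rule that[of C pinf])
    show "a \<le> pinf" by (rule LIMSEQ_le_const[OF lim]) (use bounds in auto)
    show "pinf \<le> b" by (rule LIMSEQ_le_const2[OF lim]) (use bounds in auto)
    show "\<bar>p x - pinf\<bar> \<le> C / ln (norm x + exp 1)" for x
    proof -
      obtain N where N: "norm x < real N" using reals_Archimedean2 by blast
      have "(\<lambda>k. \<bar>p x - p (e k)\<bar>) \<longlonglongrightarrow> \<bar>p x - pinf\<bar>" by (intro tendsto_intros lim)
      then show ?thesis
        by (rule LIMSEQ_le_const2) (use N C(3)[of x "e _"] in \<open>auto simp: e intro!: exI[of _ N]\<close>)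
    qed
  qed (use C in auto)
qed

text \<open>The modular is at least \<open>A powr e\<close> times the volume of the ball; the
  conclusion is the logarithm of this. The hypothesis on \<open>e\<close> handles both signs of
  \<open>ln A\<close>: for \<open>A > 1\<close> the number \<open>e\<close> bounds the exponent from
  below on the ball, for \<open>A < 1\<close> from above.\<close>

lemma modular_ball:
  fixes p :: "real^'n \<Rightarrow> real"
  assumes "modular p g \<le> 1" "\<And>x. 0 < p x" "0 < A" "0 < r"
    and g: "\<And>y. y \<in> ball z r \<Longrightarrow> ennreal A \<le> g y"
    and e: "\<And>y. y \<in> ball z r \<Longrightarrow> e * ln A \<le> p y * ln A"
  shows "e * ln A + real CARD('n) * ln r + ln (unit_ball_vol (real CARD('n))) \<le> 0"
proof -
  let ?\<omega> = "unit_ball_vol (real CARD('n))"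
  have \<omega>: "0 < ?\<omega>" by simp
  have "ennreal (A powr e * (?\<omega> * r ^ CARD('n))) = ennreal (A powr e) * emeasure lebesgue (ball z r)"
    using assms by (simp add: emeasure_ball ennreal_mult)
  also have "\<dots> = (\<integral>\<^sup>+x. ennreal (A powr e) * indicator (ball z r) x \<partial>lebesgue)"
    by (simp add: nn_integral_cmult_indicator)
  also have "\<dots> \<le> modular p g"
    unfolding modular_def
  proof (intro nn_integral_mono)
    fix x
    show "ennreal (A powr e) * indicator (ball z r) x \<le> epowr (g x) (p x)"
    proof (cases "x \<in> ball z r")
      case True
      have "ennreal (A powr e) \<le> ennreal (A powr p x)"
        using e[OF True] assms by (simp add: powr_def)
      also have "\<dots> = epowr (ennreal A) (p x)" using assms by (simp add: epowr_ennreal)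
      also have "\<dots> \<le> epowr (g x) (p x)" using g[OF True] assms by (intro epowr_mono) (auto intro: less_imp_le)
      finally show ?thesis using True by simp
    qed simp
  qed
  also have "\<dots> \<le> 1" by fact
  finally have "A powr e * (?\<omega> * r ^ CARD('n)) \<le> 1" by (simp add: ennreal_le_1)
  then have "ln (A powr e * (?\<omega> * r ^ CARD('n))) \<le> 0"
    using \<omega> assms by (subst ln_le_zero_iff) (auto intro!: mult_pos_pos)
  then show ?thesis using \<omega> assms by (simp add: ln_mult ln_powr ln_realpow)
qed

text \<open>The centre \<open>z\<close> is reached from \<open>x\<close> by moving
  \<open>t / 2\<close> away from the origin. All points of the smaller ball then have norm
  comparable with \<open>t\<close> or larger, so exponents there are close to their limit at
  infinity; a ball about \<open>x\<close> itself may contain the origin.\<close>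

lemma far_ball:
  fixes x :: "real^'n"
  assumes "0 < t"
  obtains z where "ball z (t/4) \<subseteq> ball x t" "\<And>y. y \<in> ball z (t/4) \<Longrightarrow> t/4 \<le> norm y"
proof -
  obtain v :: "real^'n" where v: "norm v = 1" "x = norm x *\<^sub>R v"
  proof (cases "x = 0")
    case True
    then show thesis by (intro that[of "axis undefined 1"]) auto
  next
    case False
    then show thesis by (intro that[of "x /\<^sub>R norm x"]) auto
  qed
  define z where "z = x + (t/2) *\<^sub>R v"
  have "z = (norm x + t/2) *\<^sub>R v" using v by (simp add: z_def scaleR_left_distrib)
  then have nz: "norm z = norm x + t/2" using v assms by simp
  have xz: "dist x z = t/2" using v assms by (simp add: z_def dist_norm)
  show thesis
  proof (rule that[of z])
    show "ball z (t/4) \<subseteq> ball x t"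
    proof
      fix y assume "y \<in> ball z (t/4)"
      then show "y \<in> ball x t" using xz dist_triangle[of x y z] assms by simp
    qed
    show "t/4 \<le> norm y" if "y \<in> ball z (t/4)" for y
    proof -
      have "norm (z - y) < t/4" using that by (simp add: dist_norm)
      then show ?thesis using nz norm_triangle_ineq2[of z y] norm_ge_zero[of x] by linarith
    qed
  qed
qed

lemma inverse_shift_le:
  fixes c e a \<delta> :: real
  assumes "0 < a" "a \<le> c" "a \<le> e" "\<bar>c - e\<bar> \<le> \<delta>"
  shows "1 / e \<le> 1 / c + \<delta> / a\<^sup>2"
proof -
  have "1 / e - 1 / c = (c - e) / (e * c)" using assms by (simp add: field_simps)
  also have "\<dots> \<le> \<delta> / (e * c)" using assms by (intro divide_right_mono) auto
  also have "\<dots> \<le> \<delta> / (a * a)" using assms by (intro divide_left_mono mult_mono mult_pos_pos) auto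
  finally show ?thesis by (simp add: power2_eq_square)
qed

text \<open>In logarithmic form: \<open>A \<le> exp K * t powr (- n / p x)\<close> for small and
  \<open>A \<le> exp K * t powr (- n / pinf)\<close> for large balls. Here log-Hoelder continuity makes the modular
  behave like a constant exponent modular on each ball.\<close>

lemma ball_bound:
  fixes p :: "real^'n \<Rightarrow> real"
  assumes bounds: "\<And>x. a \<le> p x" "0 < a" "a \<le> pinf" and C: "0 < C"
    and inf: "\<And>x. \<bar>p x - pinf\<bar> \<le> C / ln (norm x + exp 1)"
    and loc: "\<And>x y. norm (x - y) \<le> 1/2 \<Longrightarrow> \<bar>p x - p y\<bar> \<le> C / (- ln (norm (x - y)))"
  obtains K where "0 \<le> K"
    "\<And>g A x t. modular p g \<le> 1 \<Longrightarrow> 0 < A \<Longrightarrow> 0 < t \<Longrightarrow> (\<And>y. y \<in> ball x t \<Longrightarrow> ennreal A \<le> g y) \<Longrightarrow>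
      t \<le> 1 \<Longrightarrow> ln A \<le> K - real CARD('n) / p x * ln t"
    "\<And>g A x t. modular p g \<le> 1 \<Longrightarrow> 0 < A \<Longrightarrow> 0 < t \<Longrightarrow> (\<And>y. y \<in> ball x t \<Longrightarrow> ennreal A \<le> g y) \<Longrightarrow>
      1 \<le> t \<Longrightarrow> ln A \<le> K - real CARD('n) / pinf * ln t"
proof -
  let ?n = "real CARD('n)" and ?\<omega> = "ln (unit_ball_vol (real CARD('n)))"
  have p0: "0 < p x" for x using bounds(1)[of x] bounds(2) by linarith
  \<comment> \<open>The terms pay for the radii \<open>t / 2\<close> and \<open>t / 4\<close>, for
    the volume of the unit ball and for the log-Hoelder error; the factors 2 and 5 cover the worst
    of the cases below.\<close>
  define K where "K = ?n * ln 4 / a + 2 * (\<bar>?\<omega>\<bar> / a) + 5 * (?n * C / a\<^sup>2)"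
  have K: "0 \<le> K" "?n * ln 4 / a \<ge> 0" "\<bar>?\<omega>\<bar> / a \<ge> 0" "?n * C / a\<^sup>2 \<ge> 0"
    using bounds C by (auto simp: K_def intro!: add_nonneg_nonneg divide_nonneg_pos)
  show thesis
  proof (rule that[OF K(1)])
    fix g A x and t :: real
    assume g: "modular p g \<le> 1" "0 < A" "0 < t" "\<And>y. y \<in> ball x t \<Longrightarrow> ennreal A \<le> g y" "t \<le> 1"
    show "ln A \<le> K - ?n / p x * ln t"
    proof (cases "A \<le> 1")
      case True
      then have "ln A \<le> 0" using g by simp
      moreover have "?n / p x * ln t \<le> 0" using g p0[of x] by (intro mult_nonneg_nonpos) auto
      ultimately show ?thesis using K by linarith
    next
      case False
      then have A: "0 < ln A" by simp
      \<comment> \<open>On the half ball distances to \<open>x\<close> are below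
        \<open>t / 2 \<le> 1 / 2\<close>, so the exponent varies by at most \<open>C / L\<close>. In
        the end the error in its reciprocal is multiplied by \<open>L\<close>, hence stays bounded
        however small \<open>t\<close> is.\<close>
      define L where "L = - ln (t / 2)"
      have L: "ln 2 \<le> L" using g by (simp add: L_def ln_div)
      have L0: "0 < L" using L ln_gt_zero[of 2] by linarith
      \<comment> \<open>A lower bound for \<open>p\<close> on the half ball; the maximum with
        \<open>a\<close> keeps it away from 0, since it becomes a divisor.\<close>
      define e where "e = max a (p x - C / L)"
      have e: "a \<le> e" "p x - e \<le> C / L" by (auto simp: e_def)
      have "e \<le> p x" using bounds(1)[of x] C L0 by (simp add: e_def)
      then have e': "\<bar>p x - e\<bar> \<le> C / L" using e by simp
      have "e \<le> p y" if "y \<in> ball x (t/2)" for y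
      proof -
        have d: "norm (x - y) < t / 2" using that by (simp add: dist_norm)
        have "\<bar>p x - p y\<bar> \<le> C / L"
        proof (cases "x = y")
          case True then show ?thesis using C L0 by simp
        next
          case False
          have "\<bar>p x - p y\<bar> \<le> C / (- ln (norm (x - y)))" using d g by (intro loc) auto
          also have "\<dots> \<le> C / L"
          proof (intro divide_left_mono)
            show "L \<le> - ln (norm (x - y))" using False d g(3) unfolding L_def by (subst neg_le_iff_le, subst ln_le_cancel_iff) auto
            then show "0 < - ln (norm (x - y)) * L" using L0 by (intro mult_pos_pos) auto
          qed (use C in auto)
          finally show ?thesis .
        qed
        then show ?thesis using bounds(1)[of y] by (auto simp: e_def)
      qed
      then have "e * ln A + ?n * ln (t/2) + ?\<omega> \<le> 0"
        using g A p0 by (intro modular_ball[OF g(1), where r = "t/2" and z = x]) (auto intro: mult_right_mono)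
      then have "e * ln A \<le> ?n * L - ?\<omega>" by (simp add: L_def)
      then have "ln A \<le> (?n * L - ?\<omega>) / e" using e bounds by (simp add: field_simps)
      also have "\<dots> \<le> ?n * L * (1 / e) + \<bar>?\<omega>\<bar> / a"
      proof -
        have "- ?\<omega> / e \<le> \<bar>?\<omega>\<bar> / e" using e bounds by (intro divide_right_mono) auto
        also have "\<dots> \<le> \<bar>?\<omega>\<bar> / a" using e bounds by (intro divide_left_mono) auto
        finally show ?thesis by (simp add: diff_divide_distrib)
      qed
      also have "\<dots> \<le> ?n * L * (1 / p x + (C / L) / a\<^sup>2) + \<bar>?\<omega>\<bar> / a"
        using L0 by (intro add_right_mono mult_left_mono inverse_shift_le[OF bounds(2)] bounds e e') auto
      also have "\<dots> = ?n * ln 2 / p x + ?n * C / a\<^sup>2 + \<bar>?\<omega>\<bar> / a - ?n / p x * ln t"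
        using L0 g p0[of x] bounds by (simp add: L_def ln_div field_simps)
      finally have "ln A \<le> ?n * ln 2 / p x + ?n * C / a\<^sup>2 + \<bar>?\<omega>\<bar> / a - ?n / p x * ln t" .
      moreover have "?n * ln 2 / p x \<le> ?n * ln 4 / a"
        using bounds(1)[of x] bounds(2) by (intro frac_le mult_left_mono) auto
      moreover have "l \<le> X' + 2 * w + 5 * c - Y"
        if "l \<le> X + c + w - Y" "X \<le> X'" "0 \<le> w" "0 \<le> c" for l X X' c w Y :: real
        using that by linarith
      ultimately show ?thesis using K(3,4) unfolding K_def by blast
    qed
  next
    fix g A x and t :: real
    assume g: "modular p g \<le> 1" "0 < A" "0 < t" "\<And>y. y \<in> ball x t \<Longrightarrow> ennreal A \<le> g y" "1 \<le> t"
    have lt: "0 \<le> ln t" using g by simp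
    show "ln A \<le> K - ?n / pinf * ln t"
    proof (cases "1 \<le> A")
      case True
      then have A: "0 \<le> ln A" by simp
      \<comment> \<open>For \<open>A \<ge> 1\<close> the crude exponent \<open>a\<close> suffices:
        it bounds \<open>ln A\<close> and \<open>ln t\<close> simultaneously, because a unit modular
        leaves no room for such a level on a very large ball.\<close>
      have "a * ln A + ?n * ln t + ?\<omega> \<le> 0"
        using g A p0 bounds by (intro modular_ball[OF g(1), where r = t and z = x]) (auto intro: mult_right_mono)
      then have 1: "a * ln A + ?n * ln t \<le> \<bar>?\<omega>\<bar>" by linarith
      moreover have "0 \<le> a * ln A" "0 \<le> ?n * ln t" using A lt bounds by auto
      ultimately have "a * ln A \<le> \<bar>?\<omega>\<bar>" "?n * ln t \<le> \<bar>?\<omega>\<bar>" by linarith+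
      then have "ln A \<le> \<bar>?\<omega>\<bar> / a" "?n * ln t / pinf \<le> \<bar>?\<omega>\<bar> / a"
        using bounds lt by (auto simp: field_simps intro!: frac_le)
          (smt (verit) mult_right_mono mult_left_mono mult.commute)
      moreover have "l \<le> m' + 2 * w + 5 * c - v" if "l \<le> w" "v \<le> w" "0 \<le> m'" "0 \<le> c" for l m' v w c :: real
        using that by linarith
      ultimately show ?thesis using K(2,4) unfolding K_def by (simp only: times_divide_eq_left)
    next
      case False
      then have A: "ln A < 0" using g by simp
      obtain z where z: "ball z (t/4) \<subseteq> ball x t" "\<And>y. y \<in> ball z (t/4) \<Longrightarrow> t/4 \<le> norm y"
        using far_ball[OF g(3)] by blast
      define L where "L = ln (t/4 + exp 1)"
      have L1: "1 \<le> L"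
      proof -
        have "ln (exp 1) \<le> L" unfolding L_def using g by (subst ln_le_cancel_iff) (auto intro: add_pos_pos)
        then show ?thesis by simp
      qed
      \<comment> \<open>As \<open>ln A\<close> is negative, \<open>modular_ball\<close> asks for an
        upper bound of the exponent. On the ball about \<open>z\<close> norms are at least
        \<open>t / 4\<close>, so \<open>p\<close> exceeds \<open>pinf\<close> by at most
        \<open>C / L\<close>.\<close>
      define e where "e = pinf + C / L"
      have e: "a \<le> e" "\<bar>pinf - e\<bar> \<le> C / L" using bounds C L1 by (auto simp: e_def intro: add_increasing2)
      have pe: "p y \<le> e" if "y \<in> ball z (t/4)" for y
      proof -
        have "p y - pinf \<le> C / ln (norm y + exp 1)" using inf[of y] by linarith
        also have "\<dots> \<le> C / L"
        proof (intro divide_left_mono)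
          show "L \<le> ln (norm y + exp 1)" unfolding L_def using z(2)[OF that] g
            by (subst ln_le_cancel_iff) (auto intro: add_pos_pos add_nonneg_pos)
          then show "0 < ln (norm y + exp 1) * L" using L1 by (intro mult_pos_pos) auto
        qed (use C in auto)
        finally show ?thesis by (simp add: e_def)
      qed
      have "e * ln A + ?n * ln (t/4) + ?\<omega> \<le> 0"
        using g A p0 z pe by (intro modular_ball[OF g(1), where r = "t/4" and z = z]) (auto intro: mult_right_mono_neg)
      then have "e * ln A \<le> - (?n * ln t) + ?n * ln 4 + \<bar>?\<omega>\<bar>" using g by (simp add: ln_div algebra_simps)
      then have "ln A \<le> (- (?n * ln t) + ?n * ln 4 + \<bar>?\<omega>\<bar>) / e" using e bounds by (simp add: field_simps)
      also have "\<dots> = - (?n * ln t / e) + (?n * ln 4 / e + \<bar>?\<omega>\<bar> / e)" by (simp add: add_divide_distrib diff_divide_distrib)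
      finally have 1: "ln A \<le> - (?n * ln t / e) + (?n * ln 4 / e + \<bar>?\<omega>\<bar> / e)" .
      have 2: "?n * ln 4 / e + \<bar>?\<omega>\<bar> / e \<le> ?n * ln 4 / a + \<bar>?\<omega>\<bar> / a"
        using e bounds by (intro add_mono divide_left_mono) auto
      have 3: "- (?n * ln t / e) \<le> - (?n * ln t / pinf) + 5 * (?n * C / a\<^sup>2)"
      proof -
        have "1 / pinf \<le> 1 / e + (C / L) / a\<^sup>2"
          using e by (intro inverse_shift_le[OF bounds(2)] bounds) auto
        then have "?n * ln t * (1 / pinf) \<le> ?n * ln t * (1 / e + (C / L) / a\<^sup>2)"
          using lt by (intro mult_left_mono) auto
        also have "\<dots> = ?n * ln t / e + (ln t / L) * (?n * C / a\<^sup>2)" by (simp add: field_simps)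
        finally have 4: "?n * ln t / pinf \<le> ?n * ln t / e + (ln t / L) * (?n * C / a\<^sup>2)" by simp
        \<comment> \<open>Here \<open>ln t\<close> is at most a multiple of \<open>L\<close>, so the
          error \<open>C / L\<close> of the exponent contributes a bounded amount after
          multiplication by \<open>ln t\<close>.\<close>
        have "ln t / L \<le> 5"
        proof -
          have te: "0 < t/4 + exp 1" using g by (intro add_pos_pos) auto
          have "ln t \<le> ln (4 * (t/4 + exp 1))" using g te by (subst ln_le_cancel_iff) auto
          also have "\<dots> = ln 4 + L" unfolding L_def using te by (subst ln_mult) auto
          also have "ln 4 \<le> (3::real)" using ln_le_minus_one[of 4] by simp
          finally have "ln t \<le> 5 * L" using L1 by linarith
          then show ?thesis using L1 by (simp add: field_simps)
        qed
        from mult_right_mono[OF this K(4)] 4 show ?thesis by linarith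
      qed
      have "l \<le> m' + 2 * w + 5 * c - v"
        if "l \<le> - u + m" "m \<le> m' + w" "- u \<le> - v + 5 * c" "0 \<le> w" for l m m' u v w c :: real
        using that by linarith
      from this[OF 1 2 3 K(3)] show ?thesis unfolding K_def by (simp only: times_divide_eq_left)
    qed
  qed
qed

section \<open>Hedberg's inequality\<close>

text \<open>Dyadic decomposition: where \<open>1 + norm x\<close> lies between \<open>2 ^ k\<close>
  and \<open>2 ^ (k + 1)\<close>, the weight is at most \<open>c k\<close>, and the covering ball
  has volume proportional to \<open>2 ^ (n * (k + 1))\<close>. The resulting series is geometric
  with ratio \<open>r = 2 powr (n - s)\<close>.\<close>

lemma nn_integral_weight_finite:
  fixes s :: real
  assumes s: "real CARD('n) < s"
  shows "(\<integral>\<^sup>+x. ennreal ((1 + norm (x::real^'n)) powr (- s)) \<partial>lborel) < \<infinity>"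
proof -
  let ?n = "CARD('n)" and ?\<omega> = "unit_ball_vol (real CARD('n))"
  define c where "c k = (2 powr (- s)) ^ k" for k :: nat
  define r where "r = 2 powr (real ?n - s)"
  have r: "0 \<le> r" "r < 1" unfolding r_def using s by (auto simp: powr_less_one)
  have le: "ennreal ((1 + norm x) powr (- s)) \<le> (\<Sum>k. ennreal (c k) * indicator (ball (0::real^'n) (2 ^ (k + 1))) x)" for x
  proof -
    define k where "k = nat \<lfloor>log 2 (1 + norm x)\<rfloor>"
    have x: "1 \<le> 1 + norm x" by simp
    then have l0: "0 \<le> log 2 (1 + norm x)" by (subst zero_le_log_cancel_iff) (auto intro: add_pos_nonneg)
    have k: "real k \<le> log 2 (1 + norm x)" "log 2 (1 + norm x) < real k + 1"
      unfolding k_def using l0 by (auto simp: of_nat_nat)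
    have "2 powr real k \<le> 1 + norm x" "1 + norm x < 2 powr (real k + 1)"
      using k x by (auto simp: le_log_iff log_less_iff)
    then have k': "2 powr real k \<le> 1 + norm x" "norm x < 2 ^ (k + 1)"
      by (auto simp: powr_add powr_realpow)
    have "(1 + norm x) powr (- s) \<le> (2 powr real k) powr (- s)"
      using s k' by (intro powr_mono2') (auto intro: less_trans[of 0 "real CARD('n)"])
    also have "\<dots> = c k" by (simp add: c_def powr_powr powr_realpow[symmetric] mult.commute)
    finally have "ennreal ((1 + norm x) powr (- s)) \<le> ennreal (c k) * indicator (ball (0::real^'n) (2 ^ (k + 1))) x"
      using k' by (simp add: ennreal_leI)
    also have "\<dots> \<le> (\<Sum>k. ennreal (c k) * indicator (ball (0::real^'n) (2 ^ (k + 1))) x)"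
    proof -
      have "sum f {k} \<le> suminf f" for f :: "nat \<Rightarrow> ennreal"
        by (rule sum_le_suminf) auto
      then show ?thesis by (simp only: sum.insert finite.emptyI empty_iff not_False_eq_True sum.empty add_0_right)
    qed
    finally show ?thesis .
  qed
  have eq: "ennreal (c k) * emeasure lborel (ball (0::real^'n) (2 ^ (k + 1))) = ennreal (?\<omega> * 2 ^ ?n * r ^ k)" for k
  proof -
    have "c k * (2 ^ (k + 1)) ^ ?n = 2 ^ ?n * r ^ k"
      by (simp add: c_def r_def power_mult_distrib powr_diff powr_minus powr_realpow power_mult[symmetric] mult.commute[of k] divide_inverse power_inverse)
    then show ?thesis by (simp add: emeasure_ball c_def ennreal_mult[symmetric] mult_ac)
  qed
  have "(\<integral>\<^sup>+x. ennreal ((1 + norm (x::real^'n)) powr (- s)) \<partial>lborel)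
    \<le> (\<integral>\<^sup>+x. (\<Sum>k. ennreal (c k) * indicator (ball (0::real^'n) (2 ^ (k + 1))) x) \<partial>lborel)"
    by (intro nn_integral_mono le)
  also have "\<dots> = (\<Sum>k. ennreal (?\<omega> * 2 ^ ?n * r ^ k))"
  proof -
    have "(\<integral>\<^sup>+x. (\<Sum>k. a k * indicator (B k) x) \<partial>lborel) = (\<Sum>k. a k * emeasure lborel (B k))"
      if "\<And>k. B k \<in> sets borel" for a :: "nat \<Rightarrow> ennreal" and B :: "nat \<Rightarrow> (real^'n) set"
      using that by (subst nn_integral_suminf) (auto simp: nn_integral_cmult_indicator)
    then show ?thesis unfolding eq[symmetric] by simp
  qed
  also have "\<dots> = ennreal (\<Sum>k. ?\<omega> * 2 ^ ?n * r ^ k)"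
    using r by (intro suminf_ennreal2 summable_mult summable_geometric) auto
  finally show ?thesis by (rule order_le_less_trans) simp
qed

lemma nn_integral_powr_0:
  assumes "0 < a" "0 \<le> c"
  shows "(\<integral>\<^sup>+t. ennreal (t powr (a - 1)) * indicator {0..c} t \<partial>lborel) = ennreal (c powr a / a)"
proof -
  have "((\<lambda>t. t powr (a - 1)) has_integral (c powr (a - 1 + 1) / (a - 1 + 1))) {0..c}"
    by (rule has_integral_powr_from_0) (use assms in auto)
  from nn_integral_has_integral_lebesgue[OF _ this] show ?thesis
    by (simp add: mult.commute)
       (metis (no_types, lifting) ennreal_indicator ennreal_mult' indicator_pos_le mult.commute nn_integral_cong)
qed

lemma nn_integral_powr_inf:
  assumes "0 < a" "0 < c"
  shows "(\<integral>\<^sup>+t. ennreal (t powr (- a - 1)) * indicator {c..} t \<partial>lborel) = ennreal (c powr (- a) / a)"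
proof -
  have "((\<lambda>t. t powr (- a - 1)) has_integral (- (c powr (- a - 1 + 1)) / (- a - 1 + 1))) {c..}"
    by (rule has_integral_powr_to_inf) (use assms in auto)
  from nn_integral_has_integral_lebesgue[OF _ this] show ?thesis
    by (simp add: mult.commute)
       (metis (no_types, lifting) ennreal_indicator ennreal_mult' indicator_pos_le mult.commute nn_integral_cong)
qed

text \<open>The flat bound \<open>G\<close> is used up to a scale \<open>c\<close> and a power bound
  beyond it, with \<open>c\<close> balancing the two. There are two rates because a variable
  exponent acts through its value at the point for scales below 1 and through its limit at infinity
  above 1. The parameter \<epsilon> makes the constant independent of the rates.\<close>

lemma hedberg:
  fixes \<alpha> \<epsilon> K G \<sigma> \<tau> :: real and \<Phi> :: "real \<Rightarrow> ennreal"
  assumes \<alpha>: "0 < \<alpha>" and \<epsilon>: "0 < \<epsilon>" "\<epsilon> \<le> \<sigma>" "\<epsilon> \<le> \<tau>" and K: "0 \<le> K" and G: "0 \<le> G"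
    and \<Phi>: "\<And>t. 0 < t \<Longrightarrow> \<Phi> t \<le> ennreal G"
      "\<And>t. 0 < t \<Longrightarrow> t \<le> 1 \<Longrightarrow> \<Phi> t \<le> ennreal (K * t powr (- (\<sigma> + \<alpha>)))"
      "\<And>t. 1 \<le> t \<Longrightarrow> \<Phi> t \<le> ennreal (K * t powr (- (\<tau> + \<alpha>)))"
  shows "(\<integral>\<^sup>+t. ennreal (t powr (\<alpha> - 1)) * \<Phi> t * indicator {0<..} t \<partial>lborel)
    \<le> ennreal ((1 / \<alpha> + 2 * K / \<epsilon>) * (if 1 \<le> G then G powr (\<sigma> / (\<sigma> + \<alpha>)) else G powr (\<tau> / (\<tau> + \<alpha>))))"
proof (cases "G = 0")
  case True
  then have z: "ennreal (t powr (\<alpha> - 1)) * \<Phi> t * indicator {0<..} t = 0" for t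
    using \<Phi>(1)[of t] by (auto simp: indicator_def)
  show ?thesis unfolding z by simp
next
  case False
  then have G0: "0 < G" using G by simp
  let ?I = "\<integral>\<^sup>+t. ennreal (t powr (\<alpha> - 1)) * \<Phi> t * indicator {0<..} t \<partial>lborel"
  let ?z = "\<lambda>c t. ennreal G * (ennreal (t powr (\<alpha> - 1)) * indicator {0..c} t)"
  let ?i = "\<lambda>\<rho> c t. ennreal K * (ennreal (t powr (- \<rho> - 1)) * indicator {c..} t)"
  have z: "(\<integral>\<^sup>+t. ?z c t \<partial>lborel) = ennreal (G * (c powr \<alpha> / \<alpha>))" if "0 \<le> c" for c
    using nn_integral_powr_0[OF \<alpha> that] G by (simp add: nn_integral_cmult ennreal_mult'[symmetric])
  have i: "(\<integral>\<^sup>+t. ?i \<rho> c t \<partial>lborel) = ennreal (K * (c powr (- \<rho>) / \<rho>))" if "0 < \<rho>" "0 < c" for c \<rho>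
    using nn_integral_powr_inf[OF that] K by (simp add: nn_integral_cmult ennreal_mult'[symmetric])
  have pt: "t powr (\<alpha> - 1) * (K * t powr (- (\<rho> + \<alpha>))) = K * t powr (- \<rho> - 1)" if "0 < t" for t \<rho>
  proof -
    have "t powr (\<alpha> - 1) * t powr (- (\<rho> + \<alpha>)) = t powr (\<alpha> - 1 + - (\<rho> + \<alpha>))"
      by (simp only: powr_add)
    also have "\<alpha> - 1 + - (\<rho> + \<alpha>) = - \<rho> - 1" by simp
    finally show ?thesis by (simp only: mult.left_commute)
  qed
  have bz: "ennreal (t powr (\<alpha> - 1)) * \<Phi> t * indicator {0<..} t \<le> ?z c t" if "0 < t" "t \<le> c" for t c
    using mult_left_mono[OF \<Phi>(1)[OF that(1)], of "ennreal (t powr (\<alpha> - 1))"] that by (simp add: mult.commute)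
  have bi: "ennreal (t powr (\<alpha> - 1)) * \<Phi> t * indicator {0<..} t \<le> ?i \<rho> c t"
    if "0 < t" "c \<le> t" "\<Phi> t \<le> ennreal (K * t powr (- (\<rho> + \<alpha>)))" for t c \<rho>
  proof -
    have "ennreal (t powr (\<alpha> - 1)) * \<Phi> t \<le> ennreal (t powr (\<alpha> - 1)) * ennreal (K * t powr (- (\<rho> + \<alpha>)))"
      by (rule mult_left_mono[OF that(3)]) simp
    also have "\<dots> = ennreal (K * t powr (- \<rho> - 1))"
      by (simp only: ennreal_mult'[symmetric] powr_ge_zero pt[OF that(1)])
    also have "\<dots> = ennreal K * ennreal (t powr (- \<rho> - 1))" using K by (simp add: ennreal_mult')
    finally show ?thesis using that by simp
  qed
  show ?thesis
  proof (cases "1 \<le> G")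
    case True
    \<comment> \<open>Up to the constant \<open>K\<close>, the scale where the flat bound meets the
      decay of rate \<sigma>; it is at most 1 because \<open>G \<ge> 1\<close>. Scales beyond 1
      contribute only \<open>K / \<tau>\<close>, which is absorbed since \<open>?R \<ge> 1\<close>
      and accounts for the factor 2 in the constant.\<close>
    define c where "c = G powr (- (1 / (\<sigma> + \<alpha>)))"
    have c: "0 < c" "c \<le> 1" unfolding c_def using True \<epsilon> \<alpha> by (auto simp: powr_minus inverse_le_1_iff intro!: ge_one_powr_ge_zero)
    let ?R = "G powr (\<sigma> / (\<sigma> + \<alpha>))"
    have R: "1 \<le> ?R" using True \<epsilon> \<alpha> by (intro ge_one_powr_ge_zero) auto
    have "ennreal (t powr (\<alpha> - 1)) * \<Phi> t * indicator {0<..} t \<le> ?z c t + (?i \<sigma> c t + ?i \<tau> 1 t)" for t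
    proof -
      consider "t \<le> 0" | "0 < t" "t \<le> c" | "c \<le> t" "t \<le> 1" "0 < t" | "1 \<le> t" by linarith
      then show ?thesis
      proof cases
        case 2 then show ?thesis using bz[of t c] by (intro add_increasing2) auto
      next
        case 3 then show ?thesis using bi[of t c \<sigma>] \<Phi>(2)[of t] by (intro add_increasing add_increasing2) auto
      next
        case 4 then show ?thesis using bi[of t 1 \<tau>] \<Phi>(3)[of t] by (intro add_increasing) auto
      qed auto
    qed
    then have "?I \<le> (\<integral>\<^sup>+t. ?z c t + (?i \<sigma> c t + ?i \<tau> 1 t) \<partial>lborel)"
      by (rule nn_integral_mono)
    also have "\<dots> = ennreal (G * (c powr \<alpha> / \<alpha>) + (K * (c powr (- \<sigma>) / \<sigma>) + K * (1 powr (- \<tau>) / \<tau>)))"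
      using c \<epsilon> K G \<alpha> by (simp add: nn_integral_add z i ennreal_plus[symmetric] del: ennreal_plus)
    also have "\<dots> \<le> ennreal ((1 / \<alpha> + 2 * K / \<epsilon>) * ?R)"
    proof (rule ennreal_leI)
      have "1 + - (1 / (\<sigma> + \<alpha>)) * \<alpha> = \<sigma> / (\<sigma> + \<alpha>)" using \<epsilon> \<alpha> by (simp add: field_simps)
      moreover have "G * c powr \<alpha> = G powr (1 + - (1 / (\<sigma> + \<alpha>)) * \<alpha>)"
        using G0 unfolding c_def powr_powr powr_add by simp
      ultimately have 1: "G * c powr \<alpha> = ?R" by simp
      have 2: "c powr (- \<sigma>) = ?R" unfolding c_def powr_powr by simp
      have "K * (?R / \<sigma>) \<le> K * (?R / \<epsilon>)" using \<epsilon> K by (intro mult_left_mono divide_left_mono) auto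
      moreover have "K * (1 / \<tau>) \<le> K * (?R / \<epsilon>)" using \<epsilon> K R by (intro mult_left_mono frac_le) auto
      moreover have "(1 / \<alpha> + 2 * K / \<epsilon>) * ?R = ?R / \<alpha> + K * (?R / \<epsilon>) + K * (?R / \<epsilon>)" by (simp add: field_simps)
      ultimately show "G * (c powr \<alpha> / \<alpha>) + (K * (c powr (- \<sigma>) / \<sigma>) + K * (1 powr (- \<tau>) / \<tau>)) \<le> (1 / \<alpha> + 2 * K / \<epsilon>) * ?R"
        using 1 2 by simp
    qed
    finally show ?thesis using True by simp
  next
    case False
    \<comment> \<open>For \<open>G < 1\<close> the balance lies at a scale of at least 1, so the
      rate \<tau> alone decides and \<open>G\<close> receives the exponent that belongs to
      infinity.\<close>
    define c where "c = G powr (- (1 / (\<tau> + \<alpha>)))"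
    have c: "1 \<le> c"
    proof -
      have "G powr (1 / (\<tau> + \<alpha>)) \<le> 1" using False G0 \<epsilon> \<alpha> by (intro powr_le1) auto
      then show ?thesis using G0 by (simp add: c_def powr_minus one_le_inverse_iff)
    qed
    let ?R = "G powr (\<tau> / (\<tau> + \<alpha>))"
    have "ennreal (t powr (\<alpha> - 1)) * \<Phi> t * indicator {0<..} t \<le> ?z c t + ?i \<tau> c t" for t
    proof -
      consider "t \<le> 0" | "0 < t" "t \<le> c" | "c \<le> t" by linarith
      then show ?thesis
      proof cases
        case 2 then show ?thesis using bz[of t c] by (intro add_increasing2) auto
      next
        case 3 then show ?thesis using c bi[of t c \<tau>] \<Phi>(3)[of t] by (intro add_increasing) auto
      qed auto
    qed
    then have "?I \<le> (\<integral>\<^sup>+t. ?z c t + ?i \<tau> c t \<partial>lborel)"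
      by (rule nn_integral_mono)
    also have "\<dots> = ennreal (G * (c powr \<alpha> / \<alpha>) + K * (c powr (- \<tau>) / \<tau>))"
      using c \<epsilon> K G \<alpha> by (simp add: nn_integral_add z i ennreal_plus[symmetric] del: ennreal_plus)
    also have "\<dots> \<le> ennreal ((1 / \<alpha> + 2 * K / \<epsilon>) * ?R)"
    proof (rule ennreal_leI)
      have "1 + - (1 / (\<tau> + \<alpha>)) * \<alpha> = \<tau> / (\<tau> + \<alpha>)" using \<epsilon> \<alpha> by (simp add: field_simps)
      moreover have "G * c powr \<alpha> = G powr (1 + - (1 / (\<tau> + \<alpha>)) * \<alpha>)"
        using G0 unfolding c_def powr_powr powr_add by simp
      ultimately have 1: "G * c powr \<alpha> = ?R" by simp
      have 2: "c powr (- \<tau>) = ?R" unfolding c_def powr_powr by simp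
      have "K * (?R / \<tau>) \<le> K * (?R / \<epsilon>)" using \<epsilon> K by (intro mult_left_mono divide_left_mono) auto
      moreover have "0 \<le> K * (?R / \<epsilon>)" using \<epsilon> K by simp
      moreover have "(1 / \<alpha> + 2 * K / \<epsilon>) * ?R = ?R / \<alpha> + K * (?R / \<epsilon>) + K * (?R / \<epsilon>)" by (simp add: field_simps)
      ultimately show "G * (c powr \<alpha> / \<alpha>) + K * (c powr (- \<tau>) / \<tau>) \<le> (1 / \<alpha> + 2 * K / \<epsilon>) * ?R"
        using 1 2 by simp
    qed
    finally show ?thesis using False by simp
  qed
qed


section \<open>From pointwise bounds with variable exponents to the modular estimate\<close>

lemma powr_exponent_change:
  fixes G X r w D N r0 :: real
  assumes G: "0 \<le> G" "G \<le> 1" and X: "0 \<le> X" and rw: "\<bar>r - w\<bar> \<le> D / ln (X + exp 1)"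
    and r: "0 < r0" "r0 \<le> r" and DN: "0 \<le> D" "0 \<le> N"
  shows "G powr r \<le> exp (D * (N / r0)) * G powr w + (1 + X) powr (- N)"
proof (cases "G = 0")
  case False
  then have G0: "0 < G" "ln G \<le> 0" using G by auto
  define L where "L = ln (X + exp 1)"
  have L: "0 < L" "ln (1 + X) \<le> L"
  proof -
    have e: "1 < exp (1::real)" by simp
    show "0 < L" unfolding L_def using X e by (intro ln_gt_zero) linarith
    show "ln (1 + X) \<le> L" unfolding L_def using X e by (subst ln_le_cancel_iff) linarith+
  qed
  \<comment> \<open>Dichotomy at \<open>G = (1 + X) powr (- N / r0)\<close>. Above it,
    \<open>- ln G\<close> is at most a multiple of \<open>ln (1 + X)\<close>, so the log-Hoelder gap
    between \<open>r\<close> and \<open>w\<close> costs a bounded factor. Below it,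
    \<open>G powr r \<le> G powr r0\<close> is already dominated by the weight.\<close>
  show ?thesis
  proof (cases "- ln G \<le> N / r0 * ln (1 + X)")
    case True
    have "(r - w) * ln G \<le> \<bar>r - w\<bar> * (- ln G)"
      using abs_ge_self[of "(r - w) * ln G"] G0 by (simp only: abs_mult abs_of_nonpos)
    also have "\<dots> \<le> (D / L) * (N / r0 * L)"
    proof (rule mult_mono)
      have "N / r0 * ln (1 + X) \<le> N / r0 * L" using L r DN by (intro mult_left_mono) auto
      with True show "- ln G \<le> N / r0 * L" by linarith
    qed (use rw G0 L DN in \<open>auto simp: L_def\<close>)
    also have "\<dots> = D * (N / r0)" using L by simp
    finally have "r * ln G \<le> D * (N / r0) + w * ln G" by (simp add: algebra_simps)
    then have "G powr r \<le> exp (D * (N / r0)) * G powr w"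
      using G0 by (simp add: powr_def exp_add[symmetric])
    then show ?thesis by (simp add: add_increasing2)
  next
    case False
    have "r * ln G \<le> r0 * ln G" using G0 r by (intro mult_right_mono_neg) auto
    also have "\<dots> \<le> r0 * - (N / r0 * ln (1 + X))" using False r by (intro mult_left_mono) auto
    also have "\<dots> = - N * ln (1 + X)" using r by simp
    finally have "G powr r \<le> (1 + X) powr (- N)" using G0 X by (simp add: powr_def)
    then show ?thesis by (simp add: add_increasing)
  qed
qed simp

text \<open>\<open>LH_limit\<close> and \<open>ball_bound\<close> in exponential form and for values
  in \<open>ennreal\<close>, stated as one existential so that the constants can be chosen for all
  factors at once. They depend on the exponent only, not on \<open>g\<close>.\<close>

lemma variable_exponent_facts:
  fixes p :: "real^'n \<Rightarrow> real"
  assumes "p \<in> LH" "\<And>x. a \<le> p x" "0 < a" "\<And>x. p x \<le> b"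
  shows "\<exists>C pinf K. 0 < C \<and> a \<le> pinf \<and> pinf \<le> b \<and> (\<forall>x. \<bar>p x - pinf\<bar> \<le> C / ln (norm x + exp 1)) \<and>
    (\<forall>g v x t. modular p g \<le> 1 \<longrightarrow> 0 < t \<longrightarrow> v \<noteq> \<infinity> \<longrightarrow> (\<forall>y. dist x y < t \<longrightarrow> v \<le> g y) \<longrightarrow>
      (t \<le> 1 \<longrightarrow> v \<le> ennreal (exp K * t powr (- (real CARD('n) / p x)))) \<and>
      (1 \<le> t \<longrightarrow> v \<le> ennreal (exp K * t powr (- (real CARD('n) / pinf)))))"
proof -
  let ?n = "real CARD('n)"
  obtain C pinf where C: "0 < C" "a \<le> pinf" "pinf \<le> b"
    and inf: "\<And>x. \<bar>p x - pinf\<bar> \<le> C / ln (norm x + exp 1)"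
    and loc: "\<And>x y. norm (x - y) \<le> 1/2 \<Longrightarrow> \<bar>p x - p y\<bar> \<le> C / (- ln (norm (x - y)))"
    using LH_limit[OF assms(1,2,4)] by blast
  obtain K where K: "0 \<le> K"
    "\<And>g A x t. modular p g \<le> 1 \<Longrightarrow> 0 < A \<Longrightarrow> 0 < t \<Longrightarrow> (\<And>y. y \<in> ball x t \<Longrightarrow> ennreal A \<le> g y) \<Longrightarrow>
      t \<le> 1 \<Longrightarrow> ln A \<le> K - ?n / p x * ln t"
    "\<And>g A x t. modular p g \<le> 1 \<Longrightarrow> 0 < A \<Longrightarrow> 0 < t \<Longrightarrow> (\<And>y. y \<in> ball x t \<Longrightarrow> ennreal A \<le> g y) \<Longrightarrow>
      1 \<le> t \<Longrightarrow> ln A \<le> K - ?n / pinf * ln t"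
    by (rule ball_bound[OF assms(2,3) C(2,1) inf loc]) blast+
  have ex: "A \<le> exp K * t powr (- z)" if "0 < A" "0 < t" "ln A \<le> K - z * ln t" for A t z :: real
  proof -
    have "A = exp (ln A)" using that by simp
    also have "\<dots> \<le> exp (K - z * ln t)" using that by (simp only: exp_le_cancel_iff)
    also have "\<dots> = exp K * t powr (- z)" using that by (simp add: powr_def exp_add[symmetric])
    finally show ?thesis .
  qed
  have "(t \<le> 1 \<longrightarrow> v \<le> ennreal (exp K * t powr (- (?n / p x)))) \<and>
      (1 \<le> t \<longrightarrow> v \<le> ennreal (exp K * t powr (- (?n / pinf))))"
    if g: "modular p g \<le> 1" and t: "0 < t" and v: "v \<noteq> \<infinity>" and le: "\<And>y. dist x y < t \<Longrightarrow> v \<le> g y" for g v x t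
  proof (cases v)
    case (real A)
    show ?thesis
    proof (cases "A = 0")
      case False
      then have A: "0 < A" using real by simp
      have le': "\<And>y. y \<in> ball x t \<Longrightarrow> ennreal A \<le> g y" using le real by auto
      from K(2)[OF g A t le'] K(3)[OF g A t le'] show ?thesis
        using ex[OF A t] real by (auto intro!: ennreal_leI)
    qed (use real in simp)
  qed (use v in simp)
  then show ?thesis using C inf by blast
qed

text \<open>A crude form of Young's inequality: with \<open>M\<close> the sum on the right, each
  factor is at most \<open>M powr (1 / P k)\<close>, and the outer exponent is the reciprocal of the
  sum of these powers.\<close>

lemma prod_powr_le_sum:
  fixes A P :: "'m::finite \<Rightarrow> real"
  assumes A: "\<And>k. 0 \<le> A k" and P: "\<And>k. 0 < P k"
  shows "(\<Prod>k\<in>UNIV. A k) powr (1 / (\<Sum>k\<in>UNIV. 1 / P k)) \<le> (\<Sum>k\<in>UNIV. A k powr P k)"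
proof -
  define M where "M = (\<Sum>k\<in>UNIV. A k powr P k)"
  have M0: "0 \<le> M" unfolding M_def by (intro sum_nonneg) auto
  have s: "0 < (\<Sum>k\<in>UNIV. 1 / P k)" using P by (intro sum_pos) auto
  have le: "A k \<le> M powr (1 / P k)" for k
  proof -
    have "A k powr P k \<le> M" unfolding M_def by (rule member_le_sum) auto
    then have "(A k powr P k) powr (1 / P k) \<le> M powr (1 / P k)" using P[of k] by (intro powr_mono2) auto
    moreover have "(A k powr P k) powr (1 / P k) = A k" using A[of k] P[of k] by (simp add: powr_powr)
    ultimately show ?thesis by simp
  qed
  show ?thesis
  proof (cases "M = 0")
    case True
    then have "A k = 0" for k using le[of k] A[of k] by simp
    then show ?thesis by simp
  next
    case False
    have "(\<Prod>k\<in>UNIV. A k) \<le> (\<Prod>k\<in>UNIV. M powr (1 / P k))" by (intro prod_mono) (use A le in auto)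
    also have "\<dots> = M powr (\<Sum>k\<in>UNIV. 1 / P k)" using False by (subst powr_sum) auto
    finally have "(\<Prod>k\<in>UNIV. A k) powr (1 / (\<Sum>k\<in>UNIV. 1 / P k)) \<le> (M powr (\<Sum>k\<in>UNIV. 1 / P k)) powr (1 / (\<Sum>k\<in>UNIV. 1 / P k))"
      using s A by (intro powr_mono2) (auto intro: prod_nonneg)
    also have "\<dots> = M" using s M0 by (simp add: powr_powr)
    finally show ?thesis by (simp add: M_def)
  qed
qed

text \<open>With \<open>u k x t\<close> the modulus of the k-th convolution at scale
  \<open>t\<close>, this dominates the operator pointwise up to a constant. Values in
  \<open>ennreal\<close> make it meaningful before any convergence is known.\<close>

definition riesz_average :: "real \<Rightarrow> ('m::finite \<Rightarrow> 'a \<Rightarrow> real \<Rightarrow> ennreal) \<Rightarrow> 'a \<Rightarrow> ennreal" where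
  "riesz_average \<alpha> u x = (\<integral>\<^sup>+t. ennreal (t powr (\<alpha> - 1)) * (\<Prod>k\<in>UNIV. u k x t) * indicator {0<..} t \<partial>lborel)"

text \<open>The core estimate, normalised to \<open>modular (p k) (g k) \<le> 1\<close>. The bound
  of \<open>u k x t\<close> by \<open>g k\<close> on the ball about \<open>x\<close> is used twice:
  at the centre it gives the flat bound by the product of the \<open>g k x\<close>, on the whole
  ball it gives the power decay in \<open>t\<close>. Hedberg's inequality combines them into a
  pointwise bound, which is then raised to the power \<open>q x\<close> and integrated.\<close>

lemma riesz_average_modular:
  fixes p :: "'m::finite \<Rightarrow> real^'n \<Rightarrow> real"
  assumes LH: "\<And>k. p k \<in> LH" and [measurable]: "\<And>k. p k \<in> borel_measurable lebesgue"
    and a: "0 < a" "\<And>k x. a \<le> p k x" and P: "\<And>k x. p k x \<le> P k"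
    and \<alpha>: "0 < \<alpha>" and \<epsilon>: "0 < \<epsilon>" "\<epsilon> \<le> real CARD('n) * (\<Sum>k\<in>UNIV. 1 / P k) - \<alpha>"
    and q: "\<And>x. q x = real CARD('n) / (real CARD('n) * (\<Sum>k\<in>UNIV. 1 / p k x) - \<alpha>)"
  obtains C where "0 < C"
    "\<And>u g. (\<And>k. g k \<in> borel_measurable lebesgue) \<Longrightarrow> (\<And>k. modular (p k) (g k) \<le> 1) \<Longrightarrow>
       (\<And>k x y t. 0 < t \<Longrightarrow> dist x y < t \<Longrightarrow> u k x t \<le> g k y) \<Longrightarrow>
       riesz_average \<alpha> u \<in> borel_measurable lebesgue \<Longrightarrow>
       (AE x in lebesgue. riesz_average \<alpha> u x < \<infinity>) \<and> modular q (\<lambda>x. riesz_average \<alpha> u x / ennreal C) \<le> 1"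
proof -
  let ?n = "real CARD('n)" and ?m = "real CARD('m)"
  define s where "s x = (\<Sum>k\<in>UNIV. 1 / p k x)" for x
  \<comment> \<open>This is \<open>n / q x\<close>, the decay rate left at small scales after
    \<alpha> has been subtracted; \<tau> below is the same quantity for the limit exponents.\<close>
  define \<sigma> where "\<sigma> x = ?n * s x - \<alpha>" for x
  have "\<forall>k. \<exists>C pinf K. 0 < C \<and> a \<le> pinf \<and> pinf \<le> P k \<and> (\<forall>x. \<bar>p k x - pinf\<bar> \<le> C / ln (norm x + exp 1)) \<and>
    (\<forall>g v x t. modular (p k) g \<le> 1 \<longrightarrow> 0 < t \<longrightarrow> v \<noteq> \<infinity> \<longrightarrow> (\<forall>y. dist x y < t \<longrightarrow> v \<le> g y) \<longrightarrow>
      (t \<le> 1 \<longrightarrow> v \<le> ennreal (exp K * t powr (- (?n / p k x)))) \<and>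
      (1 \<le> t \<longrightarrow> v \<le> ennreal (exp K * t powr (- (?n / pinf)))))"
    by (intro allI variable_exponent_facts LH a P)
  then obtain C pinf K where C: "\<And>k. 0 < C k" and pinf: "\<And>k. a \<le> pinf k" "\<And>k. pinf k \<le> P k"
    and lim: "\<And>k x. \<bar>p k x - pinf k\<bar> \<le> C k / ln (norm x + exp 1)"
    and K: "\<And>k g v x t. modular (p k) g \<le> 1 \<Longrightarrow> 0 < t \<Longrightarrow> v \<noteq> \<infinity> \<Longrightarrow> (\<forall>y. dist x y < t \<longrightarrow> v \<le> g y) \<Longrightarrow>
      (t \<le> 1 \<longrightarrow> v \<le> ennreal (exp (K k) * t powr (- (?n / p k x)))) \<and>
      (1 \<le> t \<longrightarrow> v \<le> ennreal (exp (K k) * t powr (- (?n / pinf k))))"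
    by metis
  define sinf where "sinf = (\<Sum>k\<in>UNIV. 1 / pinf k)"
  define \<tau> where "\<tau> = ?n * sinf - \<alpha>"
  have p0: "0 < p k x" and pinf0: "0 < pinf k" for k x
    using a(1) a(2)[of k x] pinf(1)[of k] by linarith+
  have sP: "(\<Sum>k\<in>UNIV. 1 / P k) \<le> s x" for x
    unfolding s_def using p0 P by (intro sum_mono frac_le) auto
  have \<sigma>: "\<epsilon> \<le> \<sigma> x" for x
    using \<epsilon>(2) mult_left_mono[OF sP, of ?n x] unfolding \<sigma>_def by linarith
  have sinfP: "(\<Sum>k\<in>UNIV. 1 / P k) \<le> sinf"
    unfolding sinf_def using pinf0 pinf by (intro sum_mono frac_le) auto
  have \<tau>: "\<epsilon> \<le> \<tau>"
    using \<epsilon>(2) mult_left_mono[OF sinfP, of ?n] unfolding \<tau>_def by linarith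
  define S where "S = ?n * (?m / a)"
  have S: "0 < S" using a by (simp add: S_def)
  have sm: "(\<Sum>k\<in>UNIV. 1 / z k) \<le> ?m / a" if "\<And>k. a \<le> z k" for z :: "'m \<Rightarrow> real"
  proof -
    have "(\<Sum>k\<in>UNIV. 1 / z k) \<le> (\<Sum>k\<in>(UNIV::'m set). 1 / a)"
      using that a by (intro sum_mono frac_le) auto
    then show ?thesis by simp
  qed
  have \<sigma>S: "\<sigma> x + \<alpha> \<le> S" and \<tau>S: "\<tau> + \<alpha> \<le> S" for x
    using mult_left_mono[OF sm[of "\<lambda>k. p k x"], of ?n] mult_left_mono[OF sm[of pinf], of ?n] a pinf
    by (simp_all add: \<sigma>_def \<tau>_def S_def s_def sinf_def)
  define D where "D = (\<Sum>k\<in>UNIV. C k / a\<^sup>2)"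
  have D: "0 \<le> D" unfolding D_def by (intro sum_nonneg divide_nonneg_nonneg less_imp_le[OF C]) auto
  have sD: "\<bar>s x - sinf\<bar> \<le> D / ln (norm x + exp 1)" for x
  proof -
    have "\<bar>1 / p k x - 1 / pinf k\<bar> \<le> C k / a\<^sup>2 / ln (norm x + exp 1)" for k
    proof -
      have "1 / p k x \<le> 1 / pinf k + (C k / ln (norm x + exp 1)) / a\<^sup>2"
        "1 / pinf k \<le> 1 / p k x + (C k / ln (norm x + exp 1)) / a\<^sup>2"
        using lim[of k x] by (intro inverse_shift_le a pinf; simp add: abs_minus_commute)+
      then show ?thesis by (simp add: abs_le_iff mult.commute)
    qed
    then have "(\<Sum>k\<in>UNIV. \<bar>1 / p k x - 1 / pinf k\<bar>) \<le> (\<Sum>k\<in>UNIV. C k / a\<^sup>2 / ln (norm x + exp 1))"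
      by (intro sum_mono)
    moreover have "\<bar>s x - sinf\<bar> \<le> (\<Sum>k\<in>UNIV. \<bar>1 / p k x - 1 / pinf k\<bar>)"
      unfolding s_def sinf_def sum_subtractf[symmetric] by (rule sum_abs)
    ultimately show ?thesis by (simp add: D_def sum_divide_distrib)
  qed
  \<comment> \<open>The power of \<open>G\<close> obtained after raising to \<open>q x\<close> when
    \<open>G < 1\<close>. It would be \<open>1 / s x\<close> if \<tau> equalled
    \<open>\<sigma> x\<close>; \<open>rw\<close> bounds the difference by the log-Hoelder modulus,
    and \<open>r0\<close> is a uniform lower bound.\<close>
  define r where "r x = \<tau> / (\<tau> + \<alpha>) * (?n / \<sigma> x)" for x
  define r0 where "r0 = \<epsilon> / S * (?n / S)"
  define D' where "D' = ?n * \<alpha> * (?n * D) / \<epsilon> ^ 3"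
  have r0: "0 < r0" using \<epsilon> S by (simp add: r0_def)
  have D': "0 \<le> D'" using D \<alpha> \<epsilon> by (simp add: D'_def)
  have rr0: "r0 \<le> r x" for x
    unfolding r0_def r_def using \<sigma>[of x] \<tau> \<epsilon> \<alpha> S \<sigma>S[of x] \<tau>S by (intro mult_mono frac_le) auto
  have qs: "q x = ?n / \<sigma> x" for x by (simp add: q \<sigma>_def s_def)
  have ns: "\<sigma> x + \<alpha> = ?n * s x" for x by (simp add: \<sigma>_def)
  have s0: "0 < s x" for x
    unfolding s_def using p0 by (intro sum_pos) auto
  have rw: "\<bar>r x - 1 / s x\<bar> \<le> D' / ln (norm x + exp 1)" for x
  proof -
    have pos: "0 < \<sigma> x" "0 < \<tau>" "0 < \<sigma> x + \<alpha>" "0 < \<tau> + \<alpha>" using \<sigma>[of x] \<tau> \<epsilon> \<alpha> by linarith+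
    have "v / (v + \<alpha>) * (n / w) - n / (w + \<alpha>) = n * \<alpha> * (v - w) / ((v + \<alpha>) * w * (w + \<alpha>))"
      if "0 < w" "0 < v" "0 < w + \<alpha>" "0 < v + \<alpha>" for v w n :: real
    proof -
      have "v / (v + \<alpha>) * (n / w) - n / (w + \<alpha>) = (v * n * (w + \<alpha>) - n * ((v + \<alpha>) * w)) / ((v + \<alpha>) * w * (w + \<alpha>))"
        using that by (simp add: divide_simps)
      also have "v * n * (w + \<alpha>) - n * ((v + \<alpha>) * w) = n * \<alpha> * (v - w)" by algebra
      finally show ?thesis .
    qed
    from this[OF pos, of ?n]
    have "r x - 1 / s x = ?n * \<alpha> * (\<tau> - \<sigma> x) / ((\<tau> + \<alpha>) * \<sigma> x * (\<sigma> x + \<alpha>))"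
      by (simp add: r_def ns)
    then have "\<bar>r x - 1 / s x\<bar> = ?n * \<alpha> * \<bar>\<tau> - \<sigma> x\<bar> / ((\<tau> + \<alpha>) * \<sigma> x * (\<sigma> x + \<alpha>))"
      using pos \<alpha> by (simp add: abs_mult)
    also have "\<dots> \<le> ?n * \<alpha> * (?n * (D / ln (norm x + exp 1))) / (\<epsilon> * \<epsilon> * \<epsilon>)"
    proof (rule frac_le)
      have "\<tau> - \<sigma> x = ?n * (sinf - s x)" by (simp add: \<tau>_def \<sigma>_def algebra_simps)
      then have "\<bar>\<tau> - \<sigma> x\<bar> = ?n * \<bar>s x - sinf\<bar>" by (simp add: abs_mult abs_minus_commute)
      also have "\<dots> \<le> ?n * (D / ln (norm x + exp 1))" by (intro mult_left_mono sD) auto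
      finally show "?n * \<alpha> * \<bar>\<tau> - \<sigma> x\<bar> \<le> ?n * \<alpha> * (?n * (D / ln (norm x + exp 1)))"
        using \<alpha> by (intro mult_left_mono) auto
      show "\<epsilon> * \<epsilon> * \<epsilon> \<le> (\<tau> + \<alpha>) * \<sigma> x * (\<sigma> x + \<alpha>)"
        using \<sigma>[of x] \<tau> \<epsilon> \<alpha> by (intro mult_mono) auto
      have "0 < ln (norm x + exp 1)" 
        using norm_ge_zero[of x] one_less_exp_iff[of "1::real"] by (intro ln_gt_zero) linarith
      then show "0 \<le> ?n * \<alpha> * (?n * (D / ln (norm x + exp 1)))"
        using \<alpha> D by (intro mult_nonneg_nonneg divide_nonneg_pos) auto
    qed (use \<epsilon> in auto)
    also have "\<dots> = D' / ln (norm x + exp 1)" by (simp add: D'_def power3_eq_cube)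
    finally show ?thesis .
  qed
  define K0 where "K0 = exp (\<Sum>k\<in>UNIV. K k)"
  define C1 where "C1 = 1 / \<alpha> + 2 * K0 / \<epsilon>"
  have C1: "0 < C1" using \<alpha> \<epsilon> by (simp add: C1_def K0_def add_pos_pos)
  define C2 where "C2 = exp (D' * ((?n + 1) / r0))"
  have C2: "1 \<le> C2" using D' r0 by (simp add: C2_def)
  \<comment> \<open>The weight left over by the change of exponent for \<open>N = n + 1\<close>, a
    power just large enough to be integrable.\<close>
  define W where "W = (\<integral>\<^sup>+x. ennreal ((1 + norm (x::real^'n)) powr (- (?n + 1))) \<partial>lborel)"
  have W: "W < \<infinity>" unfolding W_def by (rule nn_integral_weight_finite) simp
  define B where "B = C2 * ?m + enn2real W"
  have B: "0 < B" using C2 by (simp add: B_def add_pos_nonneg)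
  have qb: "?n / S \<le> q x" and q0: "0 < q x" for x
    unfolding qs using \<sigma>[of x] \<sigma>S[of x] \<alpha> \<epsilon> by (auto intro!: divide_left_mono mult_pos_pos S)
  \<comment> \<open>The integration below yields the modular bound \<open>B\<close> rather than 1.
    As \<open>q x \<ge> n / S\<close>, a further division by \<open>c\<close> gains
    \<open>c powr (- (n / S))\<close>, and \<open>B powr (S / n)\<close> compensates
    \<open>B\<close>; the maximum with 1 serves \<open>modular_divide_le\<close>.\<close>
  define c where "c = max 1 (B powr (S / ?n))"
  have q_meas [measurable]: "q \<in> borel_measurable lebesgue"
  proof -
    have "q = (\<lambda>x. ?n / (?n * (\<Sum>k\<in>UNIV. 1 / p k x) - \<alpha>))" by (rule ext) (rule q)
    then show ?thesis by simp
  qed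
  have main: "(AE x in lebesgue. riesz_average \<alpha> u x < \<infinity>) \<and> modular q (\<lambda>x. riesz_average \<alpha> u x / ennreal C1) \<le> ennreal B"
    if gm[measurable]: "\<And>k. g k \<in> borel_measurable lebesgue" and g: "\<And>k. modular (p k) (g k) \<le> 1"
      and u: "\<And>k x y t. 0 < t \<Longrightarrow> dist x y < t \<Longrightarrow> u k x t \<le> g k y" for u g
  proof -
    have bound: "riesz_average \<alpha> u x < \<infinity> \<and> epowr (riesz_average \<alpha> u x / ennreal C1) (q x)
      \<le> ennreal C2 * (\<Sum>k\<in>UNIV. epowr (g k x) (p k x)) + ennreal ((1 + norm x) powr (- (?n + 1)))"
      if fin: "\<And>k. g k x < \<infinity>" for x
    proof -
      define A where "A k = enn2real (g k x)" for k
      have A: "g k x = ennreal (A k)" "0 \<le> A k" for k using fin[of k] by (auto simp: A_def)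
      define G where "G = (\<Prod>k\<in>UNIV. A k)"
      have G: "0 \<le> G" unfolding G_def by (intro prod_nonneg) (use A in auto)
      have u0: "u k x t \<le> ennreal (A k)" if "0 < t" for k t using u[OF that, of x x k] that A by simp
      then have uinf: "u k x t \<noteq> \<infinity>" if "0 < t" for k t using that by (metis ennreal_less_top infinity_ennreal_def leD)
      have powr_prod: "(\<Prod>k\<in>UNIV. ennreal (exp (K k) * t powr (- (?n / z k)))) = ennreal (K0 * t powr (- (?n * (\<Sum>k\<in>UNIV. 1 / z k))))"
        if "0 < t" for t and z :: "'m \<Rightarrow> real"
      proof -
        have "t powr (- (?n * (\<Sum>k\<in>UNIV. 1 / z k))) = (\<Prod>k\<in>UNIV. t powr (- (?n / z k)))"
          using that by (subst powr_sum[symmetric]) (auto simp: sum_distrib_left sum_negf)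
        then show ?thesis by (simp add: prod_ennreal K0_def exp_sum prod.distrib)
      qed
      let ?R = "if 1 \<le> G then G powr (\<sigma> x / (\<sigma> x + \<alpha>)) else G powr (\<tau> / (\<tau> + \<alpha>))"
      have "riesz_average \<alpha> u x \<le> ennreal ((1 / \<alpha> + 2 * K0 / \<epsilon>) * ?R)"
        unfolding riesz_average_def
      proof (rule hedberg[OF \<alpha> \<epsilon>(1) \<sigma> \<tau> _ G])
        fix t :: real assume t: "0 < t"
        have "(\<Prod>k\<in>UNIV. u k x t) \<le> (\<Prod>k\<in>UNIV. ennreal (A k))" by (intro prod_mono_ennreal u0 t)
        then show "(\<Prod>k\<in>UNIV. u k x t) \<le> ennreal G" by (simp add: G_def prod_ennreal A)
      next
        fix t :: real assume t: "0 < t" "t \<le> 1"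
        have "(\<Prod>k\<in>UNIV. u k x t) \<le> (\<Prod>k\<in>UNIV. ennreal (exp (K k) * t powr (- (?n / p k x))))"
          using K[OF g t(1) uinf[OF t(1)]] u t by (intro prod_mono_ennreal) blast
        then show "(\<Prod>k\<in>UNIV. u k x t) \<le> ennreal (K0 * t powr - (\<sigma> x + \<alpha>))"
          using powr_prod[OF t(1), of "\<lambda>k. p k x"] by (simp add: \<sigma>_def s_def)
      next
        fix t :: real assume t: "1 \<le> t"
        then have t0: "0 < t" by simp
        have "(\<Prod>k\<in>UNIV. u k x t) \<le> (\<Prod>k\<in>UNIV. ennreal (exp (K k) * t powr (- (?n / pinf k))))"
          using K[OF g t0 uinf[OF t0]] u t t0 by (intro prod_mono_ennreal) blast
        then show "(\<Prod>k\<in>UNIV. u k x t) \<le> ennreal (K0 * t powr - (\<tau> + \<alpha>))"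
          using powr_prod[OF t0, of pinf] by (simp add: \<tau>_def sinf_def)
      qed (simp add: K0_def)
      then have le: "riesz_average \<alpha> u x \<le> ennreal (C1 * ?R)" by (simp only: C1_def)
      have R0: "0 \<le> ?R" by simp
      have "riesz_average \<alpha> u x / ennreal C1 \<le> ennreal (C1 * ?R) / ennreal C1"
        by (rule divide_right_mono_ennreal[OF le])
      also have "\<dots> = ennreal ?R" using C1 R0 by (subst divide_ennreal) auto
      finally have "epowr (riesz_average \<alpha> u x / ennreal C1) (q x) \<le> epowr (ennreal ?R) (q x)"
        using q0[of x] by (intro epowr_mono) auto
      also have "\<dots> = ennreal (?R powr q x)" by (rule epowr_ennreal[OF R0])
      also have "\<dots> \<le> ennreal (C2 * G powr (1 / s x) + (1 + norm x) powr (- (?n + 1)))"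
      proof (rule ennreal_leI)
        have sx: "0 < \<sigma> x" using \<sigma>[of x] \<epsilon> by simp
        show "?R powr q x \<le> C2 * G powr (1 / s x) + (1 + norm x) powr (- (?n + 1))"
        proof (cases "1 \<le> G")
          case True
          \<comment> \<open>For \<open>G \<ge> 1\<close> the exponents fit exactly, because
            \<open>\<sigma> x + \<alpha> = n * s x\<close>.\<close>
          have "\<sigma> x / (\<sigma> x + \<alpha>) * (?n / \<sigma> x) = 1 / s x" 
          proof -
            have "\<sigma> x / (\<sigma> x + \<alpha>) * (?n / \<sigma> x) = ?n / (\<sigma> x + \<alpha>)" using sx by simp
            then show ?thesis using s0[of x] by (simp add: ns)
          qed
          then have "?R powr q x = G powr (1 / s x)" using True by (simp add: powr_powr qs)
          also have "\<dots> \<le> C2 * G powr (1 / s x)" using mult_right_mono[OF C2, of "G powr (1 / s x)"] by simp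
          finally show ?thesis by (simp add: add_increasing2)
        next
          case False
          then have "?R powr q x = G powr r x" by (simp add: powr_powr qs r_def)
          also have "\<dots> \<le> C2 * G powr (1 / s x) + (1 + norm x) powr (- (?n + 1))"
            unfolding C2_def
            by (rule powr_exponent_change[OF G _ _ rw r0 rr0 D']) (use False in auto)
          finally show ?thesis .
        qed
      qed
      also have "\<dots> \<le> ennreal (C2 * (\<Sum>k\<in>UNIV. A k powr p k x) + (1 + norm x) powr (- (?n + 1)))"
        using prod_powr_le_sum[of A "\<lambda>k. p k x"] A p0 C2
        by (intro ennreal_leI add_right_mono mult_left_mono) (auto simp: G_def s_def)
      also have "\<dots> = ennreal C2 * (\<Sum>k\<in>UNIV. epowr (g k x) (p k x)) + ennreal ((1 + norm x) powr (- (?n + 1)))"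
        using C2 by (simp add: A epowr_ennreal ennreal_mult sum_nonneg sum_ennreal)
      finally have "epowr (riesz_average \<alpha> u x / ennreal C1) (q x) \<le> \<dots>" .
      moreover have "riesz_average \<alpha> u x < \<infinity>" using le by (rule order_le_less_trans) simp
      ultimately show ?thesis by blast
    qed
    have "AE x in lebesgue. g k x < \<infinity>" for k
    proof -
      have "(\<integral>\<^sup>+x. epowr (g k x) (p k x) \<partial>lebesgue) \<noteq> \<infinity>"
        using g[of k] by (auto simp: modular_def top_unique)
      then have "AE x in lebesgue. epowr (g k x) (p k x) \<noteq> \<infinity>"
        by (intro nn_integral_PInf_AE) auto
      then show ?thesis by eventually_elim (auto simp: epowr_def less_top[symmetric] split: if_splits)
    qed
    then have "AE x in lebesgue. \<forall>k. g k x < \<infinity>" by (simp add: AE_all_countable)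
    then have ae: "AE x in lebesgue. riesz_average \<alpha> u x < \<infinity> \<and> epowr (riesz_average \<alpha> u x / ennreal C1) (q x)
      \<le> ennreal C2 * (\<Sum>k\<in>UNIV. epowr (g k x) (p k x)) + ennreal ((1 + norm x) powr (- (?n + 1)))"
      by eventually_elim (use bound in blast)
    have "modular q (\<lambda>x. riesz_average \<alpha> u x / ennreal C1)
      \<le> (\<integral>\<^sup>+x. ennreal C2 * (\<Sum>k\<in>UNIV. epowr (g k x) (p k x)) + ennreal ((1 + norm x) powr (- (?n + 1))) \<partial>lebesgue)"
      unfolding modular_def using ae by (intro nn_integral_mono_AE) auto
    also have "\<dots> = ennreal C2 * (\<Sum>k\<in>UNIV. modular (p k) (g k)) + W"
    proof -
      have w: "(\<lambda>x::real^'n. ennreal ((1 + norm x) powr (- (?n + 1)))) \<in> borel_measurable lebesgue"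
        by (rule measurable_completion) measurable
      have "(\<integral>\<^sup>+x. ennreal ((1 + norm (x::real^'n)) powr (- (?n + 1))) \<partial>lebesgue) = W"
        unfolding W_def by (rule nn_integral_completion)
      moreover have "(\<lambda>x. \<Sum>k\<in>UNIV. epowr (g k x) (p k x)) \<in> borel_measurable lebesgue"
        by measurable
      ultimately show ?thesis
        using w by (simp add: nn_integral_add nn_integral_cmult nn_integral_sum modular_def del: nn_integral_completion)
    qed
    also have "\<dots> \<le> ennreal C2 * (\<Sum>k\<in>(UNIV::'m set). 1) + W"
      by (intro add_right_mono mult_left_mono sum_mono g) auto
    also have "\<dots> = ennreal B"
      using C2 W by (simp add: B_def ennreal_mult ennreal_of_nat_eq_real_of_nat)
    finally show ?thesis using ae by (auto elim: eventually_mono)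
  qed
  have c: "1 \<le> c" "0 < c" by (auto simp: c_def)
  show thesis
  proof (rule that[of "C1 * c"])
    show "0 < C1 * c" using C1 c by simp
    fix u :: "'m \<Rightarrow> real^'n \<Rightarrow> real \<Rightarrow> ennreal" and g
    assume h: "\<And>k. g k \<in> borel_measurable lebesgue" "\<And>k. modular (p k) (g k) \<le> 1"
      "\<And>k x y t. 0 < t \<Longrightarrow> dist x y < t \<Longrightarrow> u k x t \<le> g k y"
      and m: "riesz_average \<alpha> u \<in> borel_measurable lebesgue"
    note * = main[of g u, OF h]
    have "riesz_average \<alpha> u x / ennreal (C1 * c) = riesz_average \<alpha> u x / ennreal C1 / ennreal c" for x
      using C1 c by (simp add: ennreal_mult divide_ennreal_def ennreal_inverse_mult mult.assoc)
    then have "modular q (\<lambda>x. riesz_average \<alpha> u x / ennreal (C1 * c)) = modular q (\<lambda>x. riesz_average \<alpha> u x / ennreal C1 / ennreal c)"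
      by simp
    also have "\<dots> \<le> ennreal (c powr (- (?n / S))) * modular q (\<lambda>x. riesz_average \<alpha> u x / ennreal C1)"
      using m by (intro modular_divide_le qb c) (use S in auto)
    also have "\<dots> \<le> ennreal (c powr (- (?n / S))) * ennreal B"
      using * by (intro mult_left_mono) auto
    also have "\<dots> = ennreal (c powr (- (?n / S)) * B)" using B by (simp add: ennreal_mult)
    also have "\<dots> \<le> 1"
    proof -
      have "(B powr (S / ?n)) powr (?n / S) \<le> c powr (?n / S)"
        using S by (intro powr_mono2) (auto simp: c_def)
      moreover have "(B powr (S / ?n)) powr (?n / S) = B" using S B by (simp add: powr_powr)
      ultimately have "B \<le> c powr (?n / S)" by simp
      then have "c powr (- (?n / S)) * B \<le> 1" using c by (simp add: powr_minus field_simps)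
      then show ?thesis by (simp add: ennreal_le_1)
    qed
    finally show "(AE x in lebesgue. riesz_average \<alpha> u x < \<infinity>) \<and> modular q (\<lambda>x. riesz_average \<alpha> u x / ennreal (C1 * c)) \<le> 1"
      using * by blast
  qed
qed

section \<open>Finite sums of atoms\<close>

text \<open>The condition \<open>1 \<le> R\<close> makes \<open>1 + norm x \<le> 2 * norm x\<close>
  available outside the ball of radius \<open>2 * R\<close>, where decay is proved.\<close>

definition ess_bounded_on :: "real \<Rightarrow> real \<Rightarrow> (real^'n \<Rightarrow> complex) \<Rightarrow> bool" where
  "ess_bounded_on R B f \<longleftrightarrow> 1 \<le> R \<and> 0 \<le> B \<and> f \<in> borel_measurable lebesgue \<and>
     (AE x in lebesgue. cmod (f x) \<le> B) \<and> (\<forall>x. R < norm x \<longrightarrow> f x = 0)"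

lemma ess_bounded_on_mono:
  "ess_bounded_on R B f \<Longrightarrow> R \<le> R' \<Longrightarrow> B \<le> B' \<Longrightarrow> ess_bounded_on R' B' f"
  unfolding ess_bounded_on_def by (auto elim: eventually_mono)

lemma ess_bounded_on_mult_integrable:
  fixes f :: "real^'n \<Rightarrow> complex"
  assumes f: "ess_bounded_on R B f" and g: "g \<in> borel_measurable lebesgue"
    and b: "\<And>x. norm x \<le> R \<Longrightarrow> cmod (g x) \<le> b"
  shows "integrable lebesgue (\<lambda>x. f x * g x)"
    and "AE x in lebesgue. cmod (f x * g x) \<le> B * b * indicator (cball 0 R) x"
proof -
  have [measurable]: "f \<in> borel_measurable lebesgue" "g \<in> borel_measurable lebesgue"
    and B: "0 \<le> B" and z: "\<And>x. R < norm x \<Longrightarrow> f x = 0"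
    using f g by (auto simp: ess_bounded_on_def)
  have "AE x in lebesgue. cmod (f x) \<le> B" using f by (simp add: ess_bounded_on_def)
  then show ae: "AE x in lebesgue. cmod (f x * g x) \<le> B * b * indicator (cball 0 R) x"
  proof eventually_elim
    case (elim x)
    show ?case
    proof (cases "norm x \<le> R")
      case True
      then show ?thesis using elim b[OF True] B by (auto simp: norm_mult intro!: mult_mono)
    qed (use z in auto)
  qed
  have "integrable lebesgue (\<lambda>x. B * b * indicator (cball (0::real^'n) R) x)"
    using emeasure_compact_finite[of "cball (0::real^'n) R"] by (auto simp: infinity_ennreal_def)
  then show "integrable lebesgue (\<lambda>x. f x * g x)"
    by (rule Bochner_Integration.integrable_bound) (use ae in \<open>auto elim!: eventually_mono\<close>)
qed

lemma ess_bounded_on_integrable: "ess_bounded_on R B f \<Longrightarrow> integrable lebesgue f"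
  using ess_bounded_on_mult_integrable(1)[of R B f "\<lambda>_. 1" 1] by simp

lemma ess_bounded_on_add:
  fixes f g :: "real^'n \<Rightarrow> complex"
  assumes "ess_bounded_on R B f" "ess_bounded_on R' B' g"
  shows "ess_bounded_on (max R R') (B + B') (\<lambda>x. f x + g x)"
proof -
  have "AE x in lebesgue. cmod (f x) \<le> B" "AE x in lebesgue. cmod (g x) \<le> B'"
    using assms by (auto simp: ess_bounded_on_def)
  then have "AE x in lebesgue. cmod (f x + g x) \<le> B + B'"
    by eventually_elim (rule norm_triangle_mono)
  then show ?thesis using assms by (auto simp: ess_bounded_on_def)
qed

lemma ess_bounded_on_scale:
  fixes f :: "real^'n \<Rightarrow> complex"
  assumes "ess_bounded_on R B f"
  shows "ess_bounded_on R (cmod c * B) (\<lambda>x. c * f x)"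
proof -
  have "AE x in lebesgue. cmod (f x) \<le> B"
    using assms by (auto simp: ess_bounded_on_def)
  then have "AE x in lebesgue. cmod (c * f x) \<le> cmod c * B"
    by eventually_elim (simp add: norm_mult mult_left_mono)
  then show ?thesis using assms by (auto simp: ess_bounded_on_def)
qed

lemma mi_power_continuous: "continuous_on S (\<lambda>x. mi_power x \<beta>)"
  unfolding mi_power_def by (intro continuous_intros)

lemma mi_power_mult_integrable:
  assumes "ess_bounded_on R B f"
  shows "integrable lebesgue (\<lambda>x. f x * complex_of_real (mi_power x \<beta>))"
proof -
  have c: "continuous_on S (\<lambda>x. complex_of_real (mi_power x \<beta>))" for S :: "(real^'a) set"
    by (intro continuous_intros mi_power_continuous)
  have "compact ((\<lambda>x. complex_of_real (mi_power x \<beta>)) ` cball 0 R)"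
    by (intro compact_continuous_image c) auto
  then obtain b where "\<And>x. norm x \<le> R \<Longrightarrow> cmod (complex_of_real (mi_power x \<beta>)) \<le> b"
    using compact_imp_bounded bounded_iff by (metis (mono_tags, lifting) image_eqI mem_cball_0)
  moreover have "(\<lambda>x::real^'a. complex_of_real (mi_power x \<beta>)) \<in> borel_measurable lebesgue"
    using borel_measurable_continuous_onI[OF c] by (simp add: measurable_completion)
  ultimately show ?thesis
    by (intro ess_bounded_on_mult_integrable(1)[OF assms])
qed

text \<open>Since \<open>inverse 0\<close> is infinite in \<open>ennreal\<close>, this is what makes
  the size condition on atoms a genuine bound. A ball inside the cube carries the level
  \<open>1 / s\<close> for every admissible divisor \<open>s\<close>, and
  \<open>modular_ball\<close>, solved for \<open>ln s\<close>, gives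
  \<open>ln s \<ge> - M\<close>.\<close>

lemma Lp_norm_cube_pos:
  fixes p :: "real^'n \<Rightarrow> real"
  assumes p: "\<And>x. a \<le> p x" "0 < a" and Q: "cube Q"
  shows "0 < Lp_norm p (indicator Q)"
proof -
  obtain c l where l: "0 < l" "Q = cbox c (c + (\<chi> i. l))" using Q by (auto simp: cube_def)
  have "(c + (\<chi> i. l / 2)) \<in> box c (c + (\<chi> i. l))" using l(1) by (simp add: mem_box_cart)
  then obtain r where r: "0 < r" "ball (c + (\<chi> i. l / 2)) r \<subseteq> box c (c + (\<chi> i. l))"
    using open_contains_ball[of "box c (c + (\<chi> i. l))"] open_box by blast
  define z where "z = c + (\<chi> i. l / 2)"
  have zQ: "ball z r \<subseteq> Q" using r box_subset_cbox unfolding l z_def by blast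
  define M where "M = max 0 ((- (real CARD('n) * ln r) - ln (unit_ball_vol (real CARD('n)))) / a)"
  have "ennreal (exp (- M)) \<le> v" if v: "v \<in> {ennreal l |l. 0 < l \<and> modular p (\<lambda>x. indicator Q x / ennreal l) \<le> 1}" for v
  proof -
    obtain s where s: "v = ennreal s" "0 < s" "modular p (\<lambda>x. indicator Q x / ennreal s) \<le> 1" using v by blast
    show ?thesis
    proof (cases "1 \<le> s")
      case True
      then show ?thesis unfolding s by (intro ennreal_leI) (auto simp: M_def intro: order_trans[of _ 1])
    next
      case False
      have "a * ln (1 / s) + real CARD('n) * ln r + ln (unit_ball_vol (real CARD('n))) \<le> 0"
      proof (rule modular_ball[OF s(3)])
        show "ennreal (1 / s) \<le> indicator Q y / ennreal s" if "y \<in> ball z r" for y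
          using that zQ s(2) by (subst indicator_simps(1)) (auto simp: divide_ennreal[symmetric])
        show "a * ln (1 / s) \<le> p y * ln (1 / s)" for y
          using p s False by (intro mult_right_mono) auto
        show "0 < p x" for x using p(1)[of x] p(2) by linarith
      qed (use s r in auto)
      then have "- ln s \<le> (- (real CARD('n) * ln r) - ln (unit_ball_vol (real CARD('n)))) / a"
        using p(2) s(2) by (simp add: ln_div field_simps)
      then have "- M \<le> ln s" by (simp add: M_def)
      then have "exp (- M) \<le> s" using s(2) by (metis exp_le_cancel_iff exp_ln)
      then show ?thesis unfolding s by (rule ennreal_leI)
    qed
  qed
  then have "ennreal (exp (- M)) \<le> Lp_norm p (indicator Q)"
    unfolding Lp_norm_def by (rule Inf_greatest)
  moreover have "0 < ennreal (exp (- M))" by simp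
  ultimately show ?thesis by (rule less_le_trans[rotated])
qed

lemma atom_ess_bounded:
  fixes p :: "real^'n \<Rightarrow> real"
  assumes p: "\<And>x. a \<le> p x" "0 < a" and atom: "atom p d f"
  shows "\<exists>R B. ess_bounded_on R B f"
proof -
  obtain Q where Q: "cube Q" "\<And>x. x \<notin> Q \<Longrightarrow> f x = 0" "esssup lebesgue (cmod_fun f) \<le> inverse (Lp_norm p (indicator Q))"
    and f: "f \<in> borel_measurable lebesgue"
    using atom by (auto simp: atom_def)
  have "bounded Q" using Q(1) by (auto simp: cube_def)
  then obtain R where R: "\<And>x. x \<in> Q \<Longrightarrow> norm x \<le> R" by (auto simp: bounded_iff)
  have "inverse (Lp_norm p (indicator Q)) < \<infinity>"
    using Lp_norm_cube_pos[of a p, OF p Q(1)] by (simp add: ennreal_inverse_eq_top_iff less_top[symmetric])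
  then obtain B where B: "0 \<le> B" "inverse (Lp_norm p (indicator Q)) = ennreal B"
    by (metis ennreal_cases infinity_ennreal_def less_irrefl)
  have "AE x in lebesgue. cmod_fun f x \<le> ennreal B"
    using esssup_AE[where M = lebesgue and f = "cmod_fun f"] Q(3) B(2) by (auto elim!: eventually_mono intro: order_trans)
  then have "AE x in lebesgue. cmod (f x) \<le> B"
    using B by (auto simp: cmod_fun_def ennreal_le_iff elim!: eventually_mono)
  then have "ess_bounded_on (max 1 R) B f"
    unfolding ess_bounded_on_def using f B Q(2) R by (force simp: not_le[symmetric])
  then show ?thesis by blast
qed

text \<open>The normalisation of the individual atoms is forgotten here. Boundedness, bounded
  support and vanishing moments of the sum suffice, because the norm estimate for the operator does
  not pass through atoms.\<close>

lemma finite_atomic_ess_bounded: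
  fixes p :: "real^'n \<Rightarrow> real"
  assumes p: "\<And>x. a \<le> p x" "0 < a" and f: "f \<in> finite_atomic p d"
  obtains R B where "ess_bounded_on R B f"
    "\<And>\<beta>. mi_order \<beta> \<le> d \<Longrightarrow> (\<integral>x. f x * complex_of_real (mi_power x \<beta>) \<partial>lebesgue) = 0"
proof -
  obtain l :: nat and c b where b: "\<And>j. j < l \<Longrightarrow> atom p d (b j)" and fe: "f = (\<lambda>x. \<Sum>j<l. c j * b j x)"
    using f by (auto simp: finite_atomic_def)
  have "\<exists>R B. ess_bounded_on R B (\<lambda>x. \<Sum>j<k. c j * b j x) \<and>
     (\<forall>\<beta>. mi_order \<beta> \<le> d \<longrightarrow> (\<integral>x. (\<Sum>j<k. c j * b j x) * complex_of_real (mi_power x \<beta>) \<partial>lebesgue) = 0)"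
    if "k \<le> l" for k
    using that
  proof (induction k)
    case 0
    show ?case by (intro exI[of _ 1] exI[of _ 0]) (auto simp: ess_bounded_on_def)
  next
    case (Suc k)
    then obtain R B where 1: "ess_bounded_on R B (\<lambda>x. \<Sum>j<k. c j * b j x)"
      "\<And>\<beta>. mi_order \<beta> \<le> d \<Longrightarrow> (\<integral>x. (\<Sum>j<k. c j * b j x) * complex_of_real (mi_power x \<beta>) \<partial>lebesgue) = 0" by auto
    obtain R' B' where 2: "ess_bounded_on R' B' (b k)"
      using atom_ess_bounded[OF p b[of k]] Suc.prems by auto
    have 3: "(\<integral>x. b k x * complex_of_real (mi_power x \<beta>) \<partial>lebesgue) = 0" if "mi_order \<beta> \<le> d" for \<beta>
      using b[of k] Suc.prems that by (simp add: atom_def)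
    note e = ess_bounded_on_add[OF 1(1) ess_bounded_on_scale[OF 2, of "c k"]]
    have "(\<integral>x. (\<Sum>j<Suc k. c j * b j x) * complex_of_real (mi_power x \<beta>) \<partial>lebesgue) = 0"
      if "mi_order \<beta> \<le> d" for \<beta>
    proof -
      have "(\<integral>x. (\<Sum>j<Suc k. c j * b j x) * complex_of_real (mi_power x \<beta>) \<partial>lebesgue)
        = (\<integral>x. (\<Sum>j<k. c j * b j x) * complex_of_real (mi_power x \<beta>) + c k * (b k x * complex_of_real (mi_power x \<beta>)) \<partial>lebesgue)"
        by (simp add: algebra_simps)
      also have "\<dots> = (\<integral>x. (\<Sum>j<k. c j * b j x) * complex_of_real (mi_power x \<beta>) \<partial>lebesgue) + (\<integral>x. c k * (b k x * complex_of_real (mi_power x \<beta>)) \<partial>lebesgue)"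
        by (intro Bochner_Integration.integral_add mi_power_mult_integrable[OF 1(1)] integrable_mult_right mi_power_mult_integrable[OF 2])
      finally show ?thesis using 1(2)[OF that] 3[OF that] by simp
    qed
    then show ?case using e by auto
  qed
  from this[of l] that show thesis unfolding fe by blast
qed

lemma schwartz_borel_measurable:
  fixes \<phi> :: "real^'n \<Rightarrow> complex"
  assumes "\<phi> \<in> schwartz"
  shows "\<phi> \<in> borel_measurable borel" "\<phi> \<in> borel_measurable lebesgue"
proof -
  have "continuous_on UNIV \<phi>"
    using smooth_imp_differentiable[OF schwartz_smooth[OF assms]]
    by (intro continuous_at_imp_continuous_on) (auto intro: differentiable_imp_continuous_within)
  then show "\<phi> \<in> borel_measurable borel" by (rule borel_measurable_continuous_onI)
  then show "\<phi> \<in> borel_measurable lebesgue" by (simp add: measurable_completion)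
qed

lemma ess_bounded_on_schwartz_integrable:
  fixes f :: "real^'n \<Rightarrow> complex"
  assumes f: "ess_bounded_on R B f" and \<phi>: "\<phi> \<in> schwartz"
  shows "integrable lebesgue (\<lambda>x. f x * \<phi> x)"
  using norm_le_schwartz_norm[OF \<phi>, of _ 0]
  by (intro ess_bounded_on_mult_integrable(1)[OF f schwartz_borel_measurable(2)[OF \<phi>]]) auto

lemma distribution_of_tempered:
  fixes f :: "real^'n::finite \<Rightarrow> complex"
  assumes f: "ess_bounded_on R B f"
  shows "distribution_of f \<in> tempered"
  unfolding tempered_def
proof (intro CollectI conjI allI impI ballI)
  note int = ess_bounded_on_schwartz_integrable[OF f]
  show "distribution_of f \<phi> = 0" if "\<phi> \<notin> schwartz" for \<phi>
    using that by (simp add: distribution_of_def)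
  show "distribution_of f (\<lambda>x. \<phi> x + \<psi> x) = distribution_of f \<phi> + distribution_of f \<psi>"
    if "\<phi> \<in> schwartz" "\<psi> \<in> schwartz" for \<phi> \<psi>
    using that int by (simp add: distribution_of_def schwartz_add distrib_left)
  show "distribution_of f (\<lambda>x. c * \<phi> x) = c * distribution_of f \<phi>" if "\<phi> \<in> schwartz" for \<phi> c
    using that by (simp add: distribution_of_def schwartz_scale mult.left_commute)
  fix \<phi> :: "real^'n \<Rightarrow> complex" and \<epsilon> :: real assume \<phi>: "\<phi> \<in> schwartz" and \<epsilon>: "0 < \<epsilon>"
  define F where "F = (\<integral>x. cmod (f x) \<partial>lebesgue)"
  have F: "0 \<le> F" by (simp add: F_def)
  show "\<exists>M. \<exists>\<delta>>0. \<forall>\<psi>\<in>schwartz. schwartz_norm M (\<lambda>x. \<psi> x - \<phi> x) < \<delta> \<longrightarrow> cmod (distribution_of f \<psi> - distribution_of f \<phi>) < \<epsilon>"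
  proof (intro exI conjI ballI impI)
    \<comment> \<open>The seminorm of index 0 is the supremum norm, enough against an integrable
      \<open>f\<close>; adding 1 to \<open>F\<close> covers an \<open>f\<close> that vanishes almost
      everywhere.\<close>
    show "0 < \<epsilon> / (F + 1)" using \<epsilon> F by simp
    fix \<psi> :: "real^'n \<Rightarrow> complex" assume \<psi>: "\<psi> \<in> schwartz" and small: "schwartz_norm 0 (\<lambda>x. \<psi> x - \<phi> x) < \<epsilon> / (F + 1)"
    have d: "(\<lambda>x. \<psi> x - \<phi> x) \<in> schwartz" by (rule schwartz_diff[OF \<psi> \<phi>])
    have "distribution_of f \<psi> - distribution_of f \<phi> = (\<integral>x. f x * (\<psi> x - \<phi> x) \<partial>lebesgue)"
      using \<phi> \<psi> int by (simp add: distribution_of_def right_diff_distrib)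
    also have "cmod \<dots> \<le> (\<integral>x. cmod (f x) * (\<epsilon> / (F + 1)) \<partial>lebesgue)"
    proof (rule Bochner_Integration.integral_norm_bound_integral)
      show "cmod (f x * (\<psi> x - \<phi> x)) \<le> cmod (f x) * (\<epsilon> / (F + 1))" for x
        unfolding norm_mult using norm_le_schwartz_norm[OF d, of x 0] small by (intro mult_left_mono) auto
    qed (use int[OF d] ess_bounded_on_integrable[OF f] in auto)
    also have "\<dots> = F * (\<epsilon> / (F + 1))" by (simp add: F_def)
    also have "\<dots> < \<epsilon>" using F \<epsilon> by (simp add: field_simps)
    finally show "cmod (distribution_of f \<psi> - distribution_of f \<phi>) < \<epsilon>" .
  qed
qed

lemma convolve_distribution_of:
  fixes f :: "real^'n::finite \<Rightarrow> complex"
  assumes "\<phi> \<in> schwartz" "0 < t"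
  shows "convolve (dilate t \<phi>) (distribution_of f) x = (\<integral>y. f y * dilate t \<phi> (x - y) \<partial>lebesgue)"
  using dilate_reflect_schwartz[OF assms, of x] by (simp add: convolve_def distribution_of_def)


section \<open>Taylor expansion and decay of the maximal function of a finite sum of atoms\<close>

lemma prod_list_coordinates: "prod_list (map (\<lambda>i. x $ i) is) = mi_power x (count_list is)"
  for x :: "real^'n"
proof (induction "is")
  case Nil
  show ?case by (simp add: mi_power_def)
next
  case (Cons i "is")
  have "mi_power x (count_list (i # is)) = (\<Prod>j\<in>UNIV. (if j = i then x $ i else 1) * (x $ j) ^ count_list is j)"
    unfolding mi_power_def by (intro prod.cong) auto
  also have "\<dots> = x $ i * mi_power x (count_list is)"
    by (simp add: prod.distrib mi_power_def prod.delta)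
  finally show ?case by (simp only: list.map prod_list.Cons Cons.IH)
qed

text \<open>The j-th derivative of \<psi> at \<open>x\<close> in the direction \<open>v\<close>.
  Summing over all sequences of \<open>j\<close> coordinates avoids multinomial coefficients, and
  the coefficients are still monomials in \<open>v\<close>.\<close>

definition directional_sum :: "(real^'n \<Rightarrow> complex) \<Rightarrow> real^'n \<Rightarrow> nat \<Rightarrow> real^'n \<Rightarrow> complex" where
  "directional_sum \<psi> v j x =
     (\<Sum>is | length is = j. prod_list (map (\<lambda>i. v $ i) is) *\<^sub>R foldr partial_deriv is \<psi> x)"

lemma card_length_eq: "card {is :: 'n::finite list. length is = j} = CARD('n) ^ j"
  using card_lists_length_eq[of "UNIV :: 'n set" j] by simp

lemma directional_sum_Suc:
  "directional_sum \<psi> v (Suc j) x =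
    (\<Sum>is | length is = j. prod_list (map (\<lambda>i. v $ i) is) *\<^sub>R (\<Sum>i\<in>UNIV. v $ i *\<^sub>R foldr partial_deriv (i # is) \<psi> x))"
proof -
  have eq: "{is :: 'a list. length is = Suc j} = (\<lambda>(is, i). i # is) ` ({is. length is = j} \<times> UNIV)"
    using lists_length_Suc_eq[of "UNIV :: 'a set" j] by simp
  have "directional_sum \<psi> v (Suc j) x =
      (\<Sum>(is, i)\<in>{is. length is = j} \<times> UNIV. (v $ i * prod_list (map (\<lambda>i. v $ i) is)) *\<^sub>R foldr partial_deriv (i # is) \<psi> x)"
    unfolding directional_sum_def eq
    by (subst sum.reindex) (auto simp: inj_on_def case_prod_beta intro!: sum.cong)
  also have "\<dots> = (\<Sum>is | length is = j. \<Sum>i\<in>UNIV. (v $ i * prod_list (map (\<lambda>i. v $ i) is)) *\<^sub>R foldr partial_deriv (i # is) \<psi> x)"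
    by (rule sum.cartesian_product[symmetric])
  finally show ?thesis by (simp add: scaleR_sum_right mult.commute)
qed

lemma directional_sum_derivative:
  fixes \<psi> :: "real^'n \<Rightarrow> complex"
  assumes "smooth \<psi>"
  shows "((\<lambda>s. directional_sum \<psi> v j (w + s *\<^sub>R v)) has_vector_derivative
     directional_sum \<psi> v (Suc j) (w + s *\<^sub>R v)) (at s within S)"
  unfolding directional_sum_Suc
  unfolding directional_sum_def
  by (intro has_vector_derivative_sum bounded_linear.has_vector_derivative[OF bounded_linear_scaleR_right] smooth_along[OF assms])

lemma abs_prod_list_coordinates_le: "\<bar>prod_list (map (\<lambda>i. v $ i) is)\<bar> \<le> norm v ^ length is"
  for v :: "real^'n"
  by (induction "is") (auto simp: abs_mult intro!: mult_mono component_le_norm_cart)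

lemma directional_sum_bound:
  fixes \<psi> :: "real^'n \<Rightarrow> complex"
  assumes \<psi>: "\<psi> \<in> test_class N" and j: "j \<le> N"
  shows "cmod (directional_sum \<psi> v j x) \<le> real (CARD('n) ^ j) * (norm v ^ j / (1 + norm x) ^ N)"
proof -
  have "cmod (foldr partial_deriv is \<psi> x) \<le> 1 / (1 + norm x) ^ N" if "length is = j" for "is"
  proof -
    have "(1 + norm x) ^ N * cmod (foldr partial_deriv is \<psi> x) \<le> 1"
      using le_schwartz_norm[of \<psi> "is" N x] \<psi> j that by (auto simp: test_class_def)
    moreover have "0 < (1 + norm x) ^ N" by (intro zero_less_power add_pos_nonneg) auto
    ultimately show ?thesis by (simp add: field_simps)
  qed
  note * = this
  have "cmod (directional_sum \<psi> v j x) \<le> (\<Sum>is | length (is :: 'n list) = j. norm v ^ j * (1 / (1 + norm x) ^ N))"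
    unfolding directional_sum_def
  proof (rule sum_norm_le)
    fix "is" :: "'n list" assume "is \<in> {is. length is = j}"
    then show "norm (prod_list (map (\<lambda>i. v $ i) is) *\<^sub>R foldr partial_deriv is \<psi> x) \<le> norm v ^ j * (1 / (1 + norm x) ^ N)"
      unfolding norm_scaleR using abs_prod_list_coordinates_le[of v "is"] by (intro mult_mono *) auto
  qed
  then show ?thesis by (simp add: card_length_eq)
qed

text \<open>Because \<open>v\<close> is at most half as long as \<open>w\<close>, the whole segment
  from \<open>w\<close> to \<open>w + v\<close> has distance at least \<open>norm w / 2\<close> from
  the origin, where the decay of the test function applies uniformly.\<close>

lemma taylor_remainder_bound:
  fixes \<psi> :: "real^'n \<Rightarrow> complex"
  assumes \<psi>: "\<psi> \<in> test_class N" and d: "Suc d \<le> N" and v: "norm v \<le> norm w / 2"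
  shows "cmod (\<psi> (w + v) - (\<Sum>j\<le>d. (1 / fact j) *\<^sub>R directional_sum \<psi> v j w))
    \<le> real (CARD('n) ^ Suc d) * (norm v ^ Suc d / (1 + norm w / 2) ^ N)"
proof -
  have sm: "smooth \<psi>" using \<psi> by (simp add: test_class_def schwartz_def)
  let ?D = "\<lambda>j s. directional_sum \<psi> v j (w + s *\<^sub>R v)"
  let ?B = "real (CARD('n) ^ Suc d) * (norm v ^ Suc d / (1 + norm w / 2) ^ N)"
  have D0: "directional_sum \<psi> v 0 z = \<psi> z" for z by (simp add: directional_sum_def)
  have "((\<lambda>x. ((1 - x) ^ (Suc d - 1) / fact (Suc d - 1)) *\<^sub>R ?D (Suc d) x) has_integral
      ?D 0 1 - (\<Sum>i<Suc d. ((1 - 0) ^ i / fact i) *\<^sub>R ?D i 0)) {0..1}"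
    by (rule Taylor_has_integral[where f = "?D 0"]) (auto intro: directional_sum_derivative[OF sm])
  then have int: "((\<lambda>x. ((1 - x) ^ d / fact d) *\<^sub>R ?D (Suc d) x) has_integral
      \<psi> (w + v) - (\<Sum>j\<le>d. (1 / fact j) *\<^sub>R directional_sum \<psi> v j w)) (cbox 0 1)"
    by (simp add: D0 lessThan_Suc_atMost)
  have "cmod (\<psi> (w + v) - (\<Sum>j\<le>d. (1 / fact j) *\<^sub>R directional_sum \<psi> v j w)) \<le> ?B * measure lborel (cbox 0 (1::real))"
  proof (rule has_integral_bound[OF _ int])
    show "0 \<le> ?B" by (intro mult_nonneg_nonneg divide_nonneg_nonneg zero_le_power add_nonneg_nonneg) auto
    fix x :: real assume "x \<in> cbox 0 1"
    then have x: "0 \<le> x" "x \<le> 1" by auto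
    have "norm (x *\<^sub>R v) \<le> norm w / 2" using mult_mono[OF x(2) v] x by simp
    then have wx: "norm w / 2 \<le> norm (w + x *\<^sub>R v)" using norm_triangle_ineq2[of w "- (x *\<^sub>R v)"] by simp
    have "(1 - x) ^ d \<le> 1" using x by (intro power_le_one) auto
    moreover have "(1::real) \<le> fact d" by simp
    ultimately have c: "(1 - x) ^ d / fact d \<le> 1" using fact_gt_zero[of d, where ?'a = real] by (subst divide_le_eq_1_pos) linarith+
    have "norm (((1 - x) ^ d / fact d) *\<^sub>R ?D (Suc d) x) = ((1 - x) ^ d / fact d) * cmod (?D (Suc d) x)"
      using x by simp
    also have "\<dots> \<le> 1 * cmod (?D (Suc d) x)" by (intro mult_right_mono c) auto
    also have "\<dots> \<le> real (CARD('n) ^ Suc d) * (norm v ^ Suc d / (1 + norm (w + x *\<^sub>R v)) ^ N)"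
      using directional_sum_bound[OF \<psi> d] by simp
    also have "\<dots> \<le> ?B"
      using wx by (intro mult_left_mono divide_left_mono power_mono mult_pos_pos zero_less_power add_pos_nonneg) auto
    finally show "norm (((1 - x) ^ d / fact d) *\<^sub>R ?D (Suc d) x) \<le> ?B" .
  qed
  then show ?thesis by simp
qed

lemma nn_integral_dilate_weight:
  fixes x :: "real^'n"
  assumes "0 < t"
  shows "(\<integral>\<^sup>+y. ennreal (1 / t ^ CARD('n) * (1 + norm ((x - y) /\<^sub>R t)) powr (- s)) \<partial>lborel)
    = (\<integral>\<^sup>+y. ennreal ((1 + norm (y::real^'n)) powr (- s)) \<partial>lborel)"
proof -
  have t: "- t \<noteq> 0" using assms by simp
  have [measurable]: "(\<lambda>y. ennreal (1 / t ^ CARD('n) * (1 + norm ((x - y) /\<^sub>R t)) powr (- s))) \<in> borel_measurable borel"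
    by measurable
  have "(\<integral>\<^sup>+y. ennreal (1 / t ^ CARD('n) * (1 + norm ((x - y) /\<^sub>R t)) powr (- s)) \<partial>lborel)
    = (\<integral>\<^sup>+y. ennreal (t ^ CARD('n)) * ennreal (1 / t ^ CARD('n) * (1 + norm (y::real^'n)) powr (- s)) \<partial>lborel)"
    by (subst lborel_affine[OF t, of x])
       (use assms in \<open>simp add: nn_integral_density nn_integral_distr del: norm_scaleR\<close>)
  also have "\<dots> = (\<integral>\<^sup>+y. ennreal ((1 + norm (y::real^'n)) powr (- s)) \<partial>lborel)"
    using assms by (simp add: ennreal_mult'[symmetric])
  finally show ?thesis .
qed

lemma integral_le_nn_integral:
  assumes "integrable M f" "AE x in M. cmod (f x) \<le> g x" "(\<integral>\<^sup>+x. ennreal (g x) \<partial>M) \<le> ennreal b" "0 \<le> b"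
  shows "cmod (\<integral>x. f x \<partial>M) \<le> b"
proof -
  have "ennreal (cmod (\<integral>x. f x \<partial>M)) \<le> (\<integral>\<^sup>+x. ennreal (cmod (f x)) \<partial>M)"
    by (rule integral_norm_bound_ennreal[OF assms(1)])
  also have "\<dots> \<le> (\<integral>\<^sup>+x. ennreal (g x) \<partial>M)"
    using assms(2) by (intro nn_integral_mono_AE) (auto elim!: eventually_mono intro: ennreal_leI)
  finally show ?thesis using assms(3,4) by (metis ennreal_le_iff order_trans)
qed

text \<open>Near the support, each convolution is bounded by \<open>B\<close> times the integral of
  a dilated weight, which does not depend on the scale. Far away, the moments remove the Taylor
  polynomial of degree \<open>d\<close>; the remainder gains \<open>d + 1\<close> powers of
  \<open>norm x\<close> over the factor \<open>norm x powr (- n)\<close>.\<close>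

lemma grand_maximal_atomic_bound:
  fixes f :: "real^'n::finite \<Rightarrow> complex"
  assumes f: "ess_bounded_on R B f"
    and moments: "\<And>\<beta>. mi_order \<beta> \<le> d \<Longrightarrow> (\<integral>x. f x * complex_of_real (mi_power x \<beta>) \<partial>lebesgue) = 0"
    and N: "CARD('n) + d + 1 \<le> N"
  obtains C where "0 < C"
    "\<And>x. grand_maximal N (distribution_of f) x \<le> ennreal (C * (1 + norm x) powr (- real (CARD('n) + d + 1)))"
proof -
  let ?n = "CARD('n)" and ?L = "CARD('n) + d + 1"
  have R: "1 \<le> R" and B: "0 \<le> B" using f by (auto simp: ess_bounded_on_def)
  define W where "W = enn2real (\<integral>\<^sup>+y. ennreal ((1 + norm (y::real^'n)) powr (- real ?L)) \<partial>lborel)"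
  have W: "(\<integral>\<^sup>+y. ennreal ((1 + norm (y::real^'n)) powr (- real ?L)) \<partial>lborel) = ennreal W"
    unfolding W_def using nn_integral_weight_finite[where ?'n = 'n, of "real ?L"] by simp
  have W0: "0 \<le> W" by (simp add: W_def)
  define F where "F = (\<integral>y. cmod (f y) \<partial>lebesgue)"
  have F0: "0 \<le> F" by (simp add: F_def)
  \<comment> \<open>First term: the region \<open>norm x \<le> 2 * R\<close>. Second term: the far
    region, where \<open>4 ^ ?L\<close> collects \<open>2 ^ ?L\<close> from halving
    \<open>norm w\<close> and \<open>2 ^ ?L\<close> from passing from \<open>norm x\<close> to
    \<open>1 + norm x\<close>.\<close>
  define C where "C = B * W * (1 + 2 * R) ^ ?L + F * (real (?n ^ Suc d) * R ^ Suc d * 4 ^ ?L) + 1"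
  have C0: "0 \<le> B * W * (1 + 2 * R) ^ ?L" "0 \<le> F * (real (?n ^ Suc d) * R ^ Suc d * 4 ^ ?L)"
    using B W0 R F0 by (auto intro!: mult_nonneg_nonneg)
  then have C: "0 < C" by (simp add: C_def add_nonneg_pos)
  have pw: "(1 + norm z) powr (- real k) = 1 / (1 + norm z) ^ k" for z :: "real^'n" and k
    using powr_realpow[of "1 + norm z" k] by (simp add: powr_minus divide_inverse add_pos_nonneg)
  have bound: "cmod (convolve (dilate t \<psi>) (distribution_of f) x) \<le> C / (1 + norm x) ^ ?L"
    if t: "0 < t" and \<psi>: "\<psi> \<in> test_class N" for t \<psi> and x :: "real^'n"
  proof -
    have \<psi>s: "\<psi> \<in> schwartz" using \<psi> by (simp add: test_class_def)
    have x0: "0 < 1 + norm x" by (simp add: add_pos_nonneg)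
    have pos: "0 < 1 + norm z" for z :: "real^'n" by (simp add: add_pos_nonneg)
    note conv = convolve_distribution_of[OF \<psi>s t, of f x]
    show ?thesis
    proof (cases "norm x \<le> 2 * R")
      case True
      have "cmod (\<integral>y. f y * dilate t \<psi> (x - y) \<partial>lebesgue) \<le> B * W"
      proof (rule integral_le_nn_integral)
        show "integrable lebesgue (\<lambda>y. f y * dilate t \<psi> (x - y))"
          by (rule ess_bounded_on_schwartz_integrable[OF f dilate_reflect_schwartz[OF \<psi>s t]])
        have \<psi>b: "cmod (\<psi> z) \<le> (1 + norm z) powr (- real ?L)" for z
        proof -
          have "(1 + norm z) ^ ?L * cmod (\<psi> z) \<le> (1 + norm z) ^ N * cmod (\<psi> z)"
            using N by (intro mult_right_mono power_increasing) auto
          also have "\<dots> \<le> 1" using norm_le_schwartz_norm[OF \<psi>s, of z N] \<psi> by (simp add: test_class_def)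
          finally show ?thesis unfolding pw pos_le_divide_eq[OF zero_less_power[OF pos]] by (simp only: mult.commute)
        qed
        have "AE y in lebesgue. cmod (f y) \<le> B" using f by (simp add: ess_bounded_on_def)
        then show "AE y in lebesgue. cmod (f y * dilate t \<psi> (x - y)) \<le> B * (1 / t ^ ?n * (1 + norm ((x - y) /\<^sub>R t)) powr (- real ?L))"
        proof eventually_elim
          case (elim y)
          show ?case unfolding norm_mult dilate_def
            using elim \<psi>b[of "(x - y) /\<^sub>R t"] t B by (intro mult_mono) (auto simp: norm_divide norm_power intro!: divide_right_mono)
        qed
        show "(\<integral>\<^sup>+y. ennreal (B * (1 / t ^ ?n * (1 + norm ((x - y) /\<^sub>R t)) powr (- real ?L))) \<partial>lebesgue) \<le> ennreal (B * W)"
          using B by (simp only: ennreal_mult' nn_integral_completion)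
             (subst nn_integral_cmult, measurable, simp only: nn_integral_dilate_weight[OF t] W order_refl)
      qed (use B W0 in simp)
      also have "\<dots> \<le> C / (1 + norm x) ^ ?L"
      proof -
        have "B * W * (1 + norm x) ^ ?L \<le> B * W * (1 + 2 * R) ^ ?L"
          using True B W0 by (intro mult_left_mono power_mono) auto
        also have "\<dots> \<le> C" using C0 by (simp add: C_def)
        finally show ?thesis unfolding pos_le_divide_eq[OF zero_less_power[OF x0]] .
      qed
      finally show ?thesis by (simp only: conv)
    next
      case False
      define w where "w = x /\<^sub>R t"
      let ?v = "\<lambda>y. - (y /\<^sub>R t)"
      let ?P = "\<lambda>y. \<Sum>j\<le>d. (1 / fact j) *\<^sub>R directional_sum \<psi> (?v y) j w"
      \<comment> \<open>As a function of \<open>y\<close> the Taylor polynomial is a combination of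
        monomials of degree at most \<open>d\<close>, so its integral against \<open>f\<close>
        vanishes.\<close>
      have P_eq: "?P y = (\<Sum>j\<le>d. \<Sum>is | length is = j. (complex_of_real (1 / fact j * (- 1 / t) ^ j) * foldr partial_deriv is \<psi> w) * complex_of_real (mi_power y (count_list is)))" for y
      proof -
        have "prod_list (map (\<lambda>i. ?v y $ i) is) = (- 1 / t) ^ length is * mi_power y (count_list is)" for "is"
          unfolding prod_list_coordinates[symmetric] by (induction "is") (auto simp: field_simps)
        moreover have "c *\<^sub>R z = complex_of_real c * z" for c z by (rule scaleR_conv_of_real)
        ultimately show ?thesis
          unfolding directional_sum_def scaleR_sum_right
          by (intro sum.cong refl) (simp del: vector_uminus_component vector_scaleR_component)
      qed
      have P_int: "integrable lebesgue (\<lambda>y. f y * ?P y)" and P0: "(\<integral>y. f y * ?P y \<partial>lebesgue) = 0"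
      proof -
        have eq: "f y * ?P y = (\<Sum>j\<le>d. \<Sum>is | length is = j. (complex_of_real (1 / fact j * (- 1 / t) ^ j) * foldr partial_deriv is \<psi> w) * (f y * complex_of_real (mi_power y (count_list is))))" for y
          unfolding P_eq sum_distrib_left by (intro sum.cong refl) (simp only: mult_ac)
        show "integrable lebesgue (\<lambda>y. f y * ?P y)" unfolding eq
          by (intro Bochner_Integration.integrable_sum integrable_mult_right mi_power_mult_integrable[OF f])
        have "(\<integral>y. f y * ?P y \<partial>lebesgue) = (\<Sum>j\<le>d. \<Sum>is | length is = j. (complex_of_real (1 / fact j * (- 1 / t) ^ j) * foldr partial_deriv is \<psi> w) * (\<integral>y. f y * complex_of_real (mi_power y (count_list is)) \<partial>lebesgue))"
          unfolding eq
          by (subst Bochner_Integration.integral_sum, intro Bochner_Integration.integrable_sum integrable_mult_right mi_power_mult_integrable[OF f],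
              intro sum.cong refl, subst Bochner_Integration.integral_sum, intro integrable_mult_right mi_power_mult_integrable[OF f], intro sum.cong refl, simp)
        also have "\<dots> = 0"
          by (intro sum.neutral ballI) (auto simp: moments mi_order_count_list)
        finally show "(\<integral>y. f y * ?P y \<partial>lebesgue) = 0" .
      qed
      let ?b = "real (?n ^ Suc d) * R ^ Suc d * 4 ^ ?L / (1 + norm x) ^ ?L"
      have tn: "0 < t ^ ?n" using t by simp
      have D_int: "integrable lebesgue (\<lambda>y. f y * dilate t \<psi> (x - y))"
        by (rule ess_bounded_on_schwartz_integrable[OF f dilate_reflect_schwartz[OF \<psi>s t]])
      have "(\<integral>y. f y * dilate t \<psi> (x - y) \<partial>lebesgue) = (\<integral>y. f y * dilate t \<psi> (x - y) \<partial>lebesgue) - complex_of_real (1 / t ^ ?n) * (\<integral>y. f y * ?P y \<partial>lebesgue)"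
        unfolding P0 by simp
      also have "\<dots> = (\<integral>y. f y * dilate t \<psi> (x - y) - complex_of_real (1 / t ^ ?n) * (f y * ?P y) \<partial>lebesgue)"
        using D_int P_int by simp
      also have "cmod \<dots> \<le> (\<integral>y. cmod (f y) * ?b \<partial>lebesgue)"
      proof (rule Bochner_Integration.integral_norm_bound_integral)
        show "integrable lebesgue (\<lambda>y. f y * dilate t \<psi> (x - y) - complex_of_real (1 / t ^ ?n) * (f y * ?P y))"
          using D_int P_int by simp
        show "integrable lebesgue (\<lambda>y. cmod (f y) * ?b)"
          using ess_bounded_on_integrable[OF f] by simp
        fix y :: "real^'n"
        show "cmod (f y * dilate t \<psi> (x - y) - complex_of_real (1 / t ^ ?n) * (f y * ?P y)) \<le> cmod (f y) * ?b"
        proof (cases "norm y \<le> R")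
          case yR: True
          have v: "norm (?v y) \<le> norm w / 2"
            using yR False t by (simp add: w_def field_simps)
          have "f y * dilate t \<psi> (x - y) - complex_of_real (1 / t ^ ?n) * (f y * ?P y) = f y * (complex_of_real (1 / t ^ ?n) * (\<psi> (w + ?v y) - ?P y))"
            by (simp add: dilate_def w_def scaleR_diff_right algebra_simps)
          also have "cmod \<dots> = cmod (f y) * (1 / t ^ ?n * cmod (\<psi> (w + ?v y) - ?P y))"
            using t by (simp add: norm_mult norm_divide norm_power)
          also have "\<dots> \<le> cmod (f y) * ?b"
          proof (rule mult_left_mono)
            have w0: "0 < 1 + norm w / 2" by (simp add: add_pos_nonneg)
            have "1 / t ^ ?n * cmod (\<psi> (w + ?v y) - ?P y) \<le> 1 / t ^ ?n * (real (?n ^ Suc d) * (norm (?v y) ^ Suc d / (1 + norm w / 2) ^ N))"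
              using N tn by (intro mult_left_mono taylor_remainder_bound[OF \<psi> _ v]) auto
            also have "\<dots> \<le> 1 / t ^ ?n * (real (?n ^ Suc d) * ((R / t) ^ Suc d / (norm x / (2 * t)) ^ ?L))"
            proof (intro mult_left_mono frac_le power_mono)
              show "norm (?v y) \<le> R / t" using yR t by (simp add: field_simps)
              have "(norm x / (2 * t)) ^ ?L \<le> (1 + norm w / 2) ^ ?L"
                using t by (intro power_mono) (auto simp: w_def field_simps)
              also have "\<dots> \<le> (1 + norm w / 2) ^ N" using N by (intro power_increasing) auto
              finally show "(norm x / (2 * t)) ^ ?L \<le> (1 + norm w / 2) ^ N" .
              show "0 < (norm x / (2 * t)) ^ ?L" using t False R by (intro zero_less_power divide_pos_pos) auto
            qed (use t R in auto)
            \<comment> \<open>All powers of \<open>t\<close> cancel: \<open>t ^ n\<close> and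
              \<open>t ^ (d + 1)\<close> against \<open>t ^ ?L\<close>. This dictates the exponent
              \<open>?L = n + d + 1\<close> and makes the bound uniform in the scale.\<close>
            also have "\<dots> = real (?n ^ Suc d) * R ^ Suc d * 2 ^ ?L / norm x ^ ?L"
              using t False R by (simp add: power_divide power_mult_distrib power_add field_simps)
            also have "\<dots> \<le> ?b"
            proof -
              have "(1 + norm x) ^ ?L \<le> (2 * norm x) ^ ?L" using False R by (intro power_mono) auto
              moreover have "1 / u \<le> k / v" if "v \<le> k * u" "0 < u" "0 < v" for u v k :: real
                using that by (simp add: field_simps)
              moreover have "0 < norm x ^ ?L"
                by (rule zero_less_power) (use False R in linarith)
              moreover have "0 < (1 + norm x) ^ ?L" by (rule zero_less_power[OF x0])
              ultimately have h: "1 / norm x ^ ?L \<le> 2 ^ ?L / (1 + norm x) ^ ?L"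
                unfolding power_mult_distrib by blast
              have "real (?n ^ Suc d) * R ^ Suc d * 2 ^ ?L * (1 / norm x ^ ?L) \<le> real (?n ^ Suc d) * R ^ Suc d * 2 ^ ?L * (2 ^ ?L / (1 + norm x) ^ ?L)"
                using R by (intro mult_left_mono h) auto
              moreover have "(2::real) ^ ?L * 2 ^ ?L = 4 ^ ?L" by (simp only: power_mult_distrib[symmetric]) simp
              ultimately show ?thesis by (simp only: mult.assoc times_divide_eq_right mult_1_right)
            qed
            finally show "1 / t ^ ?n * cmod (\<psi> (w + ?v y) - ?P y) \<le> ?b" .
          qed simp
          finally show ?thesis .
        next
          case False
          then have "f y = 0" using f by (simp add: ess_bounded_on_def)
          then show ?thesis by simp
        qed
      qed
      also have "\<dots> = F * ?b" by (simp add: F_def)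
      also have "\<dots> \<le> C / (1 + norm x) ^ ?L"
      proof -
        have "F * (real (?n ^ Suc d) * R ^ Suc d * 4 ^ ?L) \<le> C" using C0 by (simp add: C_def)
        then have "F * (real (?n ^ Suc d) * R ^ Suc d * 4 ^ ?L) / (1 + norm x) ^ ?L \<le> C / (1 + norm x) ^ ?L"
          using x0 by (intro divide_right_mono) auto
        then show ?thesis by (simp only: times_divide_eq_right)
      qed
      finally show ?thesis by (simp only: conv)
    qed
  qed
  show thesis
  proof (rule that[OF C])
    fix x :: "real^'n"
    show "grand_maximal N (distribution_of f) x \<le> ennreal (C * (1 + norm x) powr (- real ?L))"
      unfolding grand_maximal_def pw
      by (intro SUP_least) (auto simp: cmod_fun_def intro!: ennreal_leI order_trans[OF bound])
  qed
qed

text \<open>Raised to the power \<open>p x \<ge> a\<close>, the weight decays at least like the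
  power \<open>L * a > n\<close>, so the modular is finite; division by \<open>v\<close> then brings
  it below 1.\<close>

lemma Hardy_norm_finite_of_decay:
  fixes p :: "real^'n::finite \<Rightarrow> real"
  assumes [measurable]: "p \<in> borel_measurable lebesgue" and a: "0 < a" "\<And>x. a \<le> p x" and b: "\<And>x. p x \<le> b"
    and L: "real CARD('n) < L * a" "0 \<le> L" and C: "0 < C"
    and g: "\<And>x. grand_maximal N u x \<le> ennreal (C * (1 + norm x) powr (- L))"
  shows "Hardy_norm N p u < \<infinity>"
proof -
  \<comment> \<open>The explicit majorant is measurable, so \<open>modular_divide_le\<close> can be
    applied to it in place of the maximal function.\<close>
  define h where "h x = ennreal (C * (1 + norm x) powr (- L))" for x :: "real^'n"
  have hm [measurable]: "h \<in> borel_measurable lebesgue"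
    unfolding h_def by (rule measurable_completion) measurable
  have p0: "0 < p x" for x using a(1) a(2)[of x] by linarith
  define c where "c = max 1 C powr b"
  have "epowr (h x) (p x) \<le> ennreal c * ennreal ((1 + norm x) powr (- (L * a)))" for x
  proof -
    have "epowr (h x) (p x) = ennreal (C powr p x * ((1 + norm x) powr (- (L * p x))))"
      using C unfolding h_def by (subst epowr_ennreal) (auto simp: powr_mult powr_powr)
    also have "\<dots> \<le> ennreal (c * (1 + norm x) powr (- (L * a)))"
    proof (intro ennreal_leI mult_mono)
      have "C powr p x \<le> max 1 C powr p x" using C p0[of x] by (intro powr_mono2) auto
      also have "\<dots> \<le> c" unfolding c_def using b by (intro powr_mono) auto
      finally show "C powr p x \<le> c" .
      show "(1 + norm x) powr (- (L * p x)) \<le> (1 + norm x) powr (- (L * a))"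
        using a(2)[of x] L(2) by (intro powr_mono) (auto intro: mult_left_mono)
    qed (auto simp: c_def)
    finally show ?thesis by (simp add: ennreal_mult c_def)
  qed
  then have "modular p h \<le> (\<integral>\<^sup>+x. ennreal c * ennreal ((1 + norm (x::real^'n)) powr (- (L * a))) \<partial>lebesgue)"
    unfolding modular_def by (rule nn_integral_mono)
  also have "\<dots> = ennreal c * (\<integral>\<^sup>+x. ennreal ((1 + norm (x::real^'n)) powr (- (L * a))) \<partial>lborel)"
    by (simp add: nn_integral_completion nn_integral_cmult)
  also have "\<dots> < \<infinity>"
    using nn_integral_weight_finite[where ?'n = 'n, OF L(1)] by (simp add: ennreal_mult_less_top)
  finally obtain m where m: "0 \<le> m" "modular p h = ennreal m"
    by (metis ennreal_cases infinity_ennreal_def less_irrefl)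
  define v where "v = max 1 (m powr (1 / a))"
  have v: "1 \<le> v" "0 < v" by (auto simp: v_def)
  have "modular p (\<lambda>x. grand_maximal N u x / ennreal v) \<le> modular p (\<lambda>x. h x / ennreal v)"
    by (intro modular_mono p0 divide_right_mono_ennreal) (simp add: g h_def)
  also have "\<dots> \<le> ennreal (v powr (- a)) * modular p h"
    by (rule modular_divide_le) (use a v in auto)
  also have "\<dots> = ennreal (v powr (- a) * m)" using m by (simp add: ennreal_mult)
  also have "\<dots> \<le> 1"
  proof -
    have "(m powr (1 / a)) powr a \<le> v powr a" using a by (intro powr_mono2) (auto simp: v_def)
    then have "m \<le> v powr a" using a m by (simp add: powr_powr)
    then have "v powr (- a) * m \<le> 1" using v by (simp add: powr_minus field_simps)
    then show ?thesis by (simp add: ennreal_le_1)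
  qed
  finally have "Lp_norm p (grand_maximal N u) \<le> ennreal v"
    unfolding Lp_norm_def using v by (intro Inf_lower) auto
  then show ?thesis unfolding Hardy_norm_def by (rule order_le_less_trans) simp
qed

lemma finite_atomic_in_Hardy_space:
  fixes p :: "real^'n::finite \<Rightarrow> real"
  assumes "p \<in> borel_measurable lebesgue" and a: "0 < a" "\<And>x. a \<le> p x" and b: "\<And>x. p x \<le> b"
    and d: "real CARD('n) < real (CARD('n) + d + 1) * a" and N: "CARD('n) + d + 1 \<le> N"
    and f: "f \<in> finite_atomic p d"
  shows "distribution_of f \<in> Hardy_space N p"
proof -
  obtain R B where f': "ess_bounded_on R B f"
    and m: "\<And>\<beta>. mi_order \<beta> \<le> d \<Longrightarrow> (\<integral>x. f x * complex_of_real (mi_power x \<beta>) \<partial>lebesgue) = 0"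
    using finite_atomic_ess_bounded[OF a(2,1) f] by blast
  obtain C where C: "0 < C"
    "\<And>x. grand_maximal N (distribution_of f) x \<le> ennreal (C * (1 + norm x) powr (- real (CARD('n) + d + 1)))"
    using grand_maximal_atomic_bound[OF f' m N] by blast
  have "Hardy_norm N p (distribution_of f) < \<infinity>"
    by (rule Hardy_norm_finite_of_decay[OF assms(1) a b d _ C]) simp
  with distribution_of_tempered[OF f'] show ?thesis by (simp add: Hardy_space_def)
qed

section \<open>The subordination formula\<close>

lemma prod_Basis_vec:
  "(\<Prod>b\<in>(Basis :: ('a::euclidean_space^'m) set). g b) = (\<Prod>k\<in>UNIV. \<Prod>b\<in>Basis. g (axis k b))"
proof -
  have eq: "(Basis :: ('a^'m) set) = (\<lambda>(k, b). axis k b) ` (UNIV \<times> Basis)"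
    by (auto simp: Basis_vec_def)
  have inj: "inj_on (\<lambda>(k, b). axis k b) (UNIV \<times> (Basis :: 'a set))"
    by (auto simp: inj_on_def axis_eq_axis)
  show ?thesis
    unfolding eq by (subst prod.reindex[OF inj]) (simp add: prod.cartesian_product case_prod_beta')
qed

lemma measurable_vec_of_PiM:
  "(\<lambda>f. \<chi> k. f k) \<in> PiM UNIV (\<lambda>_::'m::finite. lborel :: 'a::euclidean_space measure) \<rightarrow>\<^sub>M (borel :: ('a^'m) measure)"
proof (rule borel_measurable_euclidean_space[THEN iffD2], rule ballI)
  fix b :: "'a^'m" assume "b \<in> Basis"
  then obtain k v where b: "b = axis k v" by (auto simp: Basis_vec_def)
  have "(\<lambda>f. f k) \<in> PiM UNIV (\<lambda>_::'m. lborel :: 'a measure) \<rightarrow>\<^sub>M lborel"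
    by (rule measurable_component_singleton) simp
  then have "(\<lambda>f. f k \<bullet> v) \<in> borel_measurable (PiM UNIV (\<lambda>_::'m. lborel :: 'a measure))"
    by (intro borel_measurable_inner) auto
  then show "(\<lambda>f. (\<chi> k. f k) \<bullet> b) \<in> borel_measurable (PiM UNIV (\<lambda>_::'m. lborel :: 'a measure))"
    by (simp add: b inner_axis)
qed

text \<open>Both measures give a box the product of its side lengths, grouped by components on one
  side. The identification opens product integrals to integration component by component.\<close>

lemma lborel_vec_eq_distr_PiM:
  "(lborel :: ('a::euclidean_space^'m::finite) measure) = distr (PiM UNIV (\<lambda>_::'m. lborel :: 'a measure)) borel (\<lambda>f. \<chi> k. f k)"
proof (rule lborel_eqI)
  interpret product_sigma_finite "\<lambda>_::'m. lborel :: 'a measure" ..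
  note m = measurable_vec_of_PiM[where ?'m = 'm and ?'a = 'a]
  fix l u :: "'a^'m" assume lu: "\<And>b. b \<in> Basis \<Longrightarrow> l \<bullet> b \<le> u \<bullet> b"
  have le: "l $ k \<bullet> b \<le> u $ k \<bullet> b" if "b \<in> Basis" for k b
  proof -
    have "axis k b \<in> (Basis :: ('a^'m) set)" using that by (auto simp: Basis_vec_def)
    from lu[OF this] show ?thesis by (simp add: inner_axis)
  qed
  have box: "(\<chi> k. f k) \<in> box l u \<longleftrightarrow> (\<forall>k. f k \<in> box (l $ k) (u $ k))" for f
    by (auto simp: mem_box Basis_vec_def inner_axis)
  have "emeasure (distr (PiM UNIV (\<lambda>_::'m. lborel :: 'a measure)) borel (\<lambda>f. \<chi> k. f k)) (box l u)
    = emeasure (PiM UNIV (\<lambda>_::'m. lborel :: 'a measure)) (Pi\<^sub>E UNIV (\<lambda>k. box (l $ k) (u $ k)))"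
    by (subst emeasure_distr[OF m]) (auto simp: space_PiM box PiE_UNIV_domain Pi_iff intro!: arg_cong[where f = "emeasure _"])
  also have "\<dots> = (\<Prod>k\<in>UNIV. emeasure lborel (box (l $ k) (u $ k)))"
    by (rule emeasure_PiM) auto
  also have "\<dots> = (\<Prod>k\<in>UNIV. ennreal (\<Prod>b\<in>Basis. (u $ k - l $ k) \<bullet> b))"
  proof (intro prod.cong refl)
    fix k :: 'm
    show "emeasure lborel (box (l $ k) (u $ k)) = ennreal (\<Prod>b\<in>Basis. (u $ k - l $ k) \<bullet> b)"
      by (rule emeasure_lborel_box[OF le])
  qed
  also have "\<dots> = ennreal (\<Prod>k\<in>UNIV. \<Prod>b\<in>Basis. (u $ k - l $ k) \<bullet> b)"
    using le by (intro prod_ennreal prod_nonneg) (auto simp: inner_diff_left)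
  also have "(\<Prod>k\<in>UNIV. \<Prod>b\<in>Basis. (u $ k - l $ k) \<bullet> b) = (\<Prod>b\<in>Basis. (u - l) \<bullet> b)"
    by (simp add: prod_Basis_vec inner_axis)
  finally show "emeasure (distr (PiM UNIV (\<lambda>_::'m. lborel :: 'a measure)) borel (\<lambda>f. \<chi> k. f k)) (box l u) = ennreal (\<Prod>b\<in>Basis. (u - l) \<bullet> b)" .
qed simp

lemma measurable_vec_nth_borel [measurable]:
  "(\<lambda>y. y $ k) \<in> borel_measurable (borel :: ('a::euclidean_space^'m::finite) measure)"
  by (intro borel_measurable_continuous_onI continuous_intros)

lemma nn_integral_vec_prod:
  fixes h :: "'m::finite \<Rightarrow> 'a::euclidean_space \<Rightarrow> ennreal"
  assumes [measurable]: "\<And>k. h k \<in> borel_measurable borel"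
  shows "(\<integral>\<^sup>+y. (\<Prod>k\<in>UNIV. h k (y $ k)) \<partial>(lborel :: ('a^'m) measure)) = (\<Prod>k\<in>UNIV. \<integral>\<^sup>+z. h k z \<partial>lborel)"
proof -
  interpret product_sigma_finite "\<lambda>_::'m. lborel :: 'a measure" ..
  show ?thesis
    by (subst lborel_vec_eq_distr_PiM, subst nn_integral_distr[OF measurable_vec_of_PiM])
       (auto intro!: product_nn_integral_prod)
qed

lemma integral_vec_prod:
  fixes h :: "'m::finite \<Rightarrow> 'a::euclidean_space \<Rightarrow> complex"
  assumes int: "\<And>k. integrable lborel (h k)"
  shows "(\<integral>y. (\<Prod>k\<in>UNIV. h k (y $ k)) \<partial>(lborel :: ('a^'m) measure)) = (\<Prod>k\<in>UNIV. \<integral>z. h k z \<partial>lborel)"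
proof -
  interpret product_sigma_finite "\<lambda>_::'m. lborel :: 'a measure" ..
  have [measurable]: "h k \<in> borel_measurable borel" for k
    using borel_measurable_integrable[OF int[of k]] by simp
  show ?thesis
    by (subst lborel_vec_eq_distr_PiM, subst integral_distr[OF measurable_vec_of_PiM])
       (auto intro!: product_integral_prod int)
qed

lemma lborel_reflect:
  fixes x :: "'a::euclidean_space"
  shows "lborel = distr lborel borel (\<lambda>z. x - z)"
  using lborel_affine[of "-1" x] by (simp add: density_1)

text \<open>The exceptional set is a cylinder over a null set. Its measure is a product with one
  factor 0, which vanishes in \<open>ennreal\<close> although the other factors may be
  infinite.\<close>

lemma AE_vec_component:
  fixes P :: "'a::euclidean_space \<Rightarrow> bool" and k :: "'m::finite"
  assumes "AE z in lborel. P z"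
  shows "AE y in (lborel :: ('a^'m) measure). P (x - y $ k)"
proof -
  have "AE z in distr lborel borel (\<lambda>z. x - z). P z" using assms by (subst lborel_reflect[symmetric])
  then obtain N where N: "N \<in> null_sets lborel" "\<And>z. z \<notin> N \<Longrightarrow> P (x - z)"
    using AE_distrD[of "\<lambda>z. x - z" lborel borel P] by (auto elim!: AE_E3)
  then have [measurable]: "N \<in> sets borel" by auto
  have "(\<integral>\<^sup>+y. indicator {y. y $ k \<in> N} y \<partial>(lborel :: ('a^'m) measure))
    = (\<integral>\<^sup>+y. (\<Prod>j\<in>UNIV. (if j = k then indicator N (y $ j) else 1)) \<partial>(lborel :: ('a^'m) measure))"
    by (intro nn_integral_cong) (simp add: prod.delta indicator_def)
  also have "\<dots> = (\<Prod>j\<in>UNIV. \<integral>\<^sup>+z. (if j = k then indicator N z else 1) \<partial>(lborel :: 'a measure))"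
    by (rule nn_integral_vec_prod) auto
  also have "\<dots> = 0"
    using N(1) by (intro prod_zero bexI[of _ k]) auto
  finally have "emeasure (lborel :: ('a^'m) measure) {y. y $ k \<in> N} = 0"
    by (subst (asm) nn_integral_indicator) auto
  then have "{y. y $ k \<in> N} \<in> null_sets (lborel :: ('a^'m) measure)"
    by (auto simp: null_sets_def)
  then have "AE y in (lborel :: ('a^'m) measure). y $ k \<notin> N"
    by (drule_tac AE_not_in) simp
  then show ?thesis by eventually_elim (use N(2) in blast)
qed

text \<open>Completeness of Lebesgue measure. It serves integrands that compose a merely Lebesgue
  measurable function with a coordinate map, where measurability does not follow from
  composition.\<close>

lemma lebesgue_measurable_cong_AE:
  assumes f: "f \<in> borel_measurable lebesgue" and ae: "AE x in lebesgue. f x = g x"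
  shows "g \<in> borel_measurable lebesgue"
proof (rule measurableI)
  fix S :: "'b set" assume S: "S \<in> sets borel"
  have A: "f -` S \<in> sets lebesgue" using measurable_sets[OF f S] by simp
  have "AE x in lebesgue. (x \<in> f -` S) = (x \<in> g -` S)"
    using ae by (auto elim!: eventually_mono)
  then have "g -` S \<in> sets lebesgue"
    by (rule completion.in_sets_AE[OF _ A]) simp
  then show "g -` S \<inter> space lebesgue \<in> sets lebesgue" by simp
qed simp

text \<open>Real and imaginary part have Borel representatives; setting the result to 0 where the
  bound or the support condition fails makes both hold everywhere and changes it only on a null
  set.\<close>

lemma ess_bounded_on_borel_version:
  fixes f :: "real^'n \<Rightarrow> complex"
  assumes f: "ess_bounded_on R B f"
  obtains h where "h \<in> borel_measurable borel" "\<And>x. cmod (h x) \<le> B" "\<And>x. R < norm x \<Longrightarrow> h x = 0"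
    "AE x in lebesgue. f x = h x"
proof -
  have fm: "f \<in> borel_measurable (completion lborel)" using f by (simp add: ess_bounded_on_def)
  obtain h1 where h1[measurable]: "h1 \<in> borel_measurable lborel" and e1: "AE x in lborel. Re (f x) = h1 x"
    using completion_ex_borel_measurable_real[of "\<lambda>x. Re (f x)" lborel] fm by auto
  obtain h2 where h2[measurable]: "h2 \<in> borel_measurable lborel" and e2: "AE x in lborel. Im (f x) = h2 x"
    using completion_ex_borel_measurable_real[of "\<lambda>x. Im (f x)" lborel] fm by auto
  define c where "c x = complex_of_real (h1 x) + \<i> * complex_of_real (h2 x)" for x
  define h where "h x = (if cmod (c x) \<le> B \<and> norm x \<le> R then c x else 0)" for x
  have "c \<in> borel_measurable borel" unfolding c_def using h1 h2 by simp
  then have m: "h \<in> borel_measurable borel"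
    unfolding h_def by measurable
  have "AE x in lebesgue. Re (f x) = h1 x" "AE x in lebesgue. Im (f x) = h2 x" "AE x in lebesgue. cmod (f x) \<le> B"
    using e1 e2 f by (auto simp: ess_bounded_on_def AE_completion_iff intro: AE_completion)
  then have "AE x in lebesgue. f x = h x"
  proof eventually_elim
    case (elim x)
    then have "c x = f x" by (simp add: complex_eq_iff c_def)
    then show ?case using elim f by (auto simp: h_def ess_bounded_on_def)
  qed
  moreover have "0 \<le> B" using f by (simp add: ess_bounded_on_def)
  ultimately show thesis by (intro that[of h] m) (auto simp: h_def)
qed

section \<open>The radial integral that represents the kernel\<close>

definition riesz_const :: "real \<Rightarrow> real" where
  "riesz_const s = (\<integral>t. indicator {0<..} t * (t powr (- s - 1) * exp (- (1 / t\<^sup>2))) \<partial>lborel)"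

lemma riesz_kernel_integrable:
  assumes s: "0 < s"
  shows "integrable lborel (\<lambda>t::real. indicator {0<..} t * (t powr (- s - 1) * exp (- (1 / t\<^sup>2))))"
proof (rule integrableI_bounded)
  \<comment> \<open>A single term of the exponential series, of index \<open>j\<close> with
    \<open>2 * j \<ge> s + 1\<close>, outweighs the singularity \<open>t powr (- s - 1)\<close> at
    0.\<close>
  obtain j :: nat where j: "s + 1 \<le> 2 * real j" using real_arch_simple[of "s + 1"] by (metis dual_order.trans le_add_same_cancel1 mult_2 of_nat_0_le_iff)
  have "ennreal (norm (indicator {0<..} t * (t powr (- s - 1) * exp (- (1 / t\<^sup>2)))))
    \<le> ennreal (fact j) * indicator {0..1} t + ennreal (t powr (- s - 1)) * indicator {1..} t" for t :: real
  proof -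
    consider "t \<le> 0" | "0 < t" "t \<le> 1" | "1 < t" by linarith
    then show ?thesis
    proof cases
      case 2
      have "(1 / t\<^sup>2) ^ j / fact j \<le> exp (1 / t\<^sup>2)"
      proof -
        define g where "g n = (1 / t\<^sup>2) ^ n /\<^sub>R fact n" for n
        have g: "g sums exp (1 / t\<^sup>2)" unfolding g_def by (rule exp_converges)
        have "sum g {j} \<le> suminf g"
          by (rule sum_le_suminf[OF sums_summable[OF g]]) (auto simp: g_def)
        then have "g j \<le> exp (1 / t\<^sup>2)" using sums_unique[OF g] by simp
        then show ?thesis by (simp add: g_def divide_inverse mult.commute)
      qed
      moreover have "t powr (- (2 * real j)) = (1 / t\<^sup>2) ^ j"
      proof -
        have "t powr (2 * real j) = (t\<^sup>2) ^ j" using 2 powr_realpow[of t "2 * j"] by (simp add: power_mult)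
        then show ?thesis by (simp only: powr_minus power_divide power_one inverse_eq_divide)
      qed
      moreover have "t powr (- s - 1) \<le> t powr (- (2 * real j))" using 2 j by (intro powr_mono') auto
      moreover have "a \<le> F * E" if "u / F \<le> E" "v = u" "a \<le> v" "0 < F" for a u v E F :: real
        using that by (simp add: pos_divide_le_eq mult.commute)
      ultimately have "t powr (- s - 1) \<le> fact j * exp (1 / t\<^sup>2)" using fact_gt_zero by blast
      then have "t powr (- s - 1) * exp (- (1 / t\<^sup>2)) \<le> fact j" by (simp add: exp_minus field_simps)
      then have "ennreal (t powr (- s - 1) * exp (- (1 / t\<^sup>2))) \<le> ennreal (fact j)" by (rule ennreal_leI)
      then show ?thesis using 2 by (simp add: add_increasing2)
    next
      case 3
      have "t powr (- s - 1) * exp (- (1 / t\<^sup>2)) \<le> t powr (- s - 1) * 1" by (intro mult_left_mono) auto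
      then have "ennreal (t powr (- s - 1) * exp (- (1 / t\<^sup>2))) \<le> ennreal (t powr (- s - 1))" by (simp add: ennreal_leI)
      then show ?thesis using 3 by (simp add: add_increasing)
    qed simp
  qed
  then have "(\<integral>\<^sup>+t. ennreal (norm (indicator {0<..} t * (t powr (- s - 1) * exp (- (1 / t\<^sup>2))))) \<partial>lborel)
    \<le> (\<integral>\<^sup>+t. ennreal (fact j) * indicator {0..1} t + ennreal (t powr (- s - 1)) * indicator {1..} t \<partial>lborel)"
    by (rule nn_integral_mono)
  also have "\<dots> = ennreal (fact j) + ennreal (1 powr (- s) / s)"
    using s by (subst nn_integral_add) (auto simp: nn_integral_cmult_indicator nn_integral_powr_inf)
  also have "\<dots> < \<infinity>" by (simp add: ennreal_plus[symmetric] del: ennreal_plus)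
  finally show "(\<integral>\<^sup>+t. ennreal (norm (indicator {0<..} t * (t powr (- s - 1) * exp (- (1 / t\<^sup>2))))) \<partial>lborel) < \<infinity>" .
qed measurable

text \<open>The constant is \<open>Gamma (s / 2) / 2\<close>, and the operator is defined by
  dividing by it. Integrability has to be known first, since a divergent Bochner integral has the
  value 0.\<close>

lemma riesz_const_pos:
  assumes s: "0 < s"
  shows "0 < riesz_const s"
proof -
  let ?f = "\<lambda>t::real. indicator {0<..} t * (t powr (- s - 1) * exp (- (1 / t\<^sup>2)))"
  define c where "c = 2 powr (- s - 1) * exp (- (1::real))"
  have c: "0 < c" by (simp add: c_def)
  have "c = (\<integral>t. c * indicator {1..2::real} t \<partial>lborel)" by simp
  also have "\<dots> \<le> (\<integral>t. ?f t \<partial>lborel)"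
  proof (rule integral_mono)
    show "integrable lborel ?f" by (rule riesz_kernel_integrable[OF s])
    show "integrable lborel (\<lambda>t. c * indicator {1..2::real} t)" by simp
    fix t :: real
    show "c * indicator {1..2} t \<le> ?f t"
    proof (cases "t \<in> {1..2}")
      case True
      have "2 powr (- s - 1) * exp (- 1) \<le> t powr (- s - 1) * exp (- (1 / t\<^sup>2))"
      proof (rule mult_mono)
        show "2 powr (- s - 1) \<le> t powr (- s - 1)" using True s by (intro powr_mono2') auto
        have "1 \<le> t\<^sup>2" using True by (simp add: one_le_power)
        then have "1 / t\<^sup>2 \<le> 1" by (subst divide_le_eq_1_pos) linarith+
        then show "exp (- 1) \<le> exp (- (1 / t\<^sup>2))" by simp
      qed auto
      then show ?thesis using True by (simp add: c_def)
    qed (auto simp: indicator_def)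
  qed
  finally show ?thesis using c by (simp add: riesz_const_def)
qed

lemma riesz_kernel_integral:
  assumes s: "0 < s" and r: "0 < r"
  shows "(\<integral>t. indicator {0<..} t * (t powr (- s - 1) * exp (- (r\<^sup>2 / t\<^sup>2))) \<partial>lborel) = riesz_const s * r powr (- s)"
proof -
  have "(\<integral>t. indicator {0<..} t * (t powr (- s - 1) * exp (- (r\<^sup>2 / t\<^sup>2))) \<partial>lborel)
    = \<bar>r\<bar> *\<^sub>R (\<integral>t. indicator {0<..} (0 + r * t) * ((0 + r * t) powr (- s - 1) * exp (- (r\<^sup>2 / (0 + r * t)\<^sup>2))) \<partial>lborel)"
    by (rule lborel_integral_real_affine) (use r in auto)
  also have "\<dots> = \<bar>r\<bar> *\<^sub>R (\<integral>t. r powr (- s - 1) * (indicator {0<..} t * (t powr (- s - 1) * exp (- (1 / t\<^sup>2)))) \<partial>lborel)"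
    using r by (intro arg_cong[where f = "\<lambda>z. \<bar>r\<bar> *\<^sub>R z"] Bochner_Integration.integral_cong refl)
       (auto simp: indicator_def zero_less_mult_iff powr_mult power_mult_distrib)
  also have "\<dots> = (r * r powr (- s - 1)) * riesz_const s"
    using r by (simp add: riesz_const_def)
  also have "r * r powr (- s - 1) = r powr (- s)"
    using r by (simp add: powr_diff)
  finally show ?thesis by (simp add: mult.commute)
qed


section \<open>Heat extensions and the operator built from them\<close>

definition heat :: "'n::finite functional \<Rightarrow> real^'n \<Rightarrow> real \<Rightarrow> complex" where
  "heat u x t = (if 0 < t then convolve (dilate t gaussian) u x else 0)"

text \<open>Up to the factor \<open>pi powr (n / 2)\<close>, \<open>heat u x t\<close> solves the
  heat equation with initial value \<open>u\<close>, at time \<open>t\<^sup>2 / 4\<close>. Its value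
  0 for \<open>t \<le> 0\<close> restricts the integral to positive scales.\<close>

definition riesz_operator :: "real \<Rightarrow> ('m::finite \<Rightarrow> 'n::finite functional) \<Rightarrow> real^'n \<Rightarrow> complex" where
  "riesz_operator \<alpha> F x =
     complex_of_real (1 / riesz_const (real (CARD('m) * CARD('n)) - \<alpha>)) *
     (\<integral>t. complex_of_real (t powr (\<alpha> - 1)) * (\<Prod>k\<in>UNIV. heat (F k) x t) \<partial>lborel)"

lemma heat_measurable:
  assumes "u \<in> tempered"
  shows "(\<lambda>p. heat u (fst p) (snd p)) \<in> borel_measurable borel"
proof -
  have "UNIV \<times> {0<..} \<in> sets (borel :: ((real^'a) \<times> real) measure)"
    by (intro borel_open open_Times) auto
  from borel_measurable_continuous_on_indicator[OF this convolve_dilate_continuous[OF assms gaussian_schwartz]]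
  show ?thesis
    by (rule measurable_cong[THEN iffD1, rotated]) (auto simp: heat_def indicator_def)
qed

lemma integral_reflect:
  fixes g :: "'a::euclidean_space \<Rightarrow> complex"
  assumes [measurable]: "g \<in> borel_measurable borel"
  shows "(\<integral>y. g y \<partial>lborel) = (\<integral>z. g (x - z) \<partial>lborel)"
proof -
  have "(\<integral>y. g y \<partial>lborel) = (\<integral>y. g y \<partial>distr lborel borel (\<lambda>z. x - z))"
    by (simp only: lborel_reflect[symmetric])
  also have "\<dots> = (\<integral>z. g (x - z) \<partial>lborel)" by (rule integral_distr) measurable
  finally show ?thesis .
qed

lemma nn_integral_reflect:
  fixes g :: "'a::euclidean_space \<Rightarrow> ennreal"
  assumes [measurable]: "g \<in> borel_measurable borel"
  shows "(\<integral>\<^sup>+y. g y \<partial>lborel) = (\<integral>\<^sup>+z. g (x - z) \<partial>lborel)"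
proof -
  have "(\<integral>\<^sup>+y. g y \<partial>lborel) = (\<integral>\<^sup>+y. g y \<partial>distr lborel borel (\<lambda>z. x - z))"
    by (simp only: lborel_reflect[symmetric])
  also have "\<dots> = (\<integral>\<^sup>+z. g (x - z) \<partial>lborel)" by (rule nn_integral_distr) measurable
  finally show ?thesis .
qed

lemma dilate_gaussian: "0 < t \<Longrightarrow> dilate t gaussian z = complex_of_real (exp (- ((norm z)\<^sup>2 / t\<^sup>2)) / t ^ CARD('n))"
  for z :: "real^'n"
  by (simp add: dilate_def gaussian_def power_mult_distrib divide_inverse power_inverse mult.commute)

lemma heat_distribution_of:
  fixes f h :: "real^'n::finite \<Rightarrow> complex"
  assumes f: "f \<in> borel_measurable lebesgue" and h[measurable]: "h \<in> borel_measurable borel"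
    and ae: "AE x in lebesgue. f x = h x" and t: "0 < t"
  shows "heat (distribution_of f) x t =
    (\<integral>z. complex_of_real (exp (- ((norm z)\<^sup>2 / t\<^sup>2)) / t ^ CARD('n)) * h (x - z) \<partial>lborel)"
proof -
  have [measurable]: "gaussian \<in> borel_measurable (borel :: (real^'n) measure)"
    by (rule schwartz_borel_measurable(1)[OF gaussian_schwartz])
  have g[measurable]: "(\<lambda>y. h y * dilate t gaussian (x - y)) \<in> borel_measurable borel"
    unfolding dilate_def by measurable
  have "heat (distribution_of f) x t = (\<integral>y. f y * dilate t gaussian (x - y) \<partial>lebesgue)"
    using convolve_distribution_of[OF gaussian_schwartz t] t by (simp add: heat_def)
  also have "\<dots> = (\<integral>y. h y * dilate t gaussian (x - y) \<partial>lebesgue)"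
  proof (rule integral_cong_AE)
    have "(\<lambda>y. dilate t gaussian (x - y)) \<in> borel_measurable lebesgue"
      by (rule schwartz_borel_measurable(2)[OF dilate_reflect_schwartz[OF gaussian_schwartz t]])
    then show "(\<lambda>y. f y * dilate t gaussian (x - y)) \<in> borel_measurable lebesgue"
      using f by simp
    show "(\<lambda>y. h y * dilate t gaussian (x - y)) \<in> borel_measurable lebesgue"
      using g by (simp add: measurable_completion)
    show "AE y in lebesgue. f y * dilate t gaussian (x - y) = h y * dilate t gaussian (x - y)"
      using ae by (auto elim!: eventually_mono)
  qed
  also have "\<dots> = (\<integral>y. h y * dilate t gaussian (x - y) \<partial>lborel)"
    by (rule integral_completion) simp
  also have "\<dots> = (\<integral>z. h (x - z) * dilate t gaussian (x - (x - z)) \<partial>lborel)"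
    by (rule integral_reflect) simp
  finally show ?thesis using t by (simp add: dilate_gaussian mult.commute)
qed

lemma power2_norm_vec: "(norm y)\<^sup>2 = (\<Sum>k\<in>UNIV. (norm (y $ k))\<^sup>2)" for y :: "'a::real_normed_vector^'m::finite"
  by (simp add: norm_vec_def L2_set_def sum_nonneg)

text \<open>As \<open>- s - 1\<close> is \<open>\<alpha> - 1\<close> minus \<open>m * n\<close>, the
  power of order \<open>- m * n\<close> is shared out as \<open>1 / t ^ n\<close> to each of the m
  Gaussians, which become the dilates that occur in \<open>heat\<close>.\<close>

lemma gaussian_vec_prod:
  fixes y :: "(real^'n)^'m::finite"
  assumes t: "0 < t" and s: "s = real (CARD('m) * CARD('n)) - \<alpha>"
  shows "t powr (- s - 1) * exp (- ((norm y)\<^sup>2 / t\<^sup>2)) =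
    t powr (\<alpha> - 1) * (\<Prod>k\<in>UNIV. exp (- ((norm (y $ k))\<^sup>2 / t\<^sup>2)) / t ^ CARD('n))"
proof -
  have "- s - 1 = (\<alpha> - 1) - real (CARD('m) * CARD('n))" by (simp add: s)
  then have "t powr (- s - 1) = t powr (\<alpha> - 1) / t powr real (CARD('m) * CARD('n))"
    by (simp only: powr_diff)
  also have "t powr real (CARD('m) * CARD('n)) = (t ^ CARD('n)) ^ CARD('m)"
    using t by (simp add: powr_realpow power_mult[symmetric] mult.commute del: of_nat_mult)
  finally have 1: "t powr (- s - 1) = t powr (\<alpha> - 1) / (t ^ CARD('n)) ^ CARD('m)" .
  have "exp (- ((norm y)\<^sup>2 / t\<^sup>2)) = (\<Prod>k\<in>UNIV. exp (- ((norm (y $ k))\<^sup>2 / t\<^sup>2)))"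
    by (simp add: power2_norm_vec sum_divide_distrib exp_sum[symmetric] sum_negf)
  then show ?thesis unfolding 1 by (simp add: prod_dividef)
qed

text \<open>Absolute integrability comes from \<open>hedberg\<close> again, with both rates equal to
  \<open>s\<close>. For fixed \<open>t\<close> the integral over \<open>y\<close> is a product: the
  integral of the dilated Gaussian bounds each factor uniformly in \<open>t\<close>, and the bounded
  support of \<open>h k\<close> bounds it by a multiple of \<open>1 / t ^ n\<close>, in total
  \<open>t powr (- (s + \<alpha>))\<close>.\<close>

lemma riesz_fubini_integrable:
  fixes h :: "'m::finite \<Rightarrow> real^'n::finite \<Rightarrow> complex"
  assumes [measurable]: "\<And>k. h k \<in> borel_measurable borel" and B: "\<And>k z. cmod (h k z) \<le> B"
    and R: "\<And>k z. R < norm z \<Longrightarrow> h k z = 0" and "0 \<le> B" "0 \<le> R"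
    and \<alpha>: "0 < \<alpha>" "\<alpha> < real (CARD('m) * CARD('n))" and s: "s = real (CARD('m) * CARD('n)) - \<alpha>"
  shows "integrable (lborel \<Otimes>\<^sub>M lborel) (\<lambda>(t, y :: (real^'n)^'m).
     complex_of_real (indicator {0<..} t * (t powr (- s - 1) * exp (- ((norm y)\<^sup>2 / t\<^sup>2)))) * (\<Prod>k\<in>UNIV. h k (x - y $ k)))"
    (is "integrable _ (\<lambda>(t, y). ?\<Psi> t y)")
proof (rule integrableI_bounded)
  let ?n = "CARD('n)" and ?m = "CARD('m)"
  have [measurable]: "(\<lambda>p. snd p $ k) \<in> borel_measurable (lborel \<Otimes>\<^sub>M (lborel :: ((real^'n)^'m) measure))" for k
    using measurable_compose[OF measurable_snd measurable_vec_nth_borel] by simp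
  show m: "(\<lambda>(t, y). ?\<Psi> t y) \<in> borel_measurable (lborel \<Otimes>\<^sub>M lborel)"
    unfolding case_prod_beta' by measurable
  define \<phi> where "\<phi> k t z = exp (- ((norm z)\<^sup>2 / t\<^sup>2)) / t ^ ?n * cmod (h k (x - z))" for k t and z :: "real^'n"
  have \<phi>m [measurable]: "\<phi> k t \<in> borel_measurable borel" for k t unfolding \<phi>_def by measurable
  have \<phi>0: "0 \<le> \<phi> k t z" if "0 < t" for k t z using that by (simp add: \<phi>_def)
  define \<Phi> where "\<Phi> t = (\<Prod>k\<in>UNIV. \<integral>\<^sup>+z. ennreal (\<phi> k t z) \<partial>lborel)" for t
  obtain S where S: "0 \<le> S" "\<And>z :: real^'n. exp (- (norm z)\<^sup>2) \<le> S * (1 + norm z) powr (- real (?n + 1))"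
  proof
    show "0 \<le> schwartz_norm (?n + 1) (gaussian :: real^'n \<Rightarrow> complex)" by (rule schwartz_norm_nonneg[OF gaussian_schwartz])
    fix z :: "real^'n"
    have z: "0 < 1 + norm z" by (simp add: add_pos_nonneg)
    have "(1 + norm z) ^ (?n + 1) * exp (- (norm z)\<^sup>2) \<le> schwartz_norm (?n + 1) (gaussian :: real^'n \<Rightarrow> complex)"
      using norm_le_schwartz_norm[OF gaussian_schwartz, of z "?n + 1"] by (simp add: gaussian_def)
    then show "exp (- (norm z)\<^sup>2) \<le> schwartz_norm (?n + 1) (gaussian :: real^'n \<Rightarrow> complex) * (1 + norm z) powr (- real (?n + 1))"
      using z powr_realpow[OF z, of "?n + 1"] unfolding powr_minus divide_inverse[symmetric]
      by (subst pos_le_divide_eq) (auto simp: mult.commute simp del: power_Suc)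
  qed
  define W where "W = enn2real (\<integral>\<^sup>+y. ennreal ((1 + norm (y::real^'n)) powr (- real (?n + 1))) \<partial>lborel)"
  have W: "(\<integral>\<^sup>+y. ennreal ((1 + norm (y::real^'n)) powr (- real (?n + 1))) \<partial>lborel) = ennreal W"
    unfolding W_def using nn_integral_weight_finite[where ?'n = 'n, of "real (?n + 1)"] by simp
  define V where "V = measure lborel (cball (0::real^'n) R)"
  have \<Phi>1: "\<Phi> t \<le> ennreal ((B * S * W) ^ ?m)" if t: "0 < t" for t
  proof -
    have "(\<integral>\<^sup>+z. ennreal (\<phi> k t z) \<partial>lborel) \<le> ennreal (B * S * W)" for k
    proof -
      have "\<phi> k t z \<le> B * S * (1 / t ^ ?n * (1 + norm ((0 - z) /\<^sub>R t)) powr (- real (?n + 1)))" for z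
      proof -
        have "exp (- ((norm z)\<^sup>2 / t\<^sup>2)) = exp (- (norm ((0 - z) /\<^sub>R t))\<^sup>2)"
          using t by (simp add: power_mult_distrib divide_inverse power_inverse mult.commute)
        also have "\<dots> \<le> S * (1 + norm ((0 - z) /\<^sub>R t)) powr (- real (?n + 1))" by (rule S)
        finally have "exp (- ((norm z)\<^sup>2 / t\<^sup>2)) / t ^ ?n * cmod (h k (x - z)) \<le> (S * (1 + norm ((0 - z) /\<^sub>R t)) powr (- real (?n + 1))) / t ^ ?n * B"
          using t S by (intro mult_mono divide_right_mono B) (auto intro!: divide_nonneg_nonneg mult_nonneg_nonneg)
        then show ?thesis by (simp add: \<phi>_def mult_ac)
      qed
      then have "(\<integral>\<^sup>+z. ennreal (\<phi> k t z) \<partial>lborel) \<le> (\<integral>\<^sup>+z. ennreal (B * S) * ennreal (1 / t ^ ?n * (1 + norm ((0 - (z::real^'n)) /\<^sub>R t)) powr (- real (?n + 1))) \<partial>lborel)"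
        using \<open>0 \<le> B\<close> S(1) by (intro nn_integral_mono) (simp add: ennreal_mult'[symmetric] ennreal_leI)
      also have "\<dots> = ennreal (B * S) * ennreal W"
        unfolding W[symmetric] nn_integral_dilate_weight[OF t, of 0, symmetric]
        by (rule nn_integral_cmult) measurable
      finally show ?thesis using \<open>0 \<le> B\<close> S(1) by (simp add: ennreal_mult')
    qed
    then have "\<Phi> t \<le> (\<Prod>k\<in>(UNIV::'m set). ennreal (B * S * W))"
      unfolding \<Phi>_def by (intro prod_mono_ennreal)
    then show ?thesis using \<open>0 \<le> B\<close> S(1) by (simp add: ennreal_power W_def)
  qed
  have \<Phi>2: "\<Phi> t \<le> ennreal ((B * V) ^ ?m * t powr (- (s + \<alpha>)))" if t: "0 < t" for t
  proof -
    have "(\<integral>\<^sup>+z. ennreal (\<phi> k t z) \<partial>lborel) \<le> ennreal (B * V / t ^ ?n)" for k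
    proof -
      have "ennreal (\<phi> k t z) \<le> ennreal (B / t ^ ?n) * indicator (cball (0::real^'n) R) (x - z)" for z
      proof (cases "norm (x - z) \<le> R")
        case True
        have "\<phi> k t z \<le> 1 / t ^ ?n * B"
          unfolding \<phi>_def using t by (intro mult_mono divide_right_mono B) auto
        then show ?thesis using True by (simp add: ennreal_leI)
      next
        case False
        then show ?thesis using R[of "x - z" k] by (simp add: \<phi>_def)
      qed
      then have "(\<integral>\<^sup>+z. ennreal (\<phi> k t z) \<partial>lborel) \<le> (\<integral>\<^sup>+z. ennreal (B / t ^ ?n) * indicator (cball (0::real^'n) R) (x - z) \<partial>lborel)"
        by (rule nn_integral_mono)
      also have "\<dots> = (\<integral>\<^sup>+z. ennreal (B / t ^ ?n) * indicator (cball (0::real^'n) R) z \<partial>lborel)"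
        by (rule nn_integral_reflect[symmetric])
           (intro borel_measurable_times_ennreal borel_measurable_const borel_measurable_indicator borel_closed closed_cball)
      also have "\<dots> = ennreal (B / t ^ ?n) * emeasure lborel (cball (0::real^'n) R)"
        by (rule nn_integral_cmult_indicator) simp
      also have "emeasure lborel (cball (0::real^'n) R) = ennreal V"
        unfolding V_def by (rule emeasure_eq_ennreal_measure) (use emeasure_lborel_cball_finite[of "0::real^'n" R] in \<open>auto simp: less_top[symmetric] infinity_ennreal_def\<close>)
      finally show ?thesis using \<open>0 \<le> B\<close> t by (simp add: ennreal_mult'[symmetric])
    qed
    then have "\<Phi> t \<le> (\<Prod>k\<in>(UNIV::'m set). ennreal (B * V / t ^ ?n))"
      unfolding \<Phi>_def by (intro prod_mono_ennreal)
    also have "\<dots> = ennreal ((B * V / t ^ ?n) ^ ?m)" using \<open>0 \<le> B\<close> t by (simp add: ennreal_power V_def)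
    also have "(B * V / t ^ ?n) ^ ?m = (B * V) ^ ?m * t powr (- (s + \<alpha>))"
    proof -
      have "s + \<alpha> = real (?n * ?m)" by (simp add: s)
      then have "t powr (- (s + \<alpha>)) = 1 / (t ^ ?n) ^ ?m"
        using t powr_realpow[OF t, of "?n * ?m"] by (simp only: powr_minus power_mult inverse_eq_divide)
      then show ?thesis by (simp add: power_divide)
    qed
    finally show ?thesis .
  qed
  have s0: "0 < s" using \<alpha> s by simp
  have "(\<integral>\<^sup>+p. ennreal (norm (case p of (t, y) \<Rightarrow> ?\<Psi> t y)) \<partial>(lborel \<Otimes>\<^sub>M lborel))
    = (\<integral>\<^sup>+t. \<integral>\<^sup>+y. ennreal (norm (?\<Psi> t y)) \<partial>lborel \<partial>lborel)"
    using m by (subst lborel.nn_integral_fst[symmetric]) (auto simp: case_prod_beta')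
  also have "\<dots> = (\<integral>\<^sup>+t. ennreal (t powr (\<alpha> - 1)) * \<Phi> t * indicator {0<..} t \<partial>lborel)"
  proof (rule nn_integral_cong)
    fix t :: real
    show "(\<integral>\<^sup>+y. ennreal (norm (?\<Psi> t y)) \<partial>lborel) = ennreal (t powr (\<alpha> - 1)) * \<Phi> t * indicator {0<..} t"
    proof (cases "0 < t")
      case t: True
      have "norm (?\<Psi> t y) = t powr (\<alpha> - 1) * (\<Prod>k\<in>UNIV. \<phi> k t (y $ k))" for y
      proof -
        have "norm (?\<Psi> t y) = (t powr (- s - 1) * exp (- ((norm y)\<^sup>2 / t\<^sup>2))) * (\<Prod>k\<in>UNIV. cmod (h k (x - y $ k)))"
          using t by (simp add: norm_mult prod_norm[symmetric])
        then show ?thesis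
          by (simp only: gaussian_vec_prod[OF t s] \<phi>_def prod.distrib mult.assoc)
      qed
      then have "ennreal (norm (?\<Psi> t y)) = ennreal (t powr (\<alpha> - 1)) * (\<Prod>k\<in>UNIV. ennreal (\<phi> k t (y $ k)))" for y
        by (simp add: prod_ennreal \<phi>0[OF t] ennreal_mult')
      then have "(\<integral>\<^sup>+y. ennreal (norm (?\<Psi> t y)) \<partial>lborel) = ennreal (t powr (\<alpha> - 1)) * (\<integral>\<^sup>+y. (\<Prod>k\<in>UNIV. ennreal (\<phi> k t (y $ k))) \<partial>(lborel :: ((real^'n)^'m) measure))"
        by (simp add: nn_integral_cmult)
      also have "(\<integral>\<^sup>+y. (\<Prod>k\<in>UNIV. ennreal (\<phi> k t (y $ k))) \<partial>(lborel :: ((real^'n)^'m) measure)) = \<Phi> t"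
        unfolding \<Phi>_def by (rule nn_integral_vec_prod) simp
      finally show ?thesis using t by simp
    qed simp
  qed
  also have "\<dots> \<le> ennreal ((1 / \<alpha> + 2 * ((B * V) ^ ?m) / s) * (if 1 \<le> (B * S * W) ^ ?m then ((B * S * W) ^ ?m) powr (s / (s + \<alpha>)) else ((B * S * W) ^ ?m) powr (s / (s + \<alpha>))))"
    using \<Phi>1 \<Phi>2 \<open>0 \<le> B\<close> S(1) s0 \<alpha>(1)
    by (intro hedberg) (auto simp: V_def W_def)
  also have "\<dots> < \<infinity>" by simp
  finally show "(\<integral>\<^sup>+p. ennreal (norm (case p of (t, y) \<Rightarrow> ?\<Psi> t y)) \<partial>(lborel \<Otimes>\<^sub>M lborel)) < \<infinity>" .
qed

text \<open>Fubini's theorem for the subordination formula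
  \<open>c * |y| powr (- s) = \<integral> t powr (- s - 1) * exp (- |y|^2 / t^2) dt\<close>: the Gaussian factorises over
  the components of \<open>y\<close>.\<close>

lemma riesz_operator_eq_frac_int:
  fixes f :: "'m::finite \<Rightarrow> real^'n::finite \<Rightarrow> complex"
  assumes f: "\<And>k. \<exists>R B. ess_bounded_on R B (f k)"
    and \<alpha>: "0 < \<alpha>" "\<alpha> < real (CARD('m) * CARD('n))"
  shows "riesz_operator \<alpha> (\<lambda>k. distribution_of (f k)) x = frac_int \<alpha> f x"
proof -
  let ?s = "real (CARD('m) * CARD('n)) - \<alpha>"
  have s0: "0 < ?s" using \<alpha> by simp
  obtain R B where RB: "\<And>k. ess_bounded_on (R k) (B k) (f k)" using f by metis
  define R' where "R' = (\<Sum>k\<in>UNIV. R k)"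
  define B' where "B' = (\<Sum>k\<in>UNIV. B k)"
  have pos: "0 \<le> R k" "0 \<le> B k" for k using RB[of k] by (auto simp: ess_bounded_on_def)
  have "R k \<le> R'" "B k \<le> B'" for k
    unfolding R'_def B'_def by (rule member_le_sum; use pos in auto)+
  then have RB': "ess_bounded_on R' B' (f k)" for k by (intro ess_bounded_on_mono[OF RB])
  have R'0: "0 \<le> R'" "0 \<le> B'" using pos by (auto simp: R'_def B'_def intro: sum_nonneg)
  \<comment> \<open>Fubini's theorem is applied to Borel representatives, with bounds common to the
    finitely many factors; the exchange back happens at the end.\<close>
  have "\<exists>h. h \<in> borel_measurable borel \<and> (\<forall>z. cmod (h z) \<le> B') \<and> (\<forall>z. R' < norm z \<longrightarrow> h z = 0) \<and> (AE z in lebesgue. f k z = h z)" for k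
    using ess_bounded_on_borel_version[OF RB'[of k]] by metis
  then obtain h where h[measurable]: "\<And>k. h k \<in> borel_measurable borel" and hB: "\<And>k z. cmod (h k z) \<le> B'"
    and hR: "\<And>k z. R' < norm z \<Longrightarrow> h k z = 0" and ae: "\<And>k. AE z in lebesgue. f k z = h k z" by metis
  have fm: "f k \<in> borel_measurable lebesgue" for k using RB[of k] by (simp add: ess_bounded_on_def)
  let ?H = "\<lambda>y :: (real^'n)^'m. \<Prod>k\<in>UNIV. h k (x - y $ k)"
  let ?\<Psi> = "\<lambda>t y. complex_of_real (indicator {0<..} t * (t powr (- ?s - 1) * exp (- ((norm y)\<^sup>2 / t\<^sup>2)))) * ?H y"
  have int: "integrable (lborel \<Otimes>\<^sub>M lborel) (\<lambda>(t, y). ?\<Psi> t y)"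
    by (rule riesz_fubini_integrable[OF h hB hR R'0(2,1) \<alpha> refl])
  have t_side: "(\<integral>y. ?\<Psi> t y \<partial>lborel) = complex_of_real (t powr (\<alpha> - 1)) * (\<Prod>k\<in>UNIV. heat (distribution_of (f k)) x t)" for t
  proof (cases "0 < t")
    case t: True
    let ?g = "\<lambda>k z. complex_of_real (exp (- ((norm z)\<^sup>2 / t\<^sup>2)) / t ^ CARD('n)) * h k (x - z)"
    have gint: "integrable lborel (?g k)" for k
    proof (rule Bochner_Integration.integrable_bound)
      show "integrable lborel (\<lambda>z. B' / t ^ CARD('n) * indicator (cball x R') z)"
        using emeasure_lborel_cball_finite[of x R'] by simp
      show "AE z in lborel. norm (?g k z) \<le> norm (B' / t ^ CARD('n) * indicator (cball x R') z)"
      proof (rule AE_I2)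
        fix z
        show "norm (?g k z) \<le> norm (B' / t ^ CARD('n) * indicator (cball x R') z)"
        proof (cases "norm (x - z) \<le> R'")
          case True
          have "exp (- ((norm z)\<^sup>2 / t\<^sup>2)) / t ^ CARD('n) * cmod (h k (x - z)) \<le> 1 / t ^ CARD('n) * B'"
            using t by (intro mult_mono divide_right_mono hB) auto
          then show ?thesis using True t R'0 by (simp add: norm_mult norm_divide norm_power dist_norm)
        next
          case False
          then show ?thesis using hR[of "x - z" k] by simp
        qed
      qed
    qed measurable
    have "?\<Psi> t y = complex_of_real (t powr (\<alpha> - 1)) * (\<Prod>k\<in>UNIV. ?g k (y $ k))" for y
      using t by (simp only: gaussian_vec_prod[OF t refl] prod.distrib of_real_mult of_real_prod indicator_simps greaterThan_iff of_real_1 mult_1_left mult.assoc)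
    then have "(\<integral>y. ?\<Psi> t y \<partial>lborel) = complex_of_real (t powr (\<alpha> - 1)) * (\<integral>y. (\<Prod>k\<in>UNIV. ?g k (y $ k)) \<partial>(lborel :: ((real^'n)^'m) measure))"
      by simp
    also have "(\<integral>y. (\<Prod>k\<in>UNIV. ?g k (y $ k)) \<partial>(lborel :: ((real^'n)^'m) measure)) = (\<Prod>k\<in>UNIV. \<integral>z. ?g k z \<partial>lborel)"
      by (rule integral_vec_prod[OF gint])
    finally show ?thesis by (simp only: heat_distribution_of[OF fm h ae t])
  next
    case False
    then show ?thesis by (simp add: heat_def)
  qed
  \<comment> \<open>\<open>riesz_kernel_integral\<close> requires a positive radius; the origin is a
    null set and is discarded below.\<close>
  have y_side: "(\<integral>t. ?\<Psi> t y \<partial>lborel) = complex_of_real (riesz_const ?s * (1 / norm y powr ?s)) * ?H y" if "y \<noteq> 0" for y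
  proof -
    have "(\<integral>t. complex_of_real (g t) * c \<partial>lborel) = complex_of_real (\<integral>t. g t \<partial>lborel) * c" for g :: "real \<Rightarrow> real" and c
      by simp
    then have "(\<integral>t. ?\<Psi> t y \<partial>lborel) = complex_of_real (\<integral>t. indicator {0<..} t * (t powr (- ?s - 1) * exp (- ((norm y)\<^sup>2 / t\<^sup>2))) \<partial>lborel) * ?H y" .
    also have "(\<integral>t. indicator {0<..} t * (t powr (- ?s - 1) * exp (- ((norm y)\<^sup>2 / t\<^sup>2))) \<partial>lborel) = riesz_const ?s * norm y powr (- ?s)"
      by (rule riesz_kernel_integral[OF s0]) (use that in simp)
    finally show ?thesis by (simp only: powr_minus inverse_eq_divide)
  qed
  have Hm [measurable]: "?H \<in> borel_measurable borel" by measurable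
  have km [measurable]: "(\<lambda>y :: (real^'n)^'m. complex_of_real (1 / norm y powr ?s) * ?H y) \<in> borel_measurable borel" by measurable
  have "(\<integral>t. complex_of_real (t powr (\<alpha> - 1)) * (\<Prod>k\<in>UNIV. heat (distribution_of (f k)) x t) \<partial>lborel) = (\<integral>y. (\<integral>t. ?\<Psi> t y \<partial>lborel) \<partial>lborel)"
    unfolding t_side[symmetric] by (rule lborel_pair.Fubini_integral[OF int, symmetric])
  also have "\<dots> = (\<integral>y. complex_of_real (riesz_const ?s) * (complex_of_real (1 / norm y powr ?s) * ?H y) \<partial>lborel)"
  proof (rule integral_cong_AE)
    show "(\<lambda>y. \<integral>t. ?\<Psi> t y \<partial>lborel) \<in> borel_measurable lborel"
      using lborel_pair.integrable_snd[OF int] by (rule borel_measurable_integrable)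
    have "AE y in (lborel :: ((real^'n)^'m) measure). y \<noteq> 0" by (rule AE_lborel_singleton)
    then show "AE y in lborel. (\<integral>t. ?\<Psi> t y \<partial>lborel) = complex_of_real (riesz_const ?s) * (complex_of_real (1 / norm y powr ?s) * ?H y)"
    proof eventually_elim
      case (elim y)
      show ?case unfolding y_side[OF elim] by (simp only: of_real_mult mult.assoc)
    qed
  qed measurable
  also have "\<dots> = complex_of_real (riesz_const ?s) * (\<integral>y. complex_of_real (1 / norm y powr ?s) * ?H y \<partial>lborel)"
    by (rule integral_mult_right_zero)
  also have "(\<integral>y. complex_of_real (1 / norm y powr ?s) * ?H y \<partial>lborel) = (\<integral>y. complex_of_real (1 / norm y powr ?s) * ?H y \<partial>lebesgue)"
    by (rule integral_completion[symmetric]) simp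
  also have "\<dots> = frac_int \<alpha> f x"
    unfolding frac_int_def
  proof (rule integral_cong_AE)
    show 1: "(\<lambda>y. complex_of_real (1 / norm y powr ?s) * ?H y) \<in> borel_measurable lebesgue"
      using km by (simp add: measurable_completion)
    have "AE z in lborel. f k z = h k z" for k using ae[of k] by (simp add: AE_completion_iff)
    then have "AE y in (lborel :: ((real^'n)^'m) measure). \<forall>k. f k (x - y $ k) = h k (x - y $ k)"
      unfolding AE_all_countable
      using AE_vec_component[where P = "\<lambda>z. f _ z = h _ z" and x = x] by blast
    then have "AE y in (lebesgue :: ((real^'n)^'m) measure). \<forall>k. f k (x - y $ k) = h k (x - y $ k)"
      by (rule AE_completion)
    then show 2: "AE y in lebesgue. complex_of_real (1 / norm y powr ?s) * ?H y = complex_of_real (1 / norm y powr ?s) * (\<Prod>k\<in>UNIV. f k (x - y $ k))"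
      by eventually_elim simp
    show "(\<lambda>y. complex_of_real (1 / norm y powr ?s) * (\<Prod>k\<in>UNIV. f k (x - y $ k))) \<in> borel_measurable lebesgue"
      by (rule lebesgue_measurable_cong_AE[OF 1 2])
  qed
  finally show ?thesis using riesz_const_pos[OF s0] by (simp add: riesz_operator_def)
qed

section \<open>The extended operator\<close>

text \<open>The least \<open>g\<close> admissible in \<open>riesz_average_modular\<close>. It takes
  the place of the grand maximal function there because its measurability comes for free, and for
  heat extensions it is at most a multiple of the grand maximal function.\<close>

definition nontangential :: "(real^'n \<Rightarrow> real \<Rightarrow> ennreal) \<Rightarrow> real^'n \<Rightarrow> ennreal" where
  "nontangential u y = (SUP (x, t) \<in> {(x, t). 0 < t \<and> dist x y < t}. u x t)"

text \<open>Each superlevel set is a union of balls, hence open.\<close>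

lemma nontangential_measurable: "nontangential u \<in> borel_measurable lebesgue"
proof -
  have "{y. c < nontangential u y} = (\<Union>(x, t) \<in> {(x, t). 0 < t \<and> c < u x t}. ball x t)" for c
    by (auto simp: nontangential_def less_SUP_iff) blast
  then have "open {y. c < nontangential u y}" for c by auto
  then have "nontangential u \<in> borel_measurable borel"
    by (intro borel_measurableI_greater) (auto intro: borel_open)
  then show ?thesis by (simp add: measurable_completion)
qed

lemma le_nontangential: "0 < t \<Longrightarrow> dist x y < t \<Longrightarrow> u x t \<le> nontangential u y"
  unfolding nontangential_def by (rule SUP_upper2[of "(x, t)"]) auto

lemma heat_zero: "t \<le> 0 \<Longrightarrow> heat u x t = 0"
  by (simp add: heat_def)

section \<open>Measurability, integrability and pointwise domination of the extended
  operator\<close>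

abbreviation heat_average :: "real \<Rightarrow> ('m::finite \<Rightarrow> 'n::finite functional) \<Rightarrow> real^'n \<Rightarrow> ennreal" where
  "heat_average \<alpha> F \<equiv> riesz_average \<alpha> (\<lambda>k x t. ennreal (cmod (heat (F k) x t)))"

lemma riesz_integrand_measurable:
  fixes F :: "'m::finite \<Rightarrow> 'n::finite functional"
  assumes "\<And>k. F k \<in> tempered"
  shows "(\<lambda>(x, t). complex_of_real (t powr (\<alpha> - 1)) * (\<Prod>k\<in>UNIV. heat (F k) x t)) \<in> borel_measurable (borel \<Otimes>\<^sub>M lborel)"
proof -
  have "(\<lambda>p. heat (F k) (fst p) (snd p)) \<in> borel_measurable (borel \<Otimes>\<^sub>M borel)" for k
    using heat_measurable[OF assms] by (simp add: borel_prod)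
  then have "(\<lambda>p. heat (F k) (fst p) (snd p)) \<in> borel_measurable (borel \<Otimes>\<^sub>M lborel)" for k
    by (subst measurable_cong_sets[OF sets_pair_measure_cong[OF refl sets_lborel] refl])
  then show ?thesis unfolding case_prod_beta' by measurable
qed

lemma heat_average_eq:
  fixes F :: "'m::finite \<Rightarrow> 'n::finite functional"
  shows "heat_average \<alpha> F x =
    (\<integral>\<^sup>+t. ennreal (cmod (complex_of_real (t powr (\<alpha> - 1)) * (\<Prod>k\<in>UNIV. heat (F k) x t))) \<partial>lborel)"
  unfolding riesz_average_def
proof (rule nn_integral_cong)
  fix t :: real
  show "ennreal (t powr (\<alpha> - 1)) * (\<Prod>k\<in>UNIV. ennreal (cmod (heat (F k) x t))) * indicator {0<..} t =
    ennreal (cmod (complex_of_real (t powr (\<alpha> - 1)) * (\<Prod>k\<in>UNIV. heat (F k) x t)))"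
  proof (cases "0 < t")
    case True
    then show ?thesis by (simp add: norm_mult prod_norm[symmetric] prod_ennreal ennreal_mult')
  next
    case False
    then show ?thesis by (simp add: heat_zero)
  qed
qed

lemma heat_average_measurable:
  fixes F :: "'m::finite \<Rightarrow> 'n::finite functional"
  assumes "\<And>k. F k \<in> tempered"
  shows "heat_average \<alpha> F \<in> borel_measurable lebesgue"
proof -
  have "heat_average \<alpha> F = (\<lambda>x. \<integral>\<^sup>+t. ennreal (cmod (complex_of_real (t powr (\<alpha> - 1)) * (\<Prod>k\<in>UNIV. heat (F k) x t))) \<partial>lborel)"
    by (rule ext) (rule heat_average_eq)
  also have "\<dots> \<in> borel_measurable borel"
    using riesz_integrand_measurable[where F = F and \<alpha> = \<alpha>, OF assms]
    by (intro lborel.borel_measurable_nn_integral) (simp add: case_prod_beta')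
  finally show ?thesis by (simp add: measurable_completion)
qed

lemma riesz_operator_measurable:
  fixes F :: "'m::finite \<Rightarrow> 'n::finite functional"
  assumes "\<And>k. F k \<in> tempered"
  shows "riesz_operator \<alpha> F \<in> borel_measurable lebesgue"
proof -
  have "(\<lambda>x. \<integral>t. complex_of_real (t powr (\<alpha> - 1)) * (\<Prod>k\<in>UNIV. heat (F k) x t) \<partial>lborel) \<in> borel_measurable borel"
    by (rule lborel.borel_measurable_lebesgue_integral[OF riesz_integrand_measurable[where F = F, OF assms]])
  then have "riesz_operator \<alpha> F \<in> borel_measurable borel"
    unfolding riesz_operator_def[abs_def] by (intro borel_measurable_times borel_measurable_const)
  then show ?thesis by (simp add: measurable_completion)
qed

lemma riesz_integrand_integrable:
  fixes F :: "'m::finite \<Rightarrow> 'n::finite functional"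
  assumes F: "\<And>k. F k \<in> tempered" and "heat_average \<alpha> F x < \<infinity>"
  shows "integrable lborel (\<lambda>t. complex_of_real (t powr (\<alpha> - 1)) * (\<Prod>k\<in>UNIV. heat (F k) x t))"
proof (rule integrableI_bounded)
  show "(\<lambda>t. complex_of_real (t powr (\<alpha> - 1)) * (\<Prod>k\<in>UNIV. heat (F k) x t)) \<in> borel_measurable lborel"
    using measurable_compose[OF measurable_Pair1' riesz_integrand_measurable[where F = F and \<alpha> = \<alpha>, OF F], of x] by simp
  show "(\<integral>\<^sup>+t. ennreal (cmod (complex_of_real (t powr (\<alpha> - 1)) * (\<Prod>k\<in>UNIV. heat (F k) x t))) \<partial>lborel) < \<infinity>"
    using assms(2) unfolding heat_average_eq .
qed

lemma cmod_riesz_operator_le: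
  fixes F :: "'m::finite \<Rightarrow> 'n::finite functional"
  assumes F: "\<And>k. F k \<in> tempered" and s: "0 < real (CARD('m) * CARD('n)) - \<alpha>"
  shows "cmod_fun (riesz_operator \<alpha> F) x \<le> ennreal (1 / riesz_const (real (CARD('m) * CARD('n)) - \<alpha>)) * heat_average \<alpha> F x"
proof -
  let ?K = "riesz_const (real (CARD('m) * CARD('n)) - \<alpha>)"
  let ?I = "\<integral>t. complex_of_real (t powr (\<alpha> - 1)) * (\<Prod>k\<in>UNIV. heat (F k) x t) \<partial>lborel"
  have K: "0 < ?K" by (rule riesz_const_pos[OF s])
  have "ennreal (cmod ?I) \<le> heat_average \<alpha> F x"
  proof (cases "heat_average \<alpha> F x < \<infinity>")
    case True
    from integral_norm_bound_ennreal[OF riesz_integrand_integrable[OF F True]]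
    show ?thesis by (simp only: heat_average_eq)
  qed (simp add: less_top[symmetric])
  then have "ennreal (1 / ?K) * ennreal (cmod ?I) \<le> ennreal (1 / ?K) * heat_average \<alpha> F x"
    by (rule mult_left_mono) simp
  moreover have "cmod_fun (riesz_operator \<alpha> F) x = ennreal (1 / ?K) * ennreal (cmod ?I)"
    using K unfolding cmod_fun_def riesz_operator_def norm_mult norm_of_real by (simp add: ennreal_mult'[symmetric])
  ultimately show ?thesis by simp
qed

text \<open>The infimum in the norm might not be attained, hence the strict inequality: some
  admissible divisor lies below \<open>l\<close>, and the modular decreases as the divisor
  grows.\<close>

lemma Lp_norm_less_imp_modular_le:
  assumes "Lp_norm p g < ennreal l" "\<And>x. 0 < p x"
  shows "modular p (\<lambda>x. g x / ennreal l) \<le> 1"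
proof -
  obtain l' where l': "0 < l'" "modular p (\<lambda>x. g x / ennreal l') \<le> 1" "ennreal l' < ennreal l"
    using assms(1) unfolding Lp_norm_def Inf_less_iff by auto
  have "g x / ennreal l \<le> g x / ennreal l'" for x
  proof -
    have "inverse (ennreal l) \<le> inverse (ennreal l')" 
    proof -
      have "l' < l" "0 < l" using l' by (auto simp: ennreal_less_iff)
      then show ?thesis using l'(1) by (simp add: inverse_ennreal ennreal_leI le_imp_inverse_le)
    qed
    then show ?thesis unfolding divide_ennreal_def by (intro mult_left_mono) auto
  qed
  then have "modular p (\<lambda>x. g x / ennreal l) \<le> modular p (\<lambda>x. g x / ennreal l')"
    by (intro modular_mono assms(2))
  with l'(2) show ?thesis by (rule order_trans[rotated])
qed

lemma riesz_average_divide: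
  fixes u :: "'m::finite \<Rightarrow> 'a \<Rightarrow> real \<Rightarrow> ennreal"
  assumes c: "\<And>k. 0 < c k" and um: "(\<lambda>t. ennreal (t powr (\<alpha> - 1)) * (\<Prod>k\<in>UNIV. u k x t) * indicator {0<..} t) \<in> borel_measurable lborel"
  shows "riesz_average \<alpha> (\<lambda>k x t. u k x t / ennreal (c k)) x = riesz_average \<alpha> u x / ennreal (\<Prod>k\<in>UNIV. c k)"
proof -
  have ic: "inverse (ennreal (c k)) = ennreal (inverse (c k))" for k using c[of k] by (simp add: inverse_ennreal)
  have "(\<Prod>k\<in>UNIV. u k x t / ennreal (c k)) = (\<Prod>k\<in>UNIV. u k x t) * ennreal (inverse (\<Prod>k\<in>UNIV. c k))" for t
    using c by (simp add: divide_ennreal_def ic prod.distrib prod_ennreal less_imp_le prod_inversef[symmetric])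
  moreover have "inverse (ennreal (\<Prod>k\<in>UNIV. c k)) = ennreal (inverse (\<Prod>k\<in>UNIV. c k))"
    using c by (intro inverse_ennreal prod_pos) auto
  ultimately show ?thesis
    unfolding riesz_average_def divide_ennreal_def[of "nn_integral _ _"]
    by (simp only:) (subst nn_integral_multc[OF um, symmetric], simp add: mult_ac)
qed

text \<open>A Bochner integral is additive on integrable functions, which is what finite heat
  averages guarantee. They are finite almost everywhere, so additivity of the operator is an almost
  everywhere statement.\<close>

lemma riesz_operator_linear:
  fixes F :: "'m::finite \<Rightarrow> 'n::finite functional"
  assumes F: "\<And>j. F j \<in> tempered" and G: "G \<in> tempered"
    and fin: "heat_average \<alpha> F x < \<infinity>" "heat_average \<alpha> (F(k := G)) x < \<infinity>"
  shows "riesz_operator \<alpha> (F(k := \<lambda>\<phi>. F k \<phi> + G \<phi>)) x = riesz_operator \<alpha> F x + riesz_operator \<alpha> (F(k := G)) x"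
proof -
  have split: "(\<Prod>j\<in>UNIV. heat ((F(k := H)) j) x t) = heat H x t * (\<Prod>j\<in>UNIV - {k}. heat (F j) x t)" for H t
    by (subst prod.remove[of UNIV k]) (auto intro!: arg_cong2[where f = "(*)"] prod.cong)
  have base: "(\<Prod>j\<in>UNIV. heat (F j) x t) = heat (F k) x t * (\<Prod>j\<in>UNIV - {k}. heat (F j) x t)" for t
    by (rule prod.remove) auto
  have add: "heat (\<lambda>\<phi>. F k \<phi> + G \<phi>) x t = heat (F k) x t + heat G x t" for t
    by (simp add: heat_def convolve_def)
  have "(\<Prod>j\<in>UNIV. heat ((F(k := \<lambda>\<phi>. F k \<phi> + G \<phi>)) j) x t) =
      (\<Prod>j\<in>UNIV. heat (F j) x t) + (\<Prod>j\<in>UNIV. heat ((F(k := G)) j) x t)" for t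
    unfolding split add base by (simp add: distrib_right)
  moreover have "integrable lborel (\<lambda>t. complex_of_real (t powr (\<alpha> - 1)) * (\<Prod>j\<in>UNIV. heat (F j) x t))"
    by (rule riesz_integrand_integrable[OF F fin(1)])
  moreover have "integrable lborel (\<lambda>t. complex_of_real (t powr (\<alpha> - 1)) * (\<Prod>j\<in>UNIV. heat ((F(k := G)) j) x t))"
    by (rule riesz_integrand_integrable[OF _ fin(2)]) (use F G in auto)
  ultimately show ?thesis
    unfolding riesz_operator_def by (simp add: distrib_left del: fun_upd_apply)
qed

text \<open>Scalars leave a Bochner integral even when it diverges, so this holds at every
  point.\<close>

lemma riesz_operator_scale:
  fixes F :: "'m::finite \<Rightarrow> 'n::finite functional"
  shows "riesz_operator \<alpha> (F(k := \<lambda>\<phi>. c * F k \<phi>)) x = c * riesz_operator \<alpha> F x"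
proof -
  have split: "(\<Prod>j\<in>UNIV. heat ((F(k := H)) j) x t) = heat H x t * (\<Prod>j\<in>UNIV - {k}. heat (F j) x t)" for H t
    by (subst prod.remove[of UNIV k]) (auto intro!: arg_cong2[where f = "(*)"] prod.cong)
  have base: "(\<Prod>j\<in>UNIV. heat (F j) x t) = heat (F k) x t * (\<Prod>j\<in>UNIV - {k}. heat (F j) x t)" for t
    by (rule prod.remove) auto
  have "heat (\<lambda>\<phi>. c * F k \<phi>) x t = c * heat (F k) x t" for t
    by (simp add: heat_def convolve_def)
  then have "(\<Prod>j\<in>UNIV. heat ((F(k := \<lambda>\<phi>. c * F k \<phi>)) j) x t) = c * (\<Prod>j\<in>UNIV. heat (F j) x t)" for t
    unfolding split base by (simp add: mult.assoc)
  then show ?thesis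
    unfolding riesz_operator_def by (simp add: mult.left_commute del: fun_upd_apply)
qed

text \<open>A Hardy norm may be 0 and then cannot serve as a divisor, so the estimate is first
  obtained for numbers slightly above the norms; letting \<delta> tend to 0 recovers the product of
  the norms.\<close>

lemma le_prod_of_le_shifted:
  fixes h :: "'m::finite \<Rightarrow> real"
  assumes "\<And>\<delta>. 0 < \<delta> \<Longrightarrow> v \<le> ennreal (M * (\<Prod>k\<in>UNIV. (h k + \<delta>)))"
  shows "v \<le> ennreal (M * (\<Prod>k\<in>UNIV. h k))"
proof -
  have "(\<lambda>j. 1 / real (Suc j)) \<longlonglongrightarrow> 0" by (rule LIMSEQ_Suc[OF lim_1_over_n])
  then have "(\<lambda>j. ennreal (M * (\<Prod>k\<in>UNIV. (h k + 1 / real (Suc j))))) \<longlonglongrightarrow> ennreal (M * (\<Prod>k\<in>UNIV. (h k + 0)))"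
    by (intro tendsto_intros tendsto_prod)
  then show ?thesis
    by (intro LIMSEQ_le_const[where X = "\<lambda>j. ennreal (M * (\<Prod>k\<in>UNIV. (h k + 1 / real (Suc j))))"])
       (auto intro!: exI[of _ 0] assms)
qed

text \<open>Each heat extension is divided by a multiple of a number \<open>l k\<close> above its
  Hardy norm, so that its nontangential maximal function has modular at most 1 and
  \<open>riesz_average_modular\<close> applies; homogeneity in each factor restores the product of
  the \<open>l k\<close>.\<close>

lemma riesz_operator_Hardy_bound:
  fixes p :: "'m::finite \<Rightarrow> real^'n::finite \<Rightarrow> real"
  assumes LH: "\<And>k. p k \<in> LH" and pm: "\<And>k. p k \<in> borel_measurable lebesgue"
    and a: "0 < a" "\<And>k x. a \<le> p k x" and P: "\<And>k x. p k x \<le> P k"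
    and \<alpha>: "0 < \<alpha>" "\<alpha> < real (CARD('m) * CARD('n))"
    and \<epsilon>: "0 < real CARD('n) * (\<Sum>k\<in>UNIV. 1 / P k) - \<alpha>"
    and q: "\<And>x. q x = real CARD('n) / (real CARD('n) * (\<Sum>k\<in>UNIV. 1 / p k x) - \<alpha>)"
  obtains C where "0 < C"
    "\<And>F. (\<And>k. F k \<in> Hardy_space N (p k)) \<Longrightarrow>
      (AE x in lebesgue. heat_average \<alpha> F x < \<infinity>) \<and> riesz_operator \<alpha> F \<in> Lp_space q \<and>
      Lp_norm q (cmod_fun (riesz_operator \<alpha> F)) \<le> ennreal C * (\<Prod>k\<in>UNIV. Hardy_norm N (p k) (F k))"
proof -
  let ?s = "real (CARD('m) * CARD('n)) - \<alpha>"
  have s: "0 < ?s" using \<alpha> by simp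
  have K: "0 < riesz_const ?s" by (rule riesz_const_pos[OF s])
  have p0: "0 < p k x" for k x using a(1) a(2)[of k x] by linarith
  obtain C1 where C1: "0 < C1"
    and avg: "\<And>u g. (\<And>k. g k \<in> borel_measurable lebesgue) \<Longrightarrow> (\<And>k. modular (p k) (g k) \<le> 1) \<Longrightarrow>
       (\<And>k x y t. 0 < t \<Longrightarrow> dist x y < t \<Longrightarrow> u k x t \<le> g k y) \<Longrightarrow>
       riesz_average \<alpha> u \<in> borel_measurable lebesgue \<Longrightarrow>
       (AE x in lebesgue. riesz_average \<alpha> u x < \<infinity>) \<and> modular q (\<lambda>x. riesz_average \<alpha> u x / ennreal C1) \<le> 1"
    by (rule riesz_average_modular[OF LH pm a P \<alpha>(1) \<epsilon> order_refl q]) blast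
  obtain C0 where C0: "0 < C0"
    "\<And>u x y t. u \<in> tempered \<Longrightarrow> 0 < t \<Longrightarrow> dist x y \<le> t \<Longrightarrow>
       ennreal (cmod (convolve (dilate t gaussian) u x)) \<le> ennreal C0 * grand_maximal N u (y :: real^'n)"
    using convolve_le_grand_maximal[OF gaussian_schwartz] by metis
  \<comment> \<open>One factor \<open>C0\<close> per argument from the comparison with the grand
    maximal function, \<open>C1\<close> from the modular estimate, and the normalisation of the
    kernel.\<close>
  define C where "C = C1 * C0 ^ CARD('m) / riesz_const ?s"
  have C: "0 < C" using C1 C0 K by (simp add: C_def)
  have q0: "0 < q x" for x
  proof -
    have "1 / P k \<le> 1 / p k x" for k using p0 P by (intro frac_le) auto
    then have "real CARD('n) * (\<Sum>k\<in>UNIV. 1 / P k) \<le> real CARD('n) * (\<Sum>k\<in>UNIV. 1 / p k x)"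
      by (intro mult_left_mono sum_mono) auto
    then have "0 < real CARD('n) * (\<Sum>k\<in>UNIV. 1 / p k x) - \<alpha>" using \<epsilon> by linarith
    then show ?thesis unfolding q by (intro divide_pos_pos) auto
  qed
  have main: "(AE x in lebesgue. heat_average \<alpha> F x < \<infinity>) \<and>
      modular q (\<lambda>x. cmod_fun (riesz_operator \<alpha> F) x / ennreal (C * (\<Prod>k\<in>UNIV. l k))) \<le> 1"
    if F: "\<And>k. F k \<in> tempered" and l: "\<And>k. Hardy_norm N (p k) (F k) < ennreal (l k)" for F l
  proof -
    have l0: "0 < l k" for k
      using l[of k] by (metis ennreal_less_zero_iff le_less_trans zero_le)
    let ?u = "\<lambda>k x t. ennreal (cmod (heat (F k) x t))"
    define c where "c k = C0 * l k" for k
    have c0: "0 < c k" for k using C0(1) l0 by (simp add: c_def)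
    let ?v = "\<lambda>k x t. ?u k x t / ennreal (c k)"
    have "nontangential (?v k) y \<le> grand_maximal N (F k) y / ennreal (l k)" for k y
      unfolding nontangential_def
    proof (rule SUP_least, clarify)
      fix x t assume t: "0 < t" "dist x y < t"
      have "?u k x t \<le> ennreal C0 * grand_maximal N (F k) y"
        using C0(2)[OF F t(1), of x y] t by (simp add: heat_def)
      then have "?v k x t \<le> ennreal C0 * grand_maximal N (F k) y / ennreal (c k)"
        by (rule divide_right_mono_ennreal)
      also have "\<dots> = grand_maximal N (F k) y / ennreal (l k)"
      proof -
        have "ennreal C0 * inverse (ennreal (c k)) = inverse (ennreal (l k))"
          using C0(1) l0[of k] c0[of k] by (simp add: c_def inverse_ennreal ennreal_mult'[symmetric])
        then show ?thesis unfolding divide_ennreal_def by (metis mult.assoc mult.commute)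
      qed
      finally show "?v k x t \<le> grand_maximal N (F k) y / ennreal (l k)" .
    qed
    then have "modular (p k) (nontangential (?v k)) \<le> modular (p k) (\<lambda>y. grand_maximal N (F k) y / ennreal (l k))" for k
      by (intro modular_mono p0)
    also have "\<dots> k \<le> 1" for k
      using l[of k] unfolding Hardy_norm_def by (intro Lp_norm_less_imp_modular_le p0)
    finally have mod: "modular (p k) (nontangential (?v k)) \<le> 1" for k .
    have slice: "(\<lambda>t. ennreal (t powr (\<alpha> - 1)) * (\<Prod>k\<in>UNIV. ?u k x t) * indicator {0<..} t) \<in> borel_measurable lborel" for x
    proof -
      have "(\<lambda>t. heat (F k) x t) \<in> borel_measurable borel" for k
        using measurable_compose[OF _ heat_measurable[OF F], of "\<lambda>t. (x, t)" borel]
        by (simp add: borel_measurable_continuous_onI continuous_on_Pair continuous_on_const continuous_on_id)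
      then show ?thesis by measurable
    qed
    have div: "riesz_average \<alpha> ?v x = heat_average \<alpha> F x / ennreal (\<Prod>k\<in>UNIV. c k)" for x
      by (rule riesz_average_divide[OF c0 slice])
    have am: "heat_average \<alpha> F \<in> borel_measurable lebesgue" by (rule heat_average_measurable[OF F])
    have "riesz_average \<alpha> ?v \<in> borel_measurable lebesgue"
      unfolding div[abs_def] using am by measurable
    from avg[OF nontangential_measurable mod le_nontangential this]
    have avg': "AE x in lebesgue. riesz_average \<alpha> ?v x < \<infinity>" "modular q (\<lambda>x. riesz_average \<alpha> ?v x / ennreal C1) \<le> 1"
      by auto
    have pc: "0 < (\<Prod>k\<in>UNIV. c k)" using c0 by (intro prod_pos) auto
    have "AE x in lebesgue. heat_average \<alpha> F x < \<infinity>"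
      using avg'(1)
    proof eventually_elim
      case (elim x)
      have "heat_average \<alpha> F x \<noteq> top"
      proof
        assume "heat_average \<alpha> F x = top"
        then have "riesz_average \<alpha> ?v x = top" using pc unfolding div by (simp add: ennreal_top_divide)
        with elim show False by simp
      qed
      then show ?case by (simp add: less_top)
    qed
    moreover have "modular q (\<lambda>x. cmod_fun (riesz_operator \<alpha> F) x / ennreal (C * (\<Prod>k\<in>UNIV. l k))) \<le> modular q (\<lambda>x. riesz_average \<alpha> ?v x / ennreal C1)"
    proof (rule modular_mono[OF q0])
      fix x
      have "cmod_fun (riesz_operator \<alpha> F) x / ennreal (C * (\<Prod>k\<in>UNIV. l k)) \<le> ennreal (1 / riesz_const ?s) * heat_average \<alpha> F x / ennreal (C * (\<Prod>k\<in>UNIV. l k))"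
        by (rule divide_right_mono_ennreal[OF cmod_riesz_operator_le[OF F s]])
      also have "\<dots> = heat_average \<alpha> F x / ennreal (\<Prod>k\<in>UNIV. c k) / ennreal C1"
      proof -
        have pl: "0 < (\<Prod>k\<in>UNIV. l k)" using l0 by (intro prod_pos) auto
        have "(\<Prod>k\<in>UNIV. c k) = C0 ^ CARD('m) * (\<Prod>k\<in>UNIV. l k)" by (simp add: c_def prod.distrib)
        then have "1 / riesz_const ?s * inverse (C * (\<Prod>k\<in>UNIV. l k)) = inverse (\<Prod>k\<in>UNIV. c k) * inverse C1"
          using K C1 C0(1) pl by (simp add: C_def field_simps)
        then have e: "ennreal (1 / riesz_const ?s) * inverse (ennreal (C * (\<Prod>k\<in>UNIV. l k))) = inverse (ennreal (\<Prod>k\<in>UNIV. c k)) * inverse (ennreal C1)"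
          using K C C1 pl pc by (simp add: inverse_ennreal ennreal_mult'[symmetric] del: inverse_mult_distrib)
        have rearrange: "A * H * I = H * J * L" if "A * I = J * L" for A H I J L :: ennreal
        proof -
          have "A * H * I = H * (A * I)" by (simp only: mult_ac)
          then show ?thesis unfolding that by (simp only: mult.assoc)
        qed
        show ?thesis unfolding divide_ennreal_def by (rule rearrange[OF e])
      qed
      finally show "cmod_fun (riesz_operator \<alpha> F) x / ennreal (C * (\<Prod>k\<in>UNIV. l k)) \<le> riesz_average \<alpha> ?v x / ennreal C1"
        unfolding div .
    qed
    ultimately show ?thesis using avg'(2) order_trans by blast
  qed
  show thesis
  proof (rule that[OF C])
    fix F :: "'m \<Rightarrow> 'n functional" assume H: "\<And>k. F k \<in> Hardy_space N (p k)"
    have F: "F k \<in> tempered" for k using H[of k] by (simp add: Hardy_space_def)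
    define h where "h k = enn2real (Hardy_norm N (p k) (F k))" for k
    have h: "Hardy_norm N (p k) (F k) = ennreal (h k)" "0 \<le> h k" for k
      using H[of k] by (auto simp: Hardy_space_def h_def)
    have l: "Hardy_norm N (p k) (F k) < ennreal (h k + \<delta>)" if "0 < \<delta>" for k \<delta>
      using that h by (simp add: ennreal_less_iff)
    have norm_le: "Lp_norm q (cmod_fun (riesz_operator \<alpha> F)) \<le> ennreal (C * (\<Prod>k\<in>UNIV. (h k + \<delta>)))" if \<delta>: "0 < \<delta>" for \<delta>
    proof -
      have "0 < C * (\<Prod>k\<in>UNIV. (h k + \<delta>))"
        using C h \<delta> by (intro mult_pos_pos prod_pos) (auto intro: add_nonneg_pos)
      then show ?thesis
        unfolding Lp_norm_def using main[OF F l[OF \<delta>]] by (intro Inf_lower) auto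
    qed
    have "Lp_norm q (cmod_fun (riesz_operator \<alpha> F)) \<le> ennreal (C * (\<Prod>k\<in>UNIV. h k))"
      by (rule le_prod_of_le_shifted[OF norm_le])
    also have "\<dots> = ennreal C * (\<Prod>k\<in>UNIV. Hardy_norm N (p k) (F k))"
      using C h by (simp add: ennreal_mult' prod_ennreal)
    finally have bound: "Lp_norm q (cmod_fun (riesz_operator \<alpha> F)) \<le> ennreal C * (\<Prod>k\<in>UNIV. Hardy_norm N (p k) (F k))" .
    \<comment> \<open>Membership in \<open>Lp_space q\<close> asks for one scaling with finite
      modular; the shift by 1 supplies it and keeps \<open>L\<close> positive even if some norm is
      0.\<close>
    define L where "L = C * (\<Prod>k\<in>UNIV. (h k + 1))"
    have L: "0 < L" unfolding L_def
      using C h by (intro mult_pos_pos prod_pos) (auto intro: add_nonneg_pos)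
    have "modular q (\<lambda>x. ennreal (1 / L) * cmod_fun (riesz_operator \<alpha> F) x) \<le> 1"
    proof -
      have "ennreal (1 / L) * cmod_fun (riesz_operator \<alpha> F) x = cmod_fun (riesz_operator \<alpha> F) x / ennreal L" for x
        using L by (simp add: divide_ennreal_def inverse_ennreal inverse_eq_divide mult.commute)
      then show ?thesis using main[OF F l[of 1]] by (simp add: L_def)
    qed
    then have "modular q (\<lambda>x. ennreal (1 / L) * cmod_fun (riesz_operator \<alpha> F) x) < \<infinity>"
      by (rule order_le_less_trans) simp
    then have "riesz_operator \<alpha> F \<in> Lp_space q"
      unfolding Lp_space_def using riesz_operator_measurable[OF F] L by (auto intro!: exI[of _ "1 / L"])
    then show "(AE x in lebesgue. heat_average \<alpha> F x < \<infinity>) \<and> riesz_operator \<alpha> F \<in> Lp_space q \<and>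
      Lp_norm q (cmod_fun (riesz_operator \<alpha> F)) \<le> ennreal C * (\<Prod>k\<in>UNIV. Hardy_norm N (p k) (F k))"
      using bound main[OF F l[of 1]] by simp
  qed
qed

theorem theorem3p3:
  fixes p :: "'m::finite \<Rightarrow> real^'n::finite \<Rightarrow> real"
  assumes "\<And>k. variable_exponent (p k)"
    and "\<And>k. p k \<in> LH"
    and "\<And>k. 0 < exponent_inf (p k) \<and> exponent_inf (p k) \<le> exponent_sup (p k)
              \<and> exponent_sup (p k) < \<infinity>"
  shows "\<exists>N\<^sub>0. \<forall>N\<ge>N\<^sub>0. \<forall>\<alpha> q.
           0 < \<alpha> \<and> \<alpha> < real (CARD('m) * CARD('n)) \<and>
           ereal (\<alpha> / real CARD('n)) < (\<Sum>k\<in>UNIV. 1 / exponent_sup (p k)) \<and>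
           (\<forall>x. 1 / q x = (\<Sum>k\<in>UNIV. 1 / p k x) - \<alpha> / real CARD('n))
           \<longrightarrow> frac_int_extends_boundedly N \<alpha> p q"
proof -
  let ?n = "CARD('n)"
  have pm: "p k \<in> borel_measurable lebesgue" for k using assms(1)[of k] by (simp add: variable_exponent_def)
  have "\<exists>c>0. \<forall>x. c \<le> p k x" for k
  proof -
    have "0 < exponent_inf (p k)" using assms(3) by blast
    then obtain c where c: "0 < ereal c" "ereal c < exponent_inf (p k)"
      using ereal_dense2 by blast
    moreover have "exponent_inf (p k) \<le> ereal (p k x)" for x
      unfolding exponent_inf_def by (rule INF_lower) simp
    ultimately have "ereal c \<le> ereal (p k x)" for x by (meson less_imp_le order_trans)
    then show ?thesis using c by auto
  qed
  then obtain c where c: "\<And>k. 0 < c k" "\<And>k x. c k \<le> p k x" by metis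
  \<comment> \<open>There are finitely many exponents, so their positive lower bounds have a
    positive minimum.\<close>
  define a where "a = Min (range c)"
  have a: "0 < a" "\<And>k x. a \<le> p k x"
  proof -
    show "0 < a" unfolding a_def using c(1) by (subst Min_gr_iff) auto
    show "a \<le> p k x" for k x
    proof (rule order_trans[OF _ c(2)])
      show "a \<le> c k" unfolding a_def by (rule Min_le) auto
    qed
  qed
  have "\<exists>P. exponent_sup (p k) = ereal P" for k
    using assms(3)[of k] by (cases "exponent_sup (p k)") auto
  then obtain P where Ps: "\<And>k. exponent_sup (p k) = ereal (P k)" by metis
  have P: "p k x \<le> P k" for k x
  proof -
    have "ereal (p k x) \<le> exponent_sup (p k)" unfolding exponent_sup_def by (rule SUP_upper) simp
    then show ?thesis by (simp add: Ps)
  qed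
  have P0: "0 < P k" for k using a(1) a(2)[of k 0] P[of k 0] by linarith
  \<comment> \<open>Chosen so that the decay rate \<open>n + d + 1\<close> of maximal functions of
    atoms, multiplied by \<open>a\<close>, exceeds the dimension. The choice precedes \<alpha>,
    \<open>q\<close> and \<open>N\<close>, so \<open>n + d + 1\<close> is a common threshold for
    \<open>N\<close>.\<close>
  obtain d :: nat where d: "real ?n / a < real d" using reals_Archimedean2 by blast
  have "real d * a \<le> real (?n + d + 1) * a" using a(1) by (intro mult_right_mono) auto
  moreover have "real ?n < real d * a" using d a(1) by (simp add: field_simps)
  ultimately have d': "real ?n < real (?n + d + 1) * a" by (rule order_less_le_trans[rotated])
  show ?thesis
  proof (intro exI[of _ "?n + d + 1"] allI impI, elim conjE)
    fix N \<alpha> and q :: "real^'n \<Rightarrow> real"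
    assume N: "?n + d + 1 \<le> N" and \<alpha>: "0 < \<alpha>" "\<alpha> < real (CARD('m) * CARD('n))"
      and lt: "ereal (\<alpha> / real ?n) < (\<Sum>k\<in>UNIV. 1 / exponent_sup (p k))"
      and q: "\<forall>x. 1 / q x = (\<Sum>k\<in>UNIV. 1 / p k x) - \<alpha> / real ?n"
    have "1 / exponent_sup (p k) = ereal (1 / P k)" for k
      using P0[of k] by (simp add: Ps one_ereal_def)
    then have "(\<Sum>k\<in>UNIV. 1 / exponent_sup (p k)) = ereal (\<Sum>k\<in>UNIV. 1 / P k)"
      by (simp add: sum_ereal)
    then have "\<alpha> / real ?n < (\<Sum>k\<in>UNIV. 1 / P k)" using lt by simp
    then have \<epsilon>: "0 < real ?n * (\<Sum>k\<in>UNIV. 1 / P k) - \<alpha>" by (simp add: field_simps)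
    have q': "q x = real ?n / (real ?n * (\<Sum>k\<in>UNIV. 1 / p k x) - \<alpha>)" for x
    proof -
      have "q x = 1 / ((\<Sum>k\<in>UNIV. 1 / p k x) - \<alpha> / real ?n)"
        using q by (metis div_by_1 divide_divide_eq_right mult.left_neutral)
      also have "(\<Sum>k\<in>UNIV. 1 / p k x) - \<alpha> / real ?n = (real ?n * (\<Sum>k\<in>UNIV. 1 / p k x) - \<alpha>) / real ?n"
        by (simp add: diff_divide_distrib)
      finally show ?thesis by simp
    qed
    obtain C where C: "0 < C" and bound: "\<And>F. (\<And>k. F k \<in> Hardy_space N (p k)) \<Longrightarrow>
      (AE x in lebesgue. heat_average \<alpha> F x < \<infinity>) \<and> riesz_operator \<alpha> F \<in> Lp_space q \<and>
      Lp_norm q (cmod_fun (riesz_operator \<alpha> F)) \<le> ennreal C * (\<Prod>k\<in>UNIV. Hardy_norm N (p k) (F k))"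
      by (rule riesz_operator_Hardy_bound[OF assms(2) pm a P \<alpha> \<epsilon> q', of N]) blast
    have tempered: "u \<in> tempered" if "u \<in> Hardy_space N (p k)" for u k
      using that by (simp add: Hardy_space_def)
    show "frac_int_extends_boundedly N \<alpha> p q"
      unfolding frac_int_extends_boundedly_def
    proof (intro exI[of _ C] exI[of _ d] exI[of _ "riesz_operator \<alpha>"] conjI C allI impI)
      show "multilinear_ae (\<lambda>k. Hardy_space N (p k)) (riesz_operator \<alpha>)"
        unfolding multilinear_ae_def
      proof (intro allI impI conjI ballI)
        fix F :: "'m \<Rightarrow> 'n functional" and k G
        assume F: "\<forall>j. F j \<in> Hardy_space N (p j)" and G: "G \<in> Hardy_space N (p k)"
        have "AE x in lebesgue. heat_average \<alpha> F x < \<infinity>" "AE x in lebesgue. heat_average \<alpha> (F(k := G)) x < \<infinity>"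
          using bound[of F] bound[of "F(k := G)"] F G by auto
        then show "AE x in lebesgue. riesz_operator \<alpha> (F(k := \<lambda>\<phi>. F k \<phi> + G \<phi>)) x = riesz_operator \<alpha> F x + riesz_operator \<alpha> (F(k := G)) x"
          by eventually_elim (intro riesz_operator_linear; use F G tempered in blast)
      next
        fix F :: "'m \<Rightarrow> 'n functional" and k c
        show "AE x in lebesgue. riesz_operator \<alpha> (F(k := \<lambda>\<phi>. c * F k \<phi>)) x = c * riesz_operator \<alpha> F x"
          by (simp add: riesz_operator_scale)
      qed
    next
      fix F :: "'m \<Rightarrow> 'n functional" assume "\<forall>k. F k \<in> Hardy_space N (p k)"
      then show "riesz_operator \<alpha> F \<in> Lp_space q"
        "Lp_norm q (cmod_fun (riesz_operator \<alpha> F)) \<le> ennreal C * (\<Prod>k\<in>UNIV. Hardy_norm N (p k) (F k))"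
        using bound by blast+
    next
      fix f :: "'m \<Rightarrow> real^'n \<Rightarrow> complex" and k assume f: "\<forall>k. f k \<in> finite_atomic (p k) d"
      then show "distribution_of (f k) \<in> Hardy_space N (p k)"
        by (intro finite_atomic_in_Hardy_space[OF pm a P d' N]) blast
    next
      fix f :: "'m \<Rightarrow> real^'n \<Rightarrow> complex" assume f: "\<forall>k. f k \<in> finite_atomic (p k) d"
      have "\<exists>R B. ess_bounded_on R B (f k)" for k
      proof -
        have "f k \<in> finite_atomic (p k) d" using f by blast
        from finite_atomic_ess_bounded[OF a(2) a(1) this] show ?thesis by blast
      qed
      then show "AE x in lebesgue. riesz_operator \<alpha> (\<lambda>k. distribution_of (f k)) x = frac_int \<alpha> f x"
        by (simp add: riesz_operator_eq_frac_int[OF _ \<alpha>])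
    qed
  qed
qed

end
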